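(* Assume the Markov semigroup $(P_t)$ on the Polish space $(E,\rho)$ is Feller, and that: (1) there exist a measurable $V:E\to[0,\infty)$, a concave differentiable function $\phi:\mathbb R_+\to\mathbb R_+$ increasing to infinity with $\phi(0)=0$, and a constant $K>0$ such that $P_tV(x)\le V(x)-\int_0^tP_s(\phi\circ V)(x)\,ds+Kt$ for all $t\ge0$, $x\in E$; (2) $\rho\wedge1\le\theta$ for a premetric $\theta$; (3) Assumption A holds (with this $\theta$) for some functions $r,L$; (4) there exists $t_0>0$ such that for any $M>0$, Assumption B1 holds for $B=\{V\le M\}$ and $t_0$. Then $(P_t)$ has a unique invariant probability measure $\pi$, and for any $\delta\in(0,1)$ there exist constants $C_1,C_2>0$ such that for all $x\in E$ and $t\ge0$, $$W_{\rho\wedge1}(P_t(x,\cdot),\pi)\le\frac{C_1(1+\phi(V(x))^\delta)}{\phi(H_\phi^{-1}(C_2t))^\delta},$$ where $H_\phi(x):=\int_1^x\frac{du}{\phi(u)}$, $x\ge1$.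
   Context: $(E,\rho)$ is a Polish space with Borel $\sigma$-field $\mathcal E$; $\{P_t\}_{t\ge0}$ is a Markov transition function with semigroup $P_t\phi(x)=\int\phi(y)P_t(x,dy)$ and $\mathbb P_x$ the law of the corresponding Markov process started at $x$. Feller means $P_t$ maps bounded continuous functions to bounded continuous functions. A premetric is a lower semicontinuous $\theta:E\times E\to\mathbb R_+$ with $\theta(x,y)=0\iff x=y$. For a distance-like (symmetric, lower semicontinuous, vanishing exactly on the diagonal) or metric $d$, $W_d(\mu,\nu):=\inf\int d\,d\lambda$ over couplings $\lambda$ of $\mu,\nu$; $d_{TV}(\mu,\nu)=\sup_A|\mu(A)-\nu(A)|$. Assumption A: there exist a non-increasing $r:\mathbb R_+\to\mathbb R_+$ with $r(t)\to0$ and a locally bounded $L:\mathbb R_+\to\mathbb R_+$ such that for any $x,y\in E$ there exist random processes $X^{x,y},Y^{x,y}$ on a common probability space with (1) $\mathrm{Law}(X^{x,y})=\mathbb P_x$ and $d_{TV}(\mathrm{Law}(Y^{x,y}_t),P_t(y,\cdot))\le L(t)\theta(x,y)$, $t\ge0$; (2) $\mathbb E\theta(X^{x,y}_t,Y^{x,y}_t)\le r(t)\theta(x,y)$, $t\ge0$. Assumption B1 (for a set $B$ and $t_0>0$): for any $\varepsilon>0$ there is a measurable $D$ with $\inf_{x\in B}P_{t_0}(x,D)>0$ and $\sup_{x,y\in D}\theta(x,y)\le\varepsilon$. *)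

theory Defs
  imports "HOL-Probability.Probability"
begin

text \<open>The Polish space (E, rho) is a type of class polish_space with rho = dist,
  and its Borel sigma-field is borel.  Time parameter ranges over t >= 0.\<close>

definition markov_tf :: "(real \<Rightarrow> 'a::topological_space \<Rightarrow> 'a measure) \<Rightarrow> bool" where
  "markov_tf P \<longleftrightarrow>
     (\<forall>t\<ge>0. \<forall>x. prob_space (P t x) \<and> sets (P t x) = sets borel) \<and>
     (\<forall>t\<ge>0. \<forall>A\<in>sets borel. (\<lambda>x. emeasure (P t x) A) \<in> borel_measurable borel) \<and>
     (\<forall>x. P 0 x = return borel x) \<and>
     (\<forall>s\<ge>0. \<forall>t\<ge>0. \<forall>x. \<forall>A\<in>sets borel.
        emeasure (P (s + t) x) A = (\<integral>\<^sup>+ y. emeasure (P t y) A \<partial>P s x))"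

definition feller :: "(real \<Rightarrow> 'a::topological_space \<Rightarrow> 'a measure) \<Rightarrow> bool" where
  "feller P \<longleftrightarrow>
     (\<forall>t\<ge>0. \<forall>f::'a \<Rightarrow> real. continuous_on UNIV f \<and> bounded (range f) \<longrightarrow>
        continuous_on UNIV (\<lambda>x. \<integral>y. f y \<partial>P t x) \<and> bounded (range (\<lambda>x. \<integral>y. f y \<partial>P t x)))"

text \<open>Finite-dimensional distributions of the Markov process started at x:
  the list [(h0,A0),(h1,A1),...] stands for the event
  X_{t0} in A0, X_{t1} in A1, ... with t_i = h0 + ... + h_i.\<close>
fun mkv_fdd :: "(real \<Rightarrow> 'a \<Rightarrow> 'a measure) \<Rightarrow> 'a \<Rightarrow> (real \<times> 'a set) list \<Rightarrow> ennreal" where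
  "mkv_fdd P x [] = 1"
| "mkv_fdd P x ((h, A) # rest) = (\<integral>\<^sup>+ y. indicator A y * mkv_fdd P y rest \<partial>P h x)"

text \<open>Law(X) = P_x: the process X on the probability space M is a Markov process
  with transition function P started at x (equality of the laws on the product
  sigma-field over times t >= 0, i.e. equality of all finite-dimensional distributions).\<close>
definition has_markov_law ::
  "(real \<Rightarrow> 'a::topological_space \<Rightarrow> 'a measure) \<Rightarrow> 'a \<Rightarrow> 'w measure \<Rightarrow> (real \<Rightarrow> 'w \<Rightarrow> 'a) \<Rightarrow> bool" where
  "has_markov_law P x M X \<longleftrightarrow>
     prob_space M \<and> (\<forall>t\<ge>0. X t \<in> measurable M borel) \<and>
     (\<forall>l. (\<forall>i<length l. fst (l ! i) \<ge> 0 \<and> snd (l ! i) \<in> sets borel) \<longrightarrow>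
        emeasure M {\<omega>\<in>space M. \<forall>i<length l. X (\<Sum>j\<le>i. fst (l ! j)) \<omega> \<in> snd (l ! i)}
          = mkv_fdd P x l)"

definition premetric :: "('a::topological_space \<Rightarrow> 'a \<Rightarrow> real) \<Rightarrow> bool" where
  "premetric \<theta> \<longleftrightarrow>
     (\<forall>c. open {p::'a \<times> 'a. c < \<theta> (fst p) (snd p)}) \<and>
     (\<forall>x y. \<theta> x y \<ge> 0) \<and> (\<forall>x y. \<theta> x y = 0 \<longleftrightarrow> x = y)"

definition dTV :: "'a measure \<Rightarrow> 'a measure \<Rightarrow> real" where
  "dTV \<mu> \<nu> = (SUP A\<in>sets \<mu>. \<bar>measure \<mu> A - measure \<nu> A\<bar>)"

definition couplings :: "'a::topological_space measure \<Rightarrow> 'a measure \<Rightarrow> ('a \<times> 'a) measure set" where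
  "couplings \<mu> \<nu> = {c. sets c = sets (borel \<Otimes>\<^sub>M borel) \<and> prob_space c \<and>
      distr c borel fst = \<mu> \<and> distr c borel snd = \<nu>}"

definition wasserstein :: "('a::topological_space \<Rightarrow> 'a \<Rightarrow> real) \<Rightarrow> 'a measure \<Rightarrow> 'a measure \<Rightarrow> ennreal" where
  "wasserstein d \<mu> \<nu> = (INF c\<in>couplings \<mu> \<nu>. \<integral>\<^sup>+ z. ennreal (d (fst z) (snd z)) \<partial>c)"

definition invariant_prob :: "(real \<Rightarrow> 'a::topological_space \<Rightarrow> 'a measure) \<Rightarrow> 'a measure \<Rightarrow> bool" where
  "invariant_prob P \<pi> \<longleftrightarrow> prob_space \<pi> \<and> sets \<pi> = sets borel \<and>
     (\<forall>t\<ge>0. \<forall>A\<in>sets borel. (\<integral>\<^sup>+ x. emeasure (P t x) A \<partial>\<pi>) = emeasure \<pi> A)"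

definition assumption_A ::
  "'w itself \<Rightarrow> (real \<Rightarrow> 'a::topological_space \<Rightarrow> 'a measure) \<Rightarrow> ('a \<Rightarrow> 'a \<Rightarrow> real)
     \<Rightarrow> (real \<Rightarrow> real) \<Rightarrow> (real \<Rightarrow> real) \<Rightarrow> bool" where
  "assumption_A (_::'w itself) P \<theta> r L \<longleftrightarrow>
     (\<forall>s\<ge>0. r s \<ge> 0) \<and> antimono_on {0..} r \<and> (r \<longlongrightarrow> 0) at_top \<and>
     (\<forall>s\<ge>0. L s \<ge> 0) \<and> (\<forall>T\<ge>0. bounded (L ` {0..T})) \<and>
     (\<forall>x y. \<exists>(M::'w measure) X Y.
        has_markov_law P x M X \<and> (\<forall>t\<ge>0. Y t \<in> measurable M borel) \<and>
        (\<forall>t\<ge>0. dTV (distr M borel (Y t)) (P t y) \<le> L t * \<theta> x y) \<and>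
        (\<forall>t\<ge>0. (\<integral>\<^sup>+ \<omega>. ennreal (\<theta> (X t \<omega>) (Y t \<omega>)) \<partial>M) \<le> ennreal (r t * \<theta> x y)))"

definition assumption_B1 ::
  "(real \<Rightarrow> 'a::topological_space \<Rightarrow> 'a measure) \<Rightarrow> ('a \<Rightarrow> 'a \<Rightarrow> real) \<Rightarrow> 'a set \<Rightarrow> real \<Rightarrow> bool" where
  "assumption_B1 P \<theta> B t0 \<longleftrightarrow>
     (\<forall>\<epsilon>>0. \<exists>D\<in>sets borel. (\<exists>c>0. \<forall>x\<in>B. measure (P t0 x) D \<ge> c) \<and>
        (\<forall>x\<in>D. \<forall>y\<in>D. \<theta> x y \<le> \<epsilon>))"

definition H_phi :: "(real \<Rightarrow> real) \<Rightarrow> real \<Rightarrow> real" where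
  "H_phi \<phi> x = integral {1..x} (\<lambda>u. 1 / \<phi> u)"

definition H_phi_inv :: "(real \<Rightarrow> real) \<Rightarrow> real \<Rightarrow> real" where
  "H_phi_inv \<phi> s = (THE y. y \<ge> 1 \<and> H_phi \<phi> y = s)"

end

theory Submission
  imports Defs
begin

text \<open>
  Everything is done on the dual side: for a function f that is 1-Lipschitz for min(dist, 1) we
  bound the oscillation of P_t f, which needs couplings of P_t(x, .) and P_t(y, .) only for fixed
  x, y and hence no measurable selection. Kantorovich duality then returns to the Wasserstein
  distance.

  With h = t0 + T for a large T and d = min(1, N theta) for a large N, Assumption A contracts d
  on pairs with d < 1, and B1 contracts it on pairs in a sublevel set of the Lyapunov function v.
  By Hoelder's inequality the oscillation bounds |f x - f y| <= d(x, y)^(1-q) (J x + J y)^q are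
  propagated by P_h, for weights J = b^n w(v) + (1/2 + beta v)/(beta s) truncated at a level s:
  the first summand decays geometrically at a rate proportional to phi'(s) as long as v stays
  below s, because w(u) = exp(l H(u)) is concave on [1, s] when l is at most phi'(s); the second
  summand exceeds 1 as soon as v exceeds s.
  Choosing phi(s) = phi(v)^(1-q) phi(R)^q with H(R) proportional to the time and using
  phi'(s) (H(R) - H(s)) >= ln (phi(R) / phi(s)) makes both summands at most a constant times
  (phi(v) / phi(R))^q, which is the claimed rate with delta = q^2.

  The invariant measure is a limit of Cesaro averages of the skeleton chain. They form a Cauchy
  sequence for the dual distance, and a sequence of transport kernels between successive terms
  glues, by the Ionescu-Tulcea theorem, to an almost surely convergent sequence of random points.
\<close>

section \<open>Kantorovich duality for the truncated distance\<close>

text \<open>Why a chain step has two legs: \<open>t0\<close> is imposed by B1, whereas Assumption A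
  contracts only after a long time and carries an error \<open>L t * \<theta> x y\<close> that need
  not be small. A step runs for \<open>t0\<close> first, under the coupling from A or the
  independent one, and then for \<open>T\<close> under the coupling from A. Over the last leg min(1,
  N \<theta>) is controlled by min(1, N2 \<theta>), and N enters the final factor only through N
  r(T) r(t0); once r(T) r(t0) is at most 1/4, a large N swallows both error terms.

  On far pairs outside the small set the distance gives no gain, so all decay must come from the
  weights, whose rate is limited by \<phi>'(s) and may vanish as s grows. Hence the level s is tuned
  to the starting points and to the number of steps. Where the weights grow instead, they do so by a
  factor \<Lambda> that the contraction of the distance pays for.

  The exponent is q^2 because a factor q is lost twice: in Hoelder's inequality, where the distance
  needs the positive exponent 1 - q in order to contract, and in placing \<phi>(s) strictly between
  \<phi>(v) and \<phi>(R).\<close>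

lemma compact_function_box: "compact {p :: 'b \<Rightarrow> real. \<forall>z. 0 \<le> p z \<and> p z \<le> B}"
proof -
  have "{p :: 'b \<Rightarrow> real. \<forall>z. 0 \<le> p z \<and> p z \<le> B} = PiE UNIV (\<lambda>_. {0..B})"
    by (auto simp: PiE_iff)
  moreover have "compactin (product_topology (\<lambda>_::'b. euclidean) UNIV) (PiE UNIV (\<lambda>_. {0..B}))"
    by (subst compactin_PiE) auto
  ultimately show ?thesis
    by (simp add: euclidean_product_topology flip: compactin_euclidean_iff)
qed

text \<open>A one-sided first-order condition: a negative slope \<open>G\<close> would beat the
  quadratic term at \<open>e = min b (- G * \<tau> / 2)\<close>. It is applied to single-entry
  perturbations of a minimiser.\<close>

lemma quadratic_germ_nonneg:
  fixes G \<tau> b :: real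
  assumes "b > 0" "\<tau> > 0" and e: "\<And>e. 0 < e \<Longrightarrow> e \<le> b \<Longrightarrow> 0 \<le> e * G + e\<^sup>2 / \<tau>"
  shows "0 \<le> G"
proof (rule ccontr)
  assume "\<not> 0 \<le> G"
  define e where "e = min b (- G * \<tau> / 2)"
  have "e > 0" "e \<le> b" "e \<le> - G * \<tau> / 2"
    using \<open>\<not> 0 \<le> G\<close> assms(1,2) by (auto simp: e_def mult_neg_pos)
  then have "0 \<le> e * (G + e / \<tau>)"
    using e[of e] by (simp add: power2_eq_square algebra_simps)
  then have "0 \<le> G + e / \<tau>"
    using \<open>e > 0\<close> by (simp add: zero_le_mult_iff)
  moreover have "e / \<tau> \<le> - G / 2"
    using \<open>e \<le> - G * \<tau> / 2\<close> assms(2) by (simp add: field_simps)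
  ultimately show False
    using \<open>\<not> 0 \<le> G\<close> by simp
qed

text \<open>Quadratic penalties replace the marginal constraints, so a minimiser exists by
  compactness, and its marginal defects divided by \<open>\<tau>\<close> are the dual potentials.
  Duality thus follows from first-order conditions alone, at the price of marginal errors that
  vanish with \<open>\<tau>\<close>.\<close>

lemma penalised_transport:
  fixes c :: "'a \<Rightarrow> 'a \<Rightarrow> real" and m k :: "'a \<Rightarrow> real"
  assumes fin: "finite I"
    and m: "\<And>x. x \<in> I \<Longrightarrow> 0 \<le> m x" "sum m I = 1" and k: "\<And>x. x \<in> I \<Longrightarrow> 0 \<le> k x" "sum k I = 1"
    and c: "\<And>x y. 0 \<le> c x y" "\<And>x y. c x y \<le> 1" "\<And>x. c x x = 0" "\<And>x y z. c x z \<le> c x y + c y z"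
    and dual: "\<And>f. (\<And>x y. f x - f y \<le> c x y) \<Longrightarrow> (\<Sum>x\<in>I. f x * (m x - k x)) \<le> D"
    and \<tau>: "0 < \<tau>" "\<tau> \<le> 1"
  shows "\<exists>p. (\<forall>z. 0 \<le> p z \<and> p z \<le> 4) \<and> (\<forall>x\<in>I. ((\<Sum>y\<in>I. p (x, y)) - m x)\<^sup>2 \<le> 2 * \<tau>) \<and>
     (\<forall>y\<in>I. ((\<Sum>x\<in>I. p (x, y)) - k y)\<^sup>2 \<le> 2 * \<tau>) \<and> (\<Sum>x\<in>I. \<Sum>y\<in>I. p (x, y) * c x y) \<le> D"
proof -
  define row where "row p x = (\<Sum>y\<in>I. p (x, y))" for p :: "'a \<times> 'a \<Rightarrow> real" and x
  define col where "col p y = (\<Sum>x\<in>I. p (x, y))" for p :: "'a \<times> 'a \<Rightarrow> real" and y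
  define cost where "cost p = (\<Sum>x\<in>I. \<Sum>y\<in>I. p (x, y) * c x y)" for p :: "'a \<times> 'a \<Rightarrow> real"
  define F where "F p = cost p + ((\<Sum>x\<in>I. (row p x - m x)\<^sup>2) + (\<Sum>y\<in>I. (col p y - k y)\<^sup>2)) / (2 * \<tau>)" for p
  let ?B = "{p :: 'a \<times> 'a \<Rightarrow> real. \<forall>z. 0 \<le> p z \<and> p z \<le> 4}"
  have cont: "continuous_on ?B F"
    unfolding F_def row_def col_def cost_def
    using \<tau> by (intro continuous_intros continuous_on_subset[OF continuous_on_product_coordinates]) auto
  have "?B \<noteq> {}" by (auto intro!: exI[of _ "\<lambda>_. 0"])
  from continuous_attains_inf[OF compact_function_box this cont]
  obtain p where p: "\<And>z. 0 \<le> p z" "\<And>z. p z \<le> 4" and min: "\<And>p'. (\<And>z. 0 \<le> p' z \<and> p' z \<le> 4) \<Longrightarrow> F p \<le> F p'"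
    by auto
  have m1: "m x \<le> 1" if "x \<in> I" for x using member_le_sum[of x I m] that m fin by auto
  have k1: "k x \<le> 1" if "x \<in> I" for x using member_le_sum[of x I k] that k fin by auto
  have cost0: "0 \<le> cost p" unfolding cost_def by (intro sum_nonneg mult_nonneg_nonneg p c)
  have F1: "F p \<le> 1"
  proof -
    \<comment> \<open>The product plan has the exact marginals, hence no penalty, and costs at most
      1. Comparison with it bounds the penalty of the minimiser.\<close>
    define p0 where "p0 z = (if z \<in> I \<times> I then m (fst z) * k (snd z) else 0)" for z
    have "F p \<le> F p0"
      by (intro min) (auto simp: p0_def m k intro!: order_trans[OF mult_mono[OF m1 k1]] )
    also have "row p0 x = m x" if "x \<in> I" for x
      using that k(2) by (simp add: row_def p0_def flip: sum_distrib_left)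
    moreover have "col p0 x = k x" if "x \<in> I" for x
      using that m(2) by (simp add: col_def p0_def flip: sum_distrib_right)
    ultimately have "F p \<le> cost p0" by (simp add: F_def)
    also have "\<dots> \<le> (\<Sum>x\<in>I. \<Sum>y\<in>I. p0 (x, y))"
      unfolding cost_def by (intro sum_mono mult_left_le c) (auto simp: p0_def m k)
    also have "\<dots> = 1"
      using m k by (simp add: p0_def flip: sum_distrib_left)
    finally show ?thesis .
  qed
  have sq: "(\<Sum>x\<in>I. (row p x - m x)\<^sup>2) + (\<Sum>y\<in>I. (col p y - k y)\<^sup>2) \<le> 2 * \<tau>"
    using F1 cost0 \<tau> by (simp add: F_def field_simps) (smt (verit) mult_nonneg_nonneg)
  have row: "(row p x - m x)\<^sup>2 \<le> 2 * \<tau>" if "x \<in> I" for x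
    using sq member_le_sum[of x I "\<lambda>x. (row p x - m x)\<^sup>2"] that fin
      sum_nonneg[of I "\<lambda>y. (col p y - k y)\<^sup>2"] by auto
  have col: "(col p x - k x)\<^sup>2 \<le> 2 * \<tau>" if "x \<in> I" for x
    using sq member_le_sum[of x I "\<lambda>x. (col p x - k x)\<^sup>2"] that fin
      sum_nonneg[of I "\<lambda>y. (row p y - m y)\<^sup>2"] by auto
  \<comment> \<open>This explains the height 4 of the box: an entry of the minimiser on
    \<open>I\<close> is at most 3, so it can be raised by up to 1 without leaving the box.\<close>
  have p3: "p (x, y) \<le> 3" if "x \<in> I" "y \<in> I" for x y
  proof -
    have "p (x, y) \<le> row p x"
      unfolding row_def using that fin p by (intro member_le_sum) auto
    moreover have "row p x - m x \<le> 2"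
      using row[OF that(1)] \<tau> by (auto intro: power2_le_imp_le[of _ 2])
    ultimately show ?thesis using m1[OF that(1)] by simp
  qed
  \<comment> \<open>The partial derivative of \<open>F\<close> at the minimiser in the entry
    \<open>(a, b)\<close>. As \<open>F\<close> is quadratic, changing that entry by e changes
    \<open>F\<close> by exactly e G + e^2 / \<tau>.\<close>
  define G where "G a b = c a b + (row p a - m a) / \<tau> + (col p b - k b) / \<tau>" for a b
  have perturbation: "0 \<le> e * G a b + e\<^sup>2 / \<tau>" if ab: "a \<in> I" "b \<in> I" and e: "0 \<le> p (a, b) + e" "p (a, b) + e \<le> 4" for a b e
  proof -
    define p' where "p' = p((a, b) := p (a, b) + e)"
    have p'z: "p' (x, y) = p (x, y) + (if x = a then if y = b then e else 0 else 0)" for x y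
      by (auto simp: p'_def)
    have "F p \<le> F p'"
      by (rule min) (auto simp: p'_def p e)
    moreover have "(row p' x - m x)\<^sup>2 = (row p x - m x)\<^sup>2 + (if x = a then 2 * e * (row p a - m a) + e\<^sup>2 else 0)" for x
      using ab fin by (auto simp: row_def p'z sum.distrib power2_eq_square algebra_simps)
    moreover have "(col p' x - k x)\<^sup>2 = (col p x - k x)\<^sup>2 + (if x = b then 2 * e * (col p b - k b) + e\<^sup>2 else 0)" for x
      using ab fin by (auto simp: col_def p'z sum.distrib power2_eq_square algebra_simps)
    moreover have "cost p' = cost p + e * c a b"
    proof -
      have "p' (x, y) * c x y = p (x, y) * c x y + (if x = a then if y = b then e * c a b else 0 else 0)" for x y
        by (auto simp: p'z algebra_simps)
      moreover have "(\<Sum>x\<in>I. \<Sum>y\<in>I. if x = a then if y = b then e * c a b else 0 else 0)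
          = (\<Sum>x\<in>I. if x = a then e * c a b else 0)"
        using ab fin by (intro sum.cong) auto
      ultimately show ?thesis
        using ab fin by (simp add: cost_def sum.distrib)
    qed
    ultimately have "0 \<le> e * c a b + (2 * e * (row p a - m a) + e\<^sup>2 + (2 * e * (col p b - k b) + e\<^sup>2)) / (2 * \<tau>)"
      using ab fin \<tau> by (simp add: F_def sum.distrib add_divide_distrib)
    also have "\<dots> = e * G a b + e\<^sup>2 / \<tau>"
      using \<tau>(1) by (simp add: G_def divide_simps) algebra
    finally show ?thesis .
  qed
  have G0: "0 \<le> G a b" if ab: "a \<in> I" "b \<in> I" for a b
  proof (rule quadratic_germ_nonneg[of 1 \<tau>])
    show "0 \<le> e * G a b + e\<^sup>2 / \<tau>" if "0 < e" "e \<le> 1" for e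
      using that p(1)[of "(a,b)"] p3[OF ab] by (intro perturbation[OF ab]) auto
  qed (use \<tau> in auto)
  \<comment> \<open>Complementary slackness: a positive entry can also be lowered, which forces the
    derivative to be nonpositive as well.\<close>
  have G1: "p (a, b) * G a b = 0" if ab: "a \<in> I" "b \<in> I" for a b
  proof (cases "p (a, b) = 0")
    case False
    have "0 \<le> - G a b"
    proof (rule quadratic_germ_nonneg[of "p (a, b)" \<tau>])
      show "0 \<le> e * - G a b + e\<^sup>2 / \<tau>" if "0 < e" "e \<le> p (a, b)" for e
        using that p3[OF ab] perturbation[OF ab, of "- e"] by simp
    qed (use \<tau> False p(1)[of "(a,b)"] in auto)
    with G0[OF ab] show ?thesis by simp
  qed simp
  \<comment> \<open>The dual potentials: \<open>G0\<close> becomes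
    \<open>u a + v b \<le> c a b\<close>, with equality by \<open>G1\<close> wherever the plan is
    positive.\<close>
  define u where "u x = (m x - row p x) / \<tau>" for x
  define v where "v x = (k x - col p x) / \<tau>" for x
  have rowu: "row p x = m x - \<tau> * u x" and colv: "col p x = k x - \<tau> * v x" for x
    using \<tau> by (auto simp: u_def v_def)
  have G: "G a b = c a b - u a - v b" for a b
    using \<tau> by (simp add: G_def u_def v_def field_simps)
  have "I \<noteq> {}" using m by auto
  \<comment> \<open>The c-transform of \<open>v\<close> merges both potentials into one function.
    The triangle inequality makes it Lipschitz, \<open>G0\<close> puts it above \<open>u\<close>,
    and the choice \<open>j = x\<close> with \<open>c x x = 0\<close> puts it below
    \<open>- v\<close>.\<close>
  define f where "f x = Min ((\<lambda>j. c x j - v j) ` I)" for x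
  have f_le: "f x \<le> c x j - v j" if "j \<in> I" for x j
    unfolding f_def using that fin by (intro Min_le) auto
  have f_ex: "\<exists>j\<in>I. f x = c x j - v j" for x
  proof -
    have "f x \<in> (\<lambda>j. c x j - v j) ` I"
      unfolding f_def using fin \<open>I \<noteq> {}\<close> by (intro Min_in) auto
    then show ?thesis by auto
  qed
  have "f x - f y \<le> c x y" for x y
    proof -
    obtain j where "j \<in> I" "f y = c y j - v j" using f_ex by blast
    with f_le[of j x] c(4)[of x j y] show ?thesis by simp
  qed
  note Lip = this
  have fu: "u x \<le> f x" if "x \<in> I" for x
  proof -
    obtain j where "j \<in> I" "f x = c x j - v j" using f_ex by blast
    with G0[OF that, of j] show ?thesis by (simp add: G)
  qed
  have fv: "f x \<le> - v x" if "x \<in> I" for x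
    using f_le[OF that, of x] c(3) by simp
  have "cost p = (\<Sum>x\<in>I. \<Sum>y\<in>I. p (x, y) * u x + p (x, y) * v y)"
    unfolding cost_def using G1 by (intro sum.cong refl) (auto simp: G algebra_simps)
  also have "\<dots> = (\<Sum>x\<in>I. row p x * u x) + (\<Sum>y\<in>I. col p y * v y)"
    unfolding sum.distrib row_def col_def sum_distrib_right
    by (subst (2) sum.swap) simp
  \<comment> \<open>The marginal defects only help here: substituting \<open>rowu\<close> and
    \<open>colv\<close> produces the negative terms - \<tau> u^2 and - \<tau> v^2.\<close>
  also have "\<dots> \<le> (\<Sum>x\<in>I. m x * u x) + (\<Sum>y\<in>I. k y * v y)"
    using \<tau> by (intro add_mono sum_mono) (auto simp: rowu colv algebra_simps)
  also have "\<dots> \<le> (\<Sum>x\<in>I. m x * f x) + (\<Sum>y\<in>I. k y * (- f y))"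
    using fu fv m k by (intro add_mono sum_mono mult_left_mono) (auto simp: le_minus_iff)
  also have "\<dots> = (\<Sum>x\<in>I. f x * (m x - k x))"
    by (simp add: algebra_simps sum_negf sum_subtractf)
  also have "\<dots> \<le> D" by (intro dual Lip)
  finally have "cost p \<le> D" .
  with p row col show ?thesis
    by (auto simp: row_def col_def cost_def intro!: exI[of _ p])
qed

text \<open>Exact marginals are reached without extracting subsequences: the total defect
  \<open>G\<close> of a plan is continuous and attains its minimum on the compact box, and the
  penalised plans show that this minimum is at most every positive e.\<close>

lemma finite_transport_duality:
  fixes c :: "'a \<Rightarrow> 'a \<Rightarrow> real" and m k :: "'a \<Rightarrow> real"
  assumes fin: "finite I"
    and m: "\<And>x. x \<in> I \<Longrightarrow> 0 \<le> m x" "sum m I = 1" and k: "\<And>x. x \<in> I \<Longrightarrow> 0 \<le> k x" "sum k I = 1"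
    and c: "\<And>x y. 0 \<le> c x y" "\<And>x y. c x y \<le> 1" "\<And>x. c x x = 0" "\<And>x y z. c x z \<le> c x y + c y z"
    and dual: "\<And>f. (\<And>x y. f x - f y \<le> c x y) \<Longrightarrow> (\<Sum>x\<in>I. f x * (m x - k x)) \<le> D"
  shows "\<exists>p. (\<forall>x y. 0 \<le> p x y) \<and> (\<forall>x\<in>I. (\<Sum>y\<in>I. p x y) = m x) \<and>
     (\<forall>y\<in>I. (\<Sum>x\<in>I. p x y) = k y) \<and> (\<Sum>x\<in>I. \<Sum>y\<in>I. p x y * c x y) \<le> D"
proof -
  define G where "G p = (\<Sum>x\<in>I. ((\<Sum>y\<in>I. p (x, y)) - m x)\<^sup>2) + (\<Sum>y\<in>I. ((\<Sum>x\<in>I. p (x, y)) - k y)\<^sup>2)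
    + max 0 ((\<Sum>x\<in>I. \<Sum>y\<in>I. p (x, y) * c x y) - D)" for p :: "'a \<times> 'a \<Rightarrow> real"
  let ?B = "{p :: 'a \<times> 'a \<Rightarrow> real. \<forall>z. 0 \<le> p z \<and> p z \<le> 4}"
  have cont: "continuous_on ?B G"
    unfolding G_def
    by (intro continuous_intros continuous_on_subset[OF continuous_on_product_coordinates]) auto
  have "?B \<noteq> {}" by (auto intro!: exI[of _ "\<lambda>_. 0"])
  from continuous_attains_inf[OF compact_function_box this cont]
  obtain p where p: "\<And>z. 0 \<le> p z" and min: "\<And>p'. (\<And>z. 0 \<le> p' z \<and> p' z \<le> 4) \<Longrightarrow> G p \<le> G p'"
    by auto
  have "G p \<le> 0 + e" if "e > 0" for e
  proof -
    define \<tau> where "\<tau> = min 1 (e / (4 * (real (card I) + 1)))"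
    have \<tau>: "0 < \<tau>" "\<tau> \<le> 1" "\<tau> \<le> e / (4 * (real (card I) + 1))" using that by (auto simp: \<tau>_def)
    obtain p' where p': "\<And>z. 0 \<le> p' z \<and> p' z \<le> 4" "\<And>x. x\<in>I \<Longrightarrow> ((\<Sum>y\<in>I. p' (x, y)) - m x)\<^sup>2 \<le> 2 * \<tau>"
       "\<And>y. y\<in>I \<Longrightarrow> ((\<Sum>x\<in>I. p' (x, y)) - k y)\<^sup>2 \<le> 2 * \<tau>" "(\<Sum>x\<in>I. \<Sum>y\<in>I. p' (x, y) * c x y) \<le> D"
      using penalised_transport[of I m k c D \<tau>, OF fin m k c dual \<tau>(1,2)] by blast
    have "G p' \<le> (\<Sum>x\<in>I. 2 * \<tau>) + (\<Sum>x\<in>I. 2 * \<tau>) + 0"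
      unfolding G_def using p' by (intro add_mono sum_mono) auto
    also have "\<dots> \<le> 4 * (real (card I) + 1) * \<tau>" using \<tau> by (simp add: algebra_simps)
    also have "\<dots> \<le> e" using \<tau>(3) by (simp add: field_simps)
    finally show ?thesis using min[of p'] p' by simp
  qed
  then have "G p \<le> 0" by (rule field_le_epsilon)
  moreover have "0 \<le> (\<Sum>x\<in>I. ((\<Sum>y\<in>I. p (x, y)) - m x)\<^sup>2)" "0 \<le> (\<Sum>y\<in>I. ((\<Sum>x\<in>I. p (x, y)) - k y)\<^sup>2)"
    by (auto intro!: sum_nonneg)
  ultimately have *: "(\<Sum>x\<in>I. ((\<Sum>y\<in>I. p (x, y)) - m x)\<^sup>2) = 0" "(\<Sum>y\<in>I. ((\<Sum>x\<in>I. p (x, y)) - k y)\<^sup>2) = 0"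
     "(\<Sum>x\<in>I. \<Sum>y\<in>I. p (x, y) * c x y) \<le> D"
    by (auto simp: G_def)
  then show ?thesis
    using p fin by (intro exI[of _ "\<lambda>x y. p (x, y)"]) (auto simp: sum_nonneg_eq_0_iff)
qed

section \<open>The truncated metric and its Lipschitz functions\<close>

definition bdist :: "'a::metric_space \<Rightarrow> 'a \<Rightarrow> real" where
  "bdist x y = min (dist x y) 1"

definition bLip :: "('a::metric_space \<Rightarrow> real) \<Rightarrow> bool" where
  "bLip f \<longleftrightarrow> (\<forall>x y. f x - f y \<le> bdist x y)"

lemma bdist_nonneg [simp]: "0 \<le> bdist x y" and bdist_le_1 [simp]: "bdist x y \<le> 1"
  and bdist_self [simp]: "bdist x x = 0" and bdist_commute: "bdist x y = bdist y x"
  by (auto simp: bdist_def dist_commute)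

lemma bdist_triangle: "bdist x z \<le> bdist x y + bdist y z"
  using dist_triangle[of x z y] zero_le_dist[of x y] zero_le_dist[of y z] unfolding bdist_def by linarith

lemma bdist_measurable [measurable]:
  "f \<in> M \<rightarrow>\<^sub>M borel \<Longrightarrow> g \<in> M \<rightarrow>\<^sub>M borel \<Longrightarrow>
    (\<lambda>x. bdist (f x) (g x :: 'a::{second_countable_topology, metric_space})) \<in> borel_measurable M"
  unfolding bdist_def by measurable

lemma bLip_abs: "bLip f \<Longrightarrow> \<bar>f x - f y\<bar> \<le> bdist x y"
  unfolding bLip_def by (metis abs_le_iff bdist_commute minus_diff_eq)

lemma bLip_continuous: "bLip f \<Longrightarrow> continuous_on UNIV f"
proof (rule continuous_on_subset)
  assume f: "bLip f"
  have "1-lipschitz_on UNIV f"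
    by (rule lipschitz_onI) (use bLip_abs[OF f] in \<open>auto simp: dist_real_def bdist_def\<close>)
  then show "continuous_on UNIV f" by (rule lipschitz_on_continuous_on)
qed simp

lemma bLip_measurable [measurable_dest]: "bLip f \<Longrightarrow> f \<in> borel_measurable borel"
  by (intro borel_measurable_continuous_onI bLip_continuous)

lemma bLip_bounded: "bLip f \<Longrightarrow> \<bar>f x\<bar> \<le> \<bar>f y\<bar> + 1"
  using bLip_abs[of f x y] bdist_le_1[of x y] by linarith

lemma bLip_integrable:
  assumes "prob_space \<mu>" "sets \<mu> = sets borel" "bLip f" "T \<in> \<mu> \<rightarrow>\<^sub>M borel"
  shows "integrable \<mu> (\<lambda>x. f (T x))"
proof -
  interpret prob_space \<mu> by fact
  have [measurable]: "f \<in> borel_measurable borel" using assms by measurable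
  show ?thesis
    by (rule integrable_const_bound[where B="\<bar>f undefined\<bar> + 1"])
       (use assms bLip_bounded[OF assms(3)] in auto)
qed

text \<open>Stated with \<open>simple_function\<close> because composition with an arbitrary
  function of the finitely many values then remains measurable. This covers the densities built from
  a finite transport plan.\<close>

lemma finite_range_measurable:
  fixes T :: "'a::topological_space \<Rightarrow> 'a"
  assumes fin: "finite (range T)" and T: "\<And>a. T -` {a} \<in> sets borel" and f: "f \<in> M \<rightarrow>\<^sub>M borel"
  shows "simple_function M (\<lambda>x. T (f x))"
  unfolding simple_function_def
proof (intro conjI ballI)
  show "finite ((\<lambda>x. T (f x)) ` space M)"
    by (rule finite_subset[OF _ fin]) auto
  fix a
  have "(\<lambda>x. T (f x)) -` {a} \<inter> space M = f -` (T -` {a}) \<inter> space M" by auto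
  also have "\<dots> \<in> sets M" by (rule measurable_sets[OF f T])
  finally show "(\<lambda>x. T (f x)) -` {a} \<inter> space M \<in> sets M" .
qed

lemma nn_integral_finite_range:
  fixes T :: "'a::topological_space \<Rightarrow> 'a"
  assumes "prob_space \<mu>" "sets \<mu> = sets borel" and fin: "finite (range T)" and T: "\<And>a. T -` {a} \<in> sets borel"
    and h: "\<And>a. a \<in> range T \<Longrightarrow> 0 \<le> h a"
  shows "(\<integral>\<^sup>+x. ennreal (h (T x)) \<partial>\<mu>) = ennreal (\<Sum>a\<in>range T. h a * measure \<mu> (T -` {a}))"
proof -
  interpret prob_space \<mu> by fact
  have [measurable]: "T -` {a} \<in> sets \<mu>" for a using T assms(2) by simp
  have "(\<integral>\<^sup>+x. ennreal (h (T x)) \<partial>\<mu>) = (\<integral>\<^sup>+x. (\<Sum>a\<in>range T. ennreal (h a) * indicator (T -` {a}) x) \<partial>\<mu>)"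
    by (intro nn_integral_cong) (simp add: indicator_def if_distrib[of "(*) _"] fin cong: if_cong)
  also have "\<dots> = (\<Sum>a\<in>range T. ennreal (h a) * emeasure \<mu> (T -` {a}))"
    by (subst nn_integral_sum) (auto simp: nn_integral_cmult_indicator)
  also have "\<dots> = (\<Sum>a\<in>range T. ennreal (h a * measure \<mu> (T -` {a})))"
    using h by (intro sum.cong refl) (simp add: emeasure_eq_measure ennreal_mult')
  also have "\<dots> = ennreal (\<Sum>a\<in>range T. h a * measure \<mu> (T -` {a}))"
    using h by (intro sum_ennreal) auto
  finally show ?thesis .
qed

lemma integral_finite_range:
  fixes T :: "'a::topological_space \<Rightarrow> 'a" and h :: "'a \<Rightarrow> real"
  assumes "prob_space \<mu>" "sets \<mu> = sets borel" and fin: "finite (range T)" and T: "\<And>a. T -` {a} \<in> sets borel"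
  shows "(\<integral>x. h (T x) \<partial>\<mu>) = (\<Sum>a\<in>range T. h a * measure \<mu> (T -` {a}))"
proof -
  interpret prob_space \<mu> by fact
  have [measurable]: "T -` {a} \<in> sets \<mu>" for a using T assms(2) by simp
  have int: "integrable \<mu> (indicator (T -` {a}) :: 'a \<Rightarrow> real)" for a
    by (rule integrable_const_bound[where B=1]) auto
  have "(\<integral>x. h (T x) \<partial>\<mu>) = (\<integral>x. (\<Sum>a\<in>range T. h a * indicator (T -` {a}) x) \<partial>\<mu>)"
    by (intro Bochner_Integration.integral_cong refl) (simp add: indicator_def if_distrib[of "(*) _"] fin cong: if_cong)
  also have "\<dots> = (\<Sum>a\<in>range T. h a * measure \<mu> (T -` {a}))"
    using int by (subst Bochner_Integration.integral_sum) auto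
  finally show ?thesis .
qed

text \<open>Simple functions converge pointwise to the identity; since \<open>bdist\<close> is at
  most 1, dominated convergence turns this into a small mean error, and one index serves both
  measures.\<close>

lemma finite_quantizer:
  fixes \<mu> \<nu> :: "'a::{second_countable_topology, metric_space} measure"
  assumes "prob_space \<mu>" "sets \<mu> = sets borel" "prob_space \<nu>" "sets \<nu> = sets borel" "\<epsilon> > 0"
  obtains T :: "'a \<Rightarrow> 'a" where "T \<in> borel \<rightarrow>\<^sub>M borel" "finite (range T)"
    "(\<integral>x. bdist x (T x) \<partial>\<mu>) \<le> \<epsilon>" "(\<integral>x. bdist x (T x) \<partial>\<nu>) \<le> \<epsilon>"
proof -
  obtain F :: "nat \<Rightarrow> 'a \<Rightarrow> 'a" where F: "\<And>i. simple_function borel (F i)" "\<And>x. (\<lambda>i. F i x) \<longlonglongrightarrow> x"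
    using borel_measurable_implies_sequence_metric[of "\<lambda>x::'a. x" borel undefined] by auto
  have Fm [measurable]: "F i \<in> borel \<rightarrow>\<^sub>M borel" for i by (rule borel_measurable_simple_function[OF F(1)])
  have lim: "(\<lambda>i. \<integral>x. bdist x (F i x) \<partial>\<mu>) \<longlonglongrightarrow> 0" if "prob_space \<mu>" "sets \<mu> = sets borel" for \<mu>
  proof -
    interpret prob_space \<mu> by fact
    note that(2)[measurable_cong]
    have "(\<lambda>i. \<integral>x. bdist x (F i x) \<partial>\<mu>) \<longlonglongrightarrow> (\<integral>x. 0 \<partial>\<mu>)"
    proof (rule integral_dominated_convergence[where w="\<lambda>_. 1"])
      have "(\<lambda>i. bdist x (F i x)) \<longlonglongrightarrow> min (dist x x) 1" for x
        unfolding bdist_def by (intro tendsto_intros F)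
      then show "AE x in \<mu>. (\<lambda>i. bdist x (F i x)) \<longlonglongrightarrow> 0" by simp
    qed auto
    then show ?thesis by simp
  qed
  have "eventually (\<lambda>i. (\<integral>x. bdist x (F i x) \<partial>\<mu>) < \<epsilon> \<and> (\<integral>x. bdist x (F i x) \<partial>\<nu>) < \<epsilon>) sequentially"
    using order_tendstoD(2)[OF lim[OF assms(1,2)] \<open>\<epsilon> > 0\<close>] order_tendstoD(2)[OF lim[OF assms(3,4)] \<open>\<epsilon> > 0\<close>]
    by eventually_elim auto
  then obtain i where "(\<integral>x. bdist x (F i x) \<partial>\<mu>) < \<epsilon>" "(\<integral>x. bdist x (F i x) \<partial>\<nu>) < \<epsilon>"
    unfolding eventually_sequentially by auto
  moreover have "finite (range (F i))" using F(1)[of i] by (auto simp: simple_function_def)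
  ultimately show ?thesis using that[of "F i"] by auto
qed

text \<open>The finite plan between the quantised laws is lifted by spreading the mass sent to a
  cell according to \<open>\<nu>\<close> inside that cell. The second marginal is then exactly
  \<open>\<nu>\<close>, and quantisation enters only through \<open>\<epsilon>\<close>. The result
  is a kernel rather than a coupling so that successive transports can be chained without
  disintegration.\<close>

lemma transport_kernel:
  fixes \<mu> \<nu> :: "'a::{second_countable_topology, metric_space} measure"
  assumes \<mu>: "prob_space \<mu>" "sets \<mu> = sets borel" and \<nu>: "prob_space \<nu>" "sets \<nu> = sets borel"
    and dual: "\<And>f. bLip f \<Longrightarrow> (\<integral>x. f x \<partial>\<mu>) - (\<integral>x. f x \<partial>\<nu>) \<le> D" and "\<epsilon> > 0"
  shows "\<exists>\<kappa>. \<kappa> \<in> borel \<rightarrow>\<^sub>M prob_algebra borel \<and> \<mu> \<bind> \<kappa> = \<nu> \<and>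
    (\<integral>\<^sup>+x. \<integral>\<^sup>+y. ennreal (bdist x y) \<partial>\<kappa> x \<partial>\<mu>) \<le> ennreal (D + \<epsilon>)"
proof -
  interpret \<mu>: prob_space \<mu> by fact
  interpret \<nu>: prob_space \<nu> by fact
  interpret P: pair_prob_space \<mu> \<nu> ..
  note \<mu>(2)[measurable_cong] \<nu>(2)[measurable_cong]
  have sp: "space \<mu> = UNIV" "space \<nu> = UNIV" using \<mu> \<nu> by (auto dest: sets_eq_imp_space_eq)
  obtain T :: "'a \<Rightarrow> 'a" where T[measurable]: "T \<in> borel \<rightarrow>\<^sub>M borel" and fin: "finite (range T)"
    and T\<epsilon>: "(\<integral>x. bdist x (T x) \<partial>\<mu>) \<le> \<epsilon> / 4" "(\<integral>x. bdist x (T x) \<partial>\<nu>) \<le> \<epsilon> / 4"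
    using finite_quantizer[OF \<mu> \<nu>, of "\<epsilon> / 4"] \<open>\<epsilon> > 0\<close> by auto
  have Tv: "T -` {a} \<in> sets borel" for a
    using measurable_sets[OF T, of "{a}"] by simp
  define I where "I = range T"
  define m where "m a = measure \<mu> (T -` {a})" for a
  define k where "k a = measure \<nu> (T -` {a})" for a
  have TI: "T x \<in> I" for x by (auto simp: I_def)
  \<comment> \<open>Replacing \<open>x\<close> by \<open>T x\<close> moves each of the two integrals
    by at most \<epsilon>/4, so the quantised laws satisfy the dual bound with
    \<open>D + \<epsilon> / 2\<close>.\<close>
  have D1: "(\<Sum>a\<in>I. f a * (m a - k a)) \<le> D + \<epsilon> / 2" if f': "\<And>x y. f x - f y \<le> bdist x y" for f
  proof -
    have f: "bLip f" using f' by (simp add: bLip_def)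
    have shift: "\<bar>(\<integral>x. f (T x) \<partial>M) - (\<integral>x. f x \<partial>M)\<bar> \<le> (\<integral>x. bdist x (T x) \<partial>M)"
      if M: "prob_space M" "sets M = sets borel" for M
    proof -
      interpret M: prob_space M by fact
      note M(2)[measurable_cong]
      have i: "integrable M (\<lambda>x. f (T x))" "integrable M (\<lambda>x. f x)"
        using bLip_integrable[OF M f, of T] bLip_integrable[OF M f, of "\<lambda>x. x"] by auto
      have "\<bar>(\<integral>x. f (T x) \<partial>M) - (\<integral>x. f x \<partial>M)\<bar> = \<bar>\<integral>x. f (T x) - f x \<partial>M\<bar>"
        using i by simp
      also have "\<dots> \<le> (\<integral>x. \<bar>f (T x) - f x\<bar> \<partial>M)" by (rule integral_abs_bound)
      also have "\<dots> \<le> (\<integral>x. bdist x (T x) \<partial>M)"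
      proof (rule integral_mono)
        show "integrable M (\<lambda>x. \<bar>f (T x) - f x\<bar>)" using i by auto
        show "integrable M (\<lambda>x. bdist x (T x))" by (rule M.integrable_const_bound[where B=1]) auto
      qed (use bLip_abs[OF f] bdist_commute in metis)
      finally show ?thesis .
    qed
    have "(\<Sum>a\<in>I. f a * (m a - k a)) = (\<integral>x. f (T x) \<partial>\<mu>) - (\<integral>x. f (T x) \<partial>\<nu>)"
      unfolding I_def m_def k_def
      by (simp add: integral_finite_range[OF \<mu> fin Tv] integral_finite_range[OF \<nu> fin Tv] right_diff_distrib sum_subtractf)
    also have "\<dots> \<le> D + \<epsilon> / 2"
      using dual[OF f] shift[OF \<mu>] shift[OF \<nu>] T\<epsilon> by linarith
    finally show ?thesis .
  qed
  have mk: "sum m I = 1" "sum k I = 1"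
    using integral_finite_range[OF \<mu> fin Tv, of "\<lambda>_. 1"] integral_finite_range[OF \<nu> fin Tv, of "\<lambda>_. 1"]
    by (auto simp: I_def m_def k_def \<mu>.prob_space \<nu>.prob_space)
  have mk0: "0 \<le> m a" "0 \<le> k a" for a by (auto simp: m_def k_def)
  obtain p where p: "\<And>x y. 0 \<le> p x y" "\<And>x. x \<in> I \<Longrightarrow> (\<Sum>y\<in>I. p x y) = m x"
     "\<And>y. y\<in>I \<Longrightarrow> (\<Sum>x\<in>I. p x y) = k y" and cost: "(\<Sum>x\<in>I. \<Sum>y\<in>I. p x y * bdist x y) \<le> D + \<epsilon> / 2"
    using finite_transport_duality[of I m k bdist "D + \<epsilon> / 2", OF fin[folded I_def] mk0(1) mk(1) mk0(2) mk(2)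
        bdist_nonneg bdist_le_1 bdist_self bdist_triangle D1] by blast
  have pm: "p a b = 0" if "a \<in> I" "b \<in> I" "m a = 0" for a b
    using p(1) p(2)[OF that(1)] that fin by (auto simp: sum_nonneg_eq_0_iff I_def)
  have pk: "p a b = 0" if "a \<in> I" "b \<in> I" "k b = 0" for a b
    using p(1) p(3)[OF that(2)] that fin by (auto simp: sum_nonneg_eq_0_iff I_def)
  \<comment> \<open>The density of the lifted plan with respect to \<open>\<nu>\<close>. The value 1
    on cells without \<open>\<mu>\<close>-mass makes \<open>\<kappa> x\<close> a probability measure
    for every \<open>x\<close>; where \<open>k b = 0\<close> the quotient is 0 by convention, in
    agreement with \<open>pk\<close>.\<close>
  define g where "g a b = (if m a = 0 then 1 else p a b / (m a * k b))" for a b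
  have g0: "0 \<le> g a b" for a b by (simp add: g_def p mk0)
  have gm [measurable]: "(\<lambda>z. g (T (fst z)) (T (snd z))) \<in> borel_measurable (borel \<Otimes>\<^sub>M borel)"
    by (intro borel_measurable_simple_function simple_function_compose2[where h=g])
       (rule finite_range_measurable[OF fin Tv], measurable)+
  have gm1 [measurable]: "(\<lambda>y. g a (T y)) \<in> borel_measurable borel" for a
    by (intro borel_measurable_simple_function simple_function_compose1[where g="g a"])
       (rule finite_range_measurable[OF fin Tv], measurable)
  have gm2 [measurable]: "(\<lambda>x. g (T x) b) \<in> borel_measurable borel" for b
    by (intro borel_measurable_simple_function simple_function_compose1[where g="\<lambda>a. g a b"])
       (rule finite_range_measurable[OF fin Tv], measurable)
  have rowg: "(\<Sum>b\<in>I. g a b * k b) = 1" if "a \<in> I" for a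
  proof (cases "m a = 0")
    case False
    have "(\<Sum>b\<in>I. g a b * k b) = (\<Sum>b\<in>I. p a b / m a)"
      by (intro sum.cong refl) (use False pk[OF that] in \<open>auto simp: g_def\<close>)
    also have "\<dots> = 1" using p(2)[OF that] False by (simp flip: sum_divide_distrib)
    finally show ?thesis .
  qed (simp add: g_def mk)
  have colg: "(\<Sum>a\<in>I. g a b * m a) = 1" if "b \<in> I" "k b \<noteq> 0" for b
  proof -
    have "(\<Sum>a\<in>I. g a b * m a) = (\<Sum>a\<in>I. p a b / k b)"
      by (intro sum.cong refl) (use pm[OF _ that(1)] in \<open>auto simp: g_def\<close>)
    also have "\<dots> = 1" using p(3)[OF that(1)] that by (simp flip: sum_divide_distrib)
    finally show ?thesis .
  qed
  define \<kappa> where "\<kappa> x = density \<nu> (\<lambda>y. ennreal (g (T x) (T y)))" for x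
  have em\<kappa>: "emeasure (\<kappa> x) A = (\<integral>\<^sup>+y. ennreal (g (T x) (T y)) * indicator A y \<partial>\<nu>)" if "A \<in> sets borel" for x A
    unfolding \<kappa>_def using that by (intro emeasure_density) (auto simp: \<nu>)
  have nn1: "(\<integral>\<^sup>+y. ennreal (g (T x) (T y)) \<partial>\<nu>) = 1" for x
    using nn_integral_finite_range[OF \<nu> fin Tv, of "g (T x)"] rowg[OF TI] g0 by (simp add: I_def k_def)
  have prob\<kappa>: "prob_space (\<kappa> x)" for x
    by (rule prob_spaceI) (use em\<kappa>[of UNIV x] nn1[of x] in \<open>simp add: \<kappa>_def sp\<close>)
  have \<kappa>m [measurable]: "\<kappa> \<in> borel \<rightarrow>\<^sub>M prob_algebra borel"
  proof (rule measurable_prob_algebraI)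
    show "\<kappa> \<in> borel \<rightarrow>\<^sub>M subprob_algebra borel"
    proof (rule measurable_subprob_algebra)
      fix A :: "'a set" assume [measurable]: "A \<in> sets borel"
      show "(\<lambda>a. emeasure (\<kappa> a) A) \<in> borel_measurable borel"
        by (subst em\<kappa>) (auto, measurable)
    qed (auto simp: \<kappa>_def \<nu> intro!: prob_space_imp_subprob_space prob\<kappa>[unfolded \<kappa>_def])
  qed (rule prob\<kappa>)
  have bind: "\<mu> \<bind> \<kappa> = \<nu>"
  proof (rule measure_eqI)
    show s: "sets (\<mu> \<bind> \<kappa>) = sets \<nu>"
      by (subst sets_bind[where N=borel]) (auto simp: sp \<nu> \<kappa>_def)
    fix A assume "A \<in> sets (\<mu> \<bind> \<kappa>)"
    then have A [measurable]: "A \<in> sets borel" using s \<nu> by simp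
    \<comment> \<open>\<open>colg\<close> is available only on cells of positive
      \<open>\<nu>\<close>-mass; the finitely many other cells form a null set.\<close>
    have ae: "AE y in \<nu>. k (T y) \<noteq> 0"
    proof -
      have "AE y in \<nu>. \<forall>b\<in>{b\<in>I. k b = 0}. y \<notin> T -` {b}"
      proof (rule AE_finite_allI)
        show "AE y in \<nu>. y \<notin> T -` {b}" if "b \<in> {b \<in> I. k b = 0}" for b
          using that by (intro AE_not_in null_setsI) (auto simp: k_def \<nu>.emeasure_eq_measure \<nu>(2) Tv)
      qed (simp add: fin I_def)
      then show ?thesis by eventually_elim (use TI in auto)
    qed
    have "emeasure (\<mu> \<bind> \<kappa>) A = (\<integral>\<^sup>+x. emeasure (\<kappa> x) A \<partial>\<mu>)"
      using measurable_prob_algebraD[OF \<kappa>m] \<mu>(2)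
      by (intro emeasure_bind[where N=borel]) (auto simp: sp cong: measurable_cong_sets)
    also have "\<dots> = (\<integral>\<^sup>+x. \<integral>\<^sup>+y. ennreal (g (T x) (T y)) * indicator A y \<partial>\<nu> \<partial>\<mu>)"
      by (simp add: em\<kappa>[OF A])
    also have "\<dots> = (\<integral>\<^sup>+y. \<integral>\<^sup>+x. ennreal (g (T x) (T y)) * indicator A y \<partial>\<mu> \<partial>\<nu>)"
      by (rule P.Fubini'[symmetric]) (simp add: split_beta')
    also have "\<dots> = (\<integral>\<^sup>+y. indicator A y \<partial>\<nu>)"
    proof (rule nn_integral_cong_AE, use ae in eventually_elim)
      fix y assume y: "k (T y) \<noteq> 0"
      have "(\<integral>\<^sup>+x. ennreal (g (T x) (T y)) * indicator A y \<partial>\<mu>) = (\<integral>\<^sup>+x. ennreal (g (T x) (T y)) \<partial>\<mu>) * indicator A y"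
        by (rule nn_integral_multc) measurable
      also have "(\<integral>\<^sup>+x. ennreal (g (T x) (T y)) \<partial>\<mu>) = 1"
        using nn_integral_finite_range[OF \<mu> fin Tv, of "\<lambda>a. g a (T y)"] colg[OF TI y] g0 by (simp add: I_def m_def)
      finally show "(\<integral>\<^sup>+x. ennreal (g (T x) (T y)) * indicator A y \<partial>\<mu>) = indicator A y" by simp
    qed
    also have "\<dots> = emeasure \<nu> A" by (simp add: \<nu>)
    finally show "emeasure (\<mu> \<bind> \<kappa>) A = emeasure \<nu> A" .
  qed
  \<comment> \<open>The path x, T x, T y, y splits the cost into \<epsilon>/4, the cost
    \<open>D + \<epsilon> / 2\<close> of the finite plan, and another \<epsilon>/4.\<close>
  have "(\<integral>\<^sup>+x. \<integral>\<^sup>+y. ennreal (bdist x y) \<partial>\<kappa> x \<partial>\<mu>)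
     \<le> (\<integral>\<^sup>+x. \<integral>\<^sup>+y. ennreal (bdist x (T x)) + (ennreal (bdist (T x) (T y)) + ennreal (bdist y (T y))) \<partial>\<kappa> x \<partial>\<mu>)"
    by (intro nn_integral_mono)
       (auto simp flip: ennreal_plus intro!: ennreal_leI, smt (verit) bdist_triangle bdist_commute)
  also have "\<dots> = (\<integral>\<^sup>+x. ennreal (bdist x (T x)) + ((\<integral>\<^sup>+y. ennreal (bdist (T x) (T y)) \<partial>\<kappa> x) + (\<integral>\<^sup>+y. ennreal (bdist y (T y)) \<partial>\<kappa> x)) \<partial>\<mu>)"
  proof (rule nn_integral_cong)
    fix x
    interpret K: prob_space "\<kappa> x" by (rule prob\<kappa>)
    have [measurable_cong]: "sets (\<kappa> x) = sets borel" by (simp add: \<kappa>_def \<nu>)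
    show "(\<integral>\<^sup>+y. ennreal (bdist x (T x)) + (ennreal (bdist (T x) (T y)) + ennreal (bdist y (T y))) \<partial>\<kappa> x)
      = ennreal (bdist x (T x)) + ((\<integral>\<^sup>+y. ennreal (bdist (T x) (T y)) \<partial>\<kappa> x) + (\<integral>\<^sup>+y. ennreal (bdist y (T y)) \<partial>\<kappa> x))"
      by (subst nn_integral_add, measurable) (subst nn_integral_add, auto simp: K.emeasure_space_1)
  qed
  also have "\<dots> = (\<integral>\<^sup>+x. ennreal (bdist x (T x)) \<partial>\<mu>) + ((\<integral>\<^sup>+x. \<integral>\<^sup>+y. ennreal (bdist (T x) (T y)) \<partial>\<kappa> x \<partial>\<mu>)
     + (\<integral>\<^sup>+x. \<integral>\<^sup>+y. ennreal (bdist y (T y)) \<partial>\<kappa> x \<partial>\<mu>))"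
  proof -
    have \<kappa>s [measurable]: "\<kappa> \<in> borel \<rightarrow>\<^sub>M subprob_algebra borel" by (rule measurable_prob_algebraD[OF \<kappa>m])
    have [measurable]: "(\<lambda>x. \<integral>\<^sup>+y. ennreal (bdist (T x) (T y)) \<partial>\<kappa> x) \<in> borel_measurable \<mu>"
      by (rule nn_integral_measurable_subprob_algebra2[where N=borel]) measurable
    have [measurable]: "(\<lambda>x. \<integral>\<^sup>+y. ennreal (bdist y (T y)) \<partial>\<kappa> x) \<in> borel_measurable \<mu>"
      by (rule nn_integral_measurable_subprob_algebra2[where N=borel]) measurable
    show ?thesis by (subst nn_integral_add, measurable) (subst nn_integral_add, auto)
  qed
  also have "(\<integral>\<^sup>+x. ennreal (bdist x (T x)) \<partial>\<mu>) \<le> ennreal (\<epsilon> / 4)"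
    by (subst nn_integral_eq_integral) (auto intro!: ennreal_leI T\<epsilon> \<mu>.integrable_const_bound[where B=1])
  also have "(\<integral>\<^sup>+x. \<integral>\<^sup>+y. ennreal (bdist y (T y)) \<partial>\<kappa> x \<partial>\<mu>) = (\<integral>\<^sup>+y. ennreal (bdist y (T y)) \<partial>\<nu>)"
    unfolding bind[symmetric] using measurable_prob_algebraD[OF \<kappa>m]
    by (subst nn_integral_bind[where B=borel]) (auto simp: bind)
  also have "\<dots> \<le> ennreal (\<epsilon> / 4)"
    by (subst nn_integral_eq_integral) (auto intro!: ennreal_leI T\<epsilon> \<nu>.integrable_const_bound[where B=1])
  also have "(\<integral>\<^sup>+x. \<integral>\<^sup>+y. ennreal (bdist (T x) (T y)) \<partial>\<kappa> x \<partial>\<mu>) \<le> ennreal (D + \<epsilon> / 2)"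
  proof -
    have "(\<integral>\<^sup>+y. ennreal (bdist (T x) (T y)) \<partial>\<kappa> x) = ennreal (\<Sum>b\<in>I. (g (T x) b * bdist (T x) b) * k b)" for x
    proof -
      have "(\<integral>\<^sup>+y. ennreal (bdist (T x) (T y)) \<partial>\<kappa> x) = (\<integral>\<^sup>+y. ennreal (g (T x) (T y) * bdist (T x) (T y)) \<partial>\<nu>)"
        unfolding \<kappa>_def by (subst nn_integral_density) (auto simp: ennreal_mult g0)
      also have "\<dots> = ennreal (\<Sum>b\<in>I. (g (T x) b * bdist (T x) b) * k b)"
        unfolding I_def k_def using g0 by (intro nn_integral_finite_range[OF \<nu> fin Tv]) auto
      finally show ?thesis .
    qed
    then have "(\<integral>\<^sup>+x. \<integral>\<^sup>+y. ennreal (bdist (T x) (T y)) \<partial>\<kappa> x \<partial>\<mu>)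
       = (\<integral>\<^sup>+x. ennreal (\<Sum>b\<in>I. (g (T x) b * bdist (T x) b) * k b) \<partial>\<mu>)" by simp
    also have "\<dots> = ennreal (\<Sum>a\<in>I. (\<Sum>b\<in>I. (g a b * bdist a b) * k b) * m a)"
      unfolding I_def m_def using g0 mk0 by (intro nn_integral_finite_range[OF \<mu> fin Tv] sum_nonneg) auto
    also have "(\<Sum>a\<in>I. (\<Sum>b\<in>I. (g a b * bdist a b) * k b) * m a) = (\<Sum>a\<in>I. \<Sum>b\<in>I. p a b * bdist a b)"
      unfolding sum_distrib_right
      by (intro sum.cong refl) (use pm pk in \<open>auto simp: g_def\<close>)
    finally show ?thesis using cost by (simp add: ennreal_leI)
  qed
  finally have "(\<integral>\<^sup>+x. \<integral>\<^sup>+y. ennreal (bdist x y) \<partial>\<kappa> x \<partial>\<mu>) \<le> ennreal (\<epsilon> / 4) + (ennreal (D + \<epsilon> / 2) + ennreal (\<epsilon> / 4))"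
    by (simp add: add_mono)
  also have "\<dots> = ennreal (D + \<epsilon>)"
  proof -
    have "0 \<le> D" using dual[of "\<lambda>_. 0"] by (simp add: bLip_def)
    then show ?thesis using \<open>\<epsilon> > 0\<close> by (simp flip: ennreal_plus)
  qed
  finally show ?thesis using \<kappa>m bind by blast
qed

section \<open>Limits of sequences of measures\<close>

lemma bdist_le_sum: "bdist (z m) (z (m + n)) \<le> (\<Sum>i<n. bdist (z (m + i)) (z (m + Suc i)))"
proof (induction n)
  case (Suc n)
  then show ?case using bdist_triangle[of "z m" "z (m + Suc n)" "z (m + n)"] by simp
qed simp

lemma summable_bdist_Cauchy:
  assumes "summable (\<lambda>i. bdist (z i) (z (Suc i)))"
  shows "Cauchy z"
proof (rule metric_CauchyI)
  fix e :: real assume "e > 0"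
  \<comment> \<open>Below 1 the truncation is invisible, so a \<open>bdist\<close> smaller than
    \<open>e'\<close> gives a \<open>dist\<close> smaller than \<open>e\<close>.\<close>
  define e' where "e' = min e 1"
  have "e' > 0" using \<open>e > 0\<close> by (simp add: e'_def)
  then obtain N where N: "\<And>m n. m \<ge> N \<Longrightarrow> norm (\<Sum>i\<in>{m..<n}. bdist (z i) (z (Suc i))) < e'"
    using assms unfolding summable_Cauchy by blast
  have *: "dist (z m) (z (m + n)) < e" if "m \<ge> N" for m n
  proof -
    have "bdist (z m) (z (m + n)) \<le> (\<Sum>i<n. bdist (z (m + i)) (z (m + Suc i)))" by (rule bdist_le_sum)
    also have "\<dots> = (\<Sum>i\<in>{m..<m+n}. bdist (z i) (z (Suc i)))"
      using sum.shift_bounds_nat_ivl[of "\<lambda>i. bdist (z i) (z (Suc i))" 0 m n]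
      by (simp add: lessThan_atLeast0 add.commute)
    also have "\<dots> < e'" using N[OF that, of "m + n"] by simp
    finally show ?thesis by (auto simp: bdist_def e'_def)
  qed
  show "\<exists>M. \<forall>m\<ge>M. \<forall>n\<ge>M. dist (z m) (z n) < e"
  proof (intro exI allI impI)
    fix m n assume "N \<le> m" "N \<le> n"
    then show "dist (z m) (z n) < e"
      using *[of m "n - m"] *[of n "m - n"] by (cases "m \<le> n") (auto simp: dist_commute)
  qed
qed

lemma weak_limit_exists:
  fixes \<mu> :: "nat \<Rightarrow> 'a::polish_space measure"
  assumes \<mu>: "\<And>k. prob_space (\<mu> k)" "\<And>k. sets (\<mu> k) = sets borel"
    and dual: "\<And>k f. bLip f \<Longrightarrow> (\<integral>x. f x \<partial>\<mu> k) - (\<integral>x. f x \<partial>\<mu> (Suc k)) \<le> (1/2) ^ k"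
  shows "\<exists>\<pi>. prob_space \<pi> \<and> sets \<pi> = sets borel \<and>
    (\<forall>g::'a \<Rightarrow> real. continuous_on UNIV g \<longrightarrow> bounded (range g) \<longrightarrow> (\<lambda>k. \<integral>x. g x \<partial>\<mu> k) \<longlonglongrightarrow> (\<integral>x. g x \<partial>\<pi>))"
proof -
  \<comment> \<open>The second \<open>(1/2) ^ k\<close> is the slack granted to
    \<open>transport_kernel\<close>; the costs remain summable.\<close>
  have "\<exists>\<kappa>. \<kappa> \<in> borel \<rightarrow>\<^sub>M prob_algebra borel \<and> \<mu> k \<bind> \<kappa> = \<mu> (Suc k) \<and>
    (\<integral>\<^sup>+x. \<integral>\<^sup>+y. ennreal (bdist x y) \<partial>\<kappa> x \<partial>\<mu> k) \<le> ennreal ((1/2) ^ k + (1/2) ^ k)" for k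
    by (rule transport_kernel) (simp_all add: \<mu> dual)
  then obtain \<kappa> where \<kappa>: "\<And>k. \<kappa> k \<in> borel \<rightarrow>\<^sub>M prob_algebra borel" "\<And>k. \<mu> k \<bind> \<kappa> k = \<mu> (Suc k)"
    and cost: "\<And>k. (\<integral>\<^sup>+x. \<integral>\<^sup>+y. ennreal (bdist x y) \<partial>\<kappa> k x \<partial>\<mu> k) \<le> ennreal ((1/2) ^ k + (1/2) ^ k)"
    by metis
  have \<kappa>s [measurable]: "\<kappa> k \<in> borel \<rightarrow>\<^sub>M subprob_algebra borel" for k by (rule measurable_prob_algebraD[OF \<kappa>(1)])
  have prob\<kappa>: "prob_space (\<kappa> k x)" for k x
    using measurable_space[OF \<kappa>(1)[of k], of x] by (simp add: space_prob_algebra)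
  \<comment> \<open>Each kernel looks at the last coordinate only, so the glued sequence is a Markov
    chain started from \<open>\<mu> 0\<close>, and its k-th marginal is
    \<open>\<mu> k\<close>.\<close>
  define P :: "nat \<Rightarrow> (nat \<Rightarrow> 'a) \<Rightarrow> 'a measure" where
    "P i \<omega> = (case i of 0 \<Rightarrow> \<mu> 0 | Suc j \<Rightarrow> \<kappa> j (\<omega> j))" for i \<omega>
  have P1: "P i \<in> measurable (PiM {0..<i} (\<lambda>_. borel)) (subprob_algebra borel)" for i
  proof (cases i)
    case 0
    have "\<mu> 0 \<in> space (subprob_algebra borel)"
      using \<mu> by (simp add: space_subprob_algebra prob_space_imp_subprob_space)
    then show ?thesis by (simp add: P_def[abs_def] 0)
  next
    case (Suc j)
    have "(\<lambda>\<omega>. \<kappa> j (\<omega> j)) \<in> measurable (PiM {0..<i} (\<lambda>_. borel)) (subprob_algebra borel)"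
      by (rule measurable_compose[where N=borel, OF _ \<kappa>s]) (simp add: Suc)
    then show ?thesis by (simp add: P_def[abs_def] Suc)
  qed
  have P2: "prob_space (P i x)" for i x
    by (cases i) (auto simp: P_def \<mu> prob\<kappa>)
  interpret IT: Ionescu_Tulcea P "\<lambda>_. borel"
    by (rule Ionescu_Tulcea.intro) (auto intro: P1 P2)
  define L where "L n = IT.C 0 n (\<lambda>_. undefined)" for n
  have setsL: "sets (L n) = sets (PiM {0..<n} (\<lambda>_. borel))" for n
    unfolding L_def by (subst IT.sets_C) (auto simp: space_PiM)
  have spaceL: "space (L n) = space (PiM {0..<n} (\<lambda>_. borel))" for n
    by (rule sets_eq_imp_space_eq[OF setsL])
  have LSuc: "(\<integral>\<^sup>+\<omega>. F \<omega> \<partial>L (Suc n)) = (\<integral>\<^sup>+\<omega>. \<integral>\<^sup>+y. F (fun_upd \<omega> n y) \<partial>P n \<omega> \<partial>L n)"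
    if F[measurable]: "F \<in> borel_measurable (PiM {0..<Suc n} (\<lambda>_. borel))" for F :: "_ \<Rightarrow> ennreal" and n
  proof -
    have "(\<integral>\<^sup>+\<omega>. F \<omega> \<partial>L (Suc n)) = (\<integral>\<^sup>+\<omega>. \<integral>\<^sup>+\<omega>'. F \<omega>' \<partial>IT.eP n \<omega> \<partial>L n)"
      unfolding L_def IT.C.simps add_0
      by (rule nn_integral_bind[OF F])
         (use IT.measurable_eP[of n] in \<open>simp add: measurable_cong_sets[OF setsL[unfolded L_def] refl]\<close>)
    also have "\<dots> = (\<integral>\<^sup>+\<omega>. \<integral>\<^sup>+y. F (fun_upd \<omega> n y) \<partial>P n \<omega> \<partial>L n)"
      by (intro nn_integral_cong IT.nn_integral_eP F) (simp add: spaceL)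
    finally show ?thesis .
  qed
  have marg: "(\<integral>\<^sup>+\<omega>. f (\<omega> i) \<partial>L (Suc i)) = (\<integral>\<^sup>+x. f x \<partial>\<mu> i)"
    if [measurable]: "f \<in> borel_measurable borel" for f :: "'a \<Rightarrow> ennreal" and i
    using that
  proof (induction i arbitrary: f)
    case 0
    note [measurable] = 0
    have "(\<integral>\<^sup>+\<omega>. f (\<omega> 0) \<partial>L (Suc 0)) = (\<integral>\<^sup>+\<omega>. \<integral>\<^sup>+y. f y \<partial>\<mu> 0 \<partial>L 0)"
      by (subst LSuc) (auto simp: P_def)
    also have "\<dots> = (\<integral>\<^sup>+y. f y \<partial>\<mu> 0)"
      unfolding L_def IT.C.simps by (subst nn_integral_return) (auto simp: space_PiM)
    finally show ?case .
  next
    case (Suc i)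
    note [measurable] = Suc.prems
    have "(\<integral>\<^sup>+\<omega>. f (\<omega> (Suc i)) \<partial>L (Suc (Suc i))) = (\<integral>\<^sup>+\<omega>. \<integral>\<^sup>+y. f y \<partial>\<kappa> i (\<omega> i) \<partial>L (Suc i))"
      by (subst LSuc) (auto simp: P_def)
    also have "\<dots> = (\<integral>\<^sup>+x. \<integral>\<^sup>+y. f y \<partial>\<kappa> i x \<partial>\<mu> i)"
      by (rule Suc.IH) (rule nn_integral_measurable_subprob_algebra2[where N=borel], measurable)
    also have "\<dots> = (\<integral>\<^sup>+y. f y \<partial>\<mu> (Suc i))"
      unfolding \<kappa>(2)[symmetric] 
      by (rule nn_integral_bind[where B=borel, symmetric]) (auto simp: measurable_cong_sets[OF \<mu>(2) refl])
    finally show ?case .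
  qed
  have pair: "(\<integral>\<^sup>+\<omega>. ennreal (bdist (\<omega> i) (\<omega> (Suc i))) \<partial>L (Suc (Suc i))) = (\<integral>\<^sup>+x. \<integral>\<^sup>+y. ennreal (bdist x y) \<partial>\<kappa> i x \<partial>\<mu> i)" for i
  proof -
    have "(\<integral>\<^sup>+\<omega>. ennreal (bdist (\<omega> i) (\<omega> (Suc i))) \<partial>L (Suc (Suc i))) = (\<integral>\<^sup>+\<omega>. \<integral>\<^sup>+y. ennreal (bdist (\<omega> i) y) \<partial>\<kappa> i (\<omega> i) \<partial>L (Suc i))"
      by (subst LSuc) (auto simp: P_def)
    also have "\<dots> = (\<integral>\<^sup>+x. \<integral>\<^sup>+y. ennreal (bdist x y) \<partial>\<kappa> i x \<partial>\<mu> i)"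
      by (rule marg) (rule nn_integral_measurable_subprob_algebra2[where N=borel], measurable)
    finally show ?thesis .
  qed
  define \<Omega> where "\<Omega> = IT.PF.lim"
  have sets\<Omega> [measurable_cong]: "sets \<Omega> = sets (PiM UNIV (\<lambda>_. borel))" by (simp add: \<Omega>_def)
  \<comment> \<open>This identifies the finite marginals of the projective limit with the laws
    \<open>L n\<close>, on which integrals unfold one kernel at a time.\<close>
  have CI: "IT.CI {0..<n} = distr (L n) (PiM {0..<n} (\<lambda>_. borel)) (\<lambda>f. restrict f {0..<n})" for n
  proof -
    have "IT.up_to {0..<n} = n"
    proof (rule antisym)
      show "IT.up_to {0..<n} \<le> n" by (simp add: IT.up_to_iff)
      show "n \<le> IT.up_to {0..<n}" using IT.up_to_less[of "{0..<n}" "n - 1"] by (cases n) auto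
    qed
    then show ?thesis by (simp add: IT.CI_def L_def)
  qed
  have \<Omega>L: "(\<integral>\<^sup>+\<omega>. F (restrict \<omega> {0..<n}) \<partial>\<Omega>) = (\<integral>\<^sup>+\<omega>. F (restrict \<omega> {0..<n}) \<partial>L n)"
    if F[measurable]: "F \<in> borel_measurable (PiM {0..<n} (\<lambda>_. borel))" for F :: "(nat \<Rightarrow> 'a) \<Rightarrow> ennreal" and n
  proof -
    have r: "(\<lambda>f. restrict f {0..<n}) \<in> PiM UNIV (\<lambda>_. borel) \<rightarrow>\<^sub>M PiM {0..<n} (\<lambda>_. borel :: 'a measure)"
      by (rule measurable_restrict_subset) auto
    have r2: "(\<lambda>f. restrict f {0..<n}) \<in> L n \<rightarrow>\<^sub>M PiM {0..<n} (\<lambda>_. borel :: 'a measure)"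
      unfolding measurable_cong_sets[OF setsL refl] by (rule measurable_restrict_subset) auto
    have "(\<integral>\<^sup>+\<omega>. F (restrict \<omega> {0..<n}) \<partial>\<Omega>) = (\<integral>\<^sup>+\<omega>. F \<omega> \<partial>distr \<Omega> (PiM {0..<n} (\<lambda>_. borel)) (\<lambda>f. restrict f {0..<n}))"
      by (subst nn_integral_distr) (use r in \<open>auto simp: measurable_cong_sets[OF sets\<Omega> refl]\<close>)
    also have "\<dots> = (\<integral>\<^sup>+\<omega>. F \<omega> \<partial>distr (L n) (PiM {0..<n} (\<lambda>_. borel)) (\<lambda>f. restrict f {0..<n}))"
      by (simp add: \<Omega>_def IT.distr_lim CI)
    also have "\<dots> = (\<integral>\<^sup>+\<omega>. F (restrict \<omega> {0..<n}) \<partial>L n)"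
      by (subst nn_integral_distr) (use r2 in auto)
    finally show ?thesis .
  qed
  have marg\<Omega>: "(\<integral>\<^sup>+\<omega>. f (\<omega> i) \<partial>\<Omega>) = (\<integral>\<^sup>+x. f x \<partial>\<mu> i)"
    if [measurable]: "f \<in> borel_measurable borel" for f :: "'a \<Rightarrow> ennreal" and i
    using \<Omega>L[of "\<lambda>\<omega>. f (\<omega> i)" "Suc i"] marg[of f i] by simp
  have cost\<Omega>: "(\<integral>\<^sup>+\<omega>. ennreal (bdist (\<omega> i) (\<omega> (Suc i))) \<partial>\<Omega>) \<le> ennreal ((1/2) ^ i + (1/2) ^ i)" for i
    using \<Omega>L[of "\<lambda>\<omega>. ennreal (bdist (\<omega> i) (\<omega> (Suc i)))" "Suc (Suc i)"] pair[of i] cost[of i] by simp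
  have law: "distr \<Omega> borel (\<lambda>\<omega>. \<omega> i) = \<mu> i" for i
  proof (rule measure_eqI)
    fix A assume "A \<in> sets (distr \<Omega> borel (\<lambda>\<omega>. \<omega> i))"
    then have [measurable]: "A \<in> sets borel" by simp
    have "emeasure (distr \<Omega> borel (\<lambda>\<omega>. \<omega> i)) A = (\<integral>\<^sup>+x. indicator A x \<partial>distr \<Omega> borel (\<lambda>\<omega>. \<omega> i))" by simp
    also have "\<dots> = (\<integral>\<^sup>+\<omega>. indicator A (\<omega> i) \<partial>\<Omega>)" by (rule nn_integral_distr) measurable
    also have "\<dots> = emeasure (\<mu> i) A" by (subst marg\<Omega>) (auto simp: \<mu>)
    finally show "emeasure (distr \<Omega> borel (\<lambda>\<omega>. \<omega> i)) A = emeasure (\<mu> i) A" .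
  qed (simp add: \<mu>)
  interpret \<Omega>: prob_space \<Omega>
  proof
    show "emeasure \<Omega> (space \<Omega>) = 1"
      using marg\<Omega>[of "\<lambda>_. 1" 0] prob_space.emeasure_space_1[OF \<mu>(1)[of 0]] by simp
  qed
  have ae: "AE \<omega> in \<Omega>. Cauchy \<omega>"
  proof -
    have "(\<integral>\<^sup>+\<omega>. (\<Sum>i. ennreal (bdist (\<omega> i) (\<omega> (Suc i)))) \<partial>\<Omega>) = (\<Sum>i. \<integral>\<^sup>+\<omega>. ennreal (bdist (\<omega> i) (\<omega> (Suc i))) \<partial>\<Omega>)"
      by (rule nn_integral_suminf) measurable
    also have "\<dots> \<le> (\<Sum>i. ennreal ((1/2) ^ i + (1/2) ^ i))"
      by (intro suminf_le cost\<Omega>) auto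
    also have "\<dots> < \<infinity>"
    proof -
      have "summable (\<lambda>i. (1/2::real) ^ i + (1/2) ^ i)"
        by (intro summable_add summable_geometric) auto
      from ennreal_suminf_neq_top[OF this] show ?thesis
        by (metis (no_types, lifting) infinity_ennreal_def top.not_eq_extremum zero_le_power add_nonneg_nonneg zero_le_divide_1_iff zero_le_numeral)
    qed
    finally have lt: "(\<integral>\<^sup>+\<omega>. (\<Sum>i. ennreal (bdist (\<omega> i) (\<omega> (Suc i)))) \<partial>\<Omega>) < \<infinity>" .
    have "AE \<omega> in \<Omega>. (\<Sum>i. ennreal (bdist (\<omega> i) (\<omega> (Suc i)))) \<noteq> \<infinity>"
      by (rule nn_integral_PInf_AE[OF _ less_imp_neq[OF lt]]) measurable
    then show ?thesis
      by eventually_elim (auto intro!: summable_bdist_Cauchy summable_suminf_not_top)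
  qed
  \<comment> \<open>Replacing sequences that are not Cauchy by a constant one gives convergence
    everywhere instead of almost everywhere, so the limit is measurable as a pointwise
    limit.\<close>
  define z :: "(nat \<Rightarrow> 'a) \<Rightarrow> nat \<Rightarrow> 'a" where "z \<omega> i = (if Cauchy \<omega> then \<omega> i else undefined)" for \<omega> i
  define Z where "Z \<omega> = lim (z \<omega>)" for \<omega>
  have zc: "Cauchy (z \<omega>)" for \<omega>
  proof (cases "Cauchy \<omega>")
    case True
    then have "z \<omega> = \<omega>" by (simp add: z_def fun_eq_iff)
    then show ?thesis using True by simp
  next
    case False
    then have "z \<omega> = (\<lambda>_. undefined)" by (simp add: z_def fun_eq_iff)
    then show ?thesis by (simp add: LIMSEQ_imp_Cauchy[OF tendsto_const])
  qed
  have zZ: "z \<omega> \<longlonglongrightarrow> Z \<omega>" for \<omega>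
    unfolding Z_def using Cauchy_convergent[OF zc] by (simp add: convergent_LIMSEQ_iff)
  have zm [measurable]: "(\<lambda>\<omega>. z \<omega> i) \<in> \<Omega> \<rightarrow>\<^sub>M borel" for i
    unfolding z_def by measurable
  have Zm [measurable]: "Z \<in> \<Omega> \<rightarrow>\<^sub>M borel"
    by (rule borel_measurable_LIMSEQ_metric[where f="\<lambda>i \<omega>. z \<omega> i"]) (auto intro: zZ)
  have aeZ: "AE \<omega> in \<Omega>. \<omega> \<longlonglongrightarrow> Z \<omega>"
    using ae
  proof eventually_elim
    fix \<omega> :: "nat \<Rightarrow> 'a" assume "Cauchy \<omega>"
    then have "z \<omega> = \<omega>" by (auto simp: z_def)
    then show "\<omega> \<longlonglongrightarrow> Z \<omega>" using zZ[of \<omega>] by simp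
  qed
  define \<pi> where "\<pi> = distr \<Omega> borel Z"
  have "(\<lambda>k. \<integral>x. g x \<partial>\<mu> k) \<longlonglongrightarrow> (\<integral>x. g x \<partial>\<pi>)"
    if g: "continuous_on UNIV g" "bounded (range g)" for g :: "'a \<Rightarrow> real"
  proof -
    have [measurable]: "g \<in> borel_measurable borel" using g(1) by (rule borel_measurable_continuous_onI)
    obtain B where B: "\<And>x. \<bar>g x\<bar> \<le> B" using g(2) by (auto simp: bounded_iff)
    have "(\<lambda>k. \<integral>\<omega>. g (\<omega> k) \<partial>\<Omega>) \<longlonglongrightarrow> (\<integral>\<omega>. g (Z \<omega>) \<partial>\<Omega>)"
    proof (rule integral_dominated_convergence[where w="\<lambda>_. B"])
      show "AE \<omega> in \<Omega>. (\<lambda>i. g (\<omega> i)) \<longlonglongrightarrow> g (Z \<omega>)"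
        using aeZ by eventually_elim (rule continuous_on_tendsto_compose[OF g(1)], auto)
    qed (auto simp: B)
    moreover have "(\<integral>\<omega>. g (\<omega> k) \<partial>\<Omega>) = (\<integral>x. g x \<partial>\<mu> k)" for k
      unfolding law[of k, symmetric] by (rule integral_distr[symmetric]) measurable
    moreover have "(\<integral>\<omega>. g (Z \<omega>) \<partial>\<Omega>) = (\<integral>x. g x \<partial>\<pi>)"
      unfolding \<pi>_def by (rule integral_distr[symmetric]) measurable
    ultimately show ?thesis by simp
  qed
  moreover have "prob_space \<pi>" unfolding \<pi>_def by (rule \<Omega>.prob_space_distr) measurable
  ultimately show ?thesis by (auto simp: \<pi>_def intro!: exI[of _ \<pi>])
qed

section \<open>Couplings\<close>

text \<open>A uniform variable compared with \<open>r\<close> is a coin of bias \<open>r\<close>.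
  Below, the bias depends on the value of another random variable, which is then accepted or
  rejected.\<close>

lemma uniform_unit_threshold:
  fixes r :: real and a b :: ennreal
  assumes "0 \<le> r" "r \<le> 1"
  shows "(\<integral>\<^sup>+u. (if u \<le> r then a else b) \<partial>uniform_measure lborel {0..1}) = ennreal r * a + ennreal (1 - r) * b"
proof -
  have "(\<integral>\<^sup>+u. (if u \<le> r then a else b) \<partial>uniform_measure lborel {0..1::real})
      = (\<integral>\<^sup>+u. (if u \<le> r then a else b) * indicator {0..1} u \<partial>lborel) / emeasure lborel {0..1::real}"
    by (rule nn_integral_uniform_measure) auto
  also have "\<dots> = (\<integral>\<^sup>+u. a * indicator {0..r} u + b * indicator {r<..1} u \<partial>lborel)"
    using assms by (auto intro!: nn_integral_cong simp: divide_ennreal_def split: split_indicator)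
  also have "\<dots> = a * emeasure lborel {0..r} + b * emeasure lborel {r<..1}"
    by (simp add: nn_integral_add nn_integral_cmult_indicator)
  also have "\<dots> = ennreal r * a + ennreal (1 - r) * b"
    using assms by (simp add: mult.commute)
  finally show ?thesis .
qed

text \<open>Both measures are absolutely continuous with respect to their average, built here as a
  Bernoulli mixture. The Radon-Nikodym derivatives are taken real-valued and nonnegative everywhere,
  so they can be compared pointwise.\<close>

lemma common_density:
  fixes \<mu> \<nu> :: "'a measure"
  assumes "prob_space \<mu>" "prob_space \<nu>" and s: "sets \<mu> = sets S" "sets \<nu> = sets S"
  obtains \<sigma> a b where "sets \<sigma> = sets S" "a \<in> borel_measurable S" "b \<in> borel_measurable S"
    "\<And>x. 0 \<le> (a x :: real)" "\<And>x. 0 \<le> (b x :: real)" "\<mu> = density \<sigma> (\<lambda>x. ennreal (a x))" "\<nu> = density \<sigma> (\<lambda>x. ennreal (b x))"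
proof -
  interpret \<mu>: prob_space \<mu> by fact
  interpret \<nu>: prob_space \<nu> by fact
  define \<sigma> where "\<sigma> = measure_pmf (bernoulli_pmf (1/2)) \<bind> (\<lambda>c. if c then \<mu> else \<nu>)"
  have k: "(\<lambda>c. if c then \<mu> else \<nu>) \<in> measure_pmf (bernoulli_pmf (1/2)) \<rightarrow>\<^sub>M subprob_algebra S"
    by (auto simp: space_subprob_algebra s \<mu>.subprob_space_axioms \<nu>.subprob_space_axioms)
  have sS [measurable_cong]: "sets \<sigma> = sets S"
    unfolding \<sigma>_def by (rule sets_bind) (auto simp: s)
  have em: "emeasure \<sigma> A = ennreal (1/2) * emeasure \<mu> A + ennreal (1/2) * emeasure \<nu> A" if "A \<in> sets S" for A
    unfolding \<sigma>_def using that k by (subst emeasure_bind[OF _ k]) (auto simp: nn_integral_bernoulli_pmf mult.commute)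
  interpret \<sigma>: prob_space \<sigma>
  proof
    have "emeasure \<sigma> (space S) = ennreal (1/2) + ennreal (1/2)"
      using \<mu>.emeasure_space_1 \<nu>.emeasure_space_1 sets_eq_imp_space_eq[OF s(1)] sets_eq_imp_space_eq[OF s(2)]
      by (subst em) auto
    also have "\<dots> = 1" by (subst ennreal_plus[symmetric]) auto
    finally show "emeasure \<sigma> (space \<sigma>) = 1" by (simp add: sets_eq_imp_space_eq[OF sS])
  qed
  have *: "\<exists>a. a \<in> borel_measurable S \<and> (\<forall>x. 0 \<le> (a x :: real)) \<and> \<rho> = density \<sigma> (\<lambda>x. ennreal (a x))"
    if \<rho>: "prob_space \<rho>" "sets \<rho> = sets S" "\<And>A. A \<in> sets S \<Longrightarrow> emeasure \<sigma> A = 0 \<Longrightarrow> emeasure \<rho> A = 0" for \<rho>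
  proof -
    interpret \<rho>: prob_space \<rho> by fact
    have ac: "absolutely_continuous \<sigma> \<rho>"
      using \<rho> by (auto simp: absolutely_continuous_def null_sets_def sS)
    have ss: "sets \<rho> = sets \<sigma>" using \<rho> sS by simp
    obtain D where D: "D \<in> borel_measurable \<sigma>" "AE x in \<sigma>. RN_deriv \<sigma> \<rho> x = ennreal (D x)" "\<And>x. 0 \<le> D x"
      using \<sigma>.real_RN_deriv[OF \<rho>.finite_measure_axioms ac ss] by metis
    have "\<rho> = density \<sigma> (RN_deriv \<sigma> \<rho>)" by (rule \<sigma>.density_RN_deriv[OF ac ss, symmetric])
    also have "\<dots> = density \<sigma> (\<lambda>x. ennreal (D x))"
      using D by (intro density_cong) auto
    finally show ?thesis using D by (intro exI[of _ D]) (auto simp: measurable_cong_sets[OF sS refl])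
  qed
  obtain a where a: "a \<in> borel_measurable S" "\<And>x. 0 \<le> (a x :: real)" "\<mu> = density \<sigma> (\<lambda>x. ennreal (a x))"
    using *[of \<mu>] em s \<mu>.prob_space_axioms by auto
  obtain b where b: "b \<in> borel_measurable S" "\<And>x. 0 \<le> (b x :: real)" "\<nu> = density \<sigma> (\<lambda>x. ennreal (b x))"
    using *[of \<nu>] em s \<nu>.prob_space_axioms by auto
  show ?thesis by (rule that[OF sS a(1) b(1) a(2) b(2) a(3) b(3)])
qed

lemma dTV_upper:
  assumes "prob_space \<mu>" "prob_space \<nu>" "A \<in> sets \<mu>"
  shows "measure \<mu> A - measure \<nu> A \<le> dTV \<mu> \<nu>"
proof -
  have "\<bar>measure \<mu> A - measure \<nu> A\<bar> \<le> dTV \<mu> \<nu>"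
    unfolding dTV_def
  proof (rule cSUP_upper)
    show "bdd_above ((\<lambda>A. \<bar>measure \<mu> A - measure \<nu> A\<bar>) ` sets \<mu>)"
    proof (rule bdd_aboveI2)
      fix B show "\<bar>measure \<mu> B - measure \<nu> B\<bar> \<le> 1"
        using prob_space.prob_le_1[OF assms(1), of B] prob_space.prob_le_1[OF assms(2), of B]
          measure_nonneg[of \<mu> B] measure_nonneg[of \<nu> B] by linarith
    qed
  qed fact
  then show ?thesis by linarith
qed

text \<open>Rejection sampling: \<open>Y\<close> is kept with probability
  \<open>\<rho> (Y \<omega>)\<close> and otherwise replaced by an independent draw from the
  normalised part of \<open>\<nu>\<close> above the common density. The new variable has law
  \<open>\<nu>\<close> and is a replacement with probability at most \<open>e\<close>. Working on an
  extension of the space of \<open>X\<close> and \<open>Y\<close> preserves their joint law, so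
  nothing has to be glued.\<close>

lemma dTV_coupling:
  fixes X Y :: "'w \<Rightarrow> 'a::topological_space" and \<nu> :: "'a measure"
  assumes M: "prob_space M" and X[measurable]: "X \<in> M \<rightarrow>\<^sub>M borel" and Y[measurable]: "Y \<in> M \<rightarrow>\<^sub>M borel"
    and \<nu>: "prob_space \<nu>" "sets \<nu> = sets borel" and e: "dTV (distr M borel Y) \<nu> \<le> e"
  shows "\<exists>c\<in>couplings (distr M borel X) \<nu>. \<forall>g\<in>borel_measurable (borel \<Otimes>\<^sub>M borel). (\<forall>z. 0 \<le> g z \<and> g z \<le> 1) \<longrightarrow>
    (\<integral>\<^sup>+z. ennreal (g z) \<partial>c) \<le> (\<integral>\<^sup>+\<omega>. ennreal (g (X \<omega>, Y \<omega>)) \<partial>M) + ennreal e"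
proof -
  interpret M: prob_space M by fact
  interpret \<nu>: prob_space \<nu> by fact
  define \<mu> where "\<mu> = distr M borel Y"
  interpret \<mu>: prob_space \<mu> unfolding \<mu>_def by (rule M.prob_space_distr) simp
  obtain \<sigma> a b where \<sigma>[measurable_cong]: "sets \<sigma> = sets borel" and ab[measurable]: "a \<in> borel_measurable borel" "b \<in> borel_measurable borel"
    and ab0: "\<And>x. 0 \<le> (a x :: real)" "\<And>x. 0 \<le> (b x :: real)"
    and \<mu>a: "\<mu> = density \<sigma> (\<lambda>x. ennreal (a x))" and \<nu>b: "\<nu> = density \<sigma> (\<lambda>x. ennreal (b x))"
    using common_density[of \<mu> \<nu> borel] \<mu>.prob_space_axioms \<nu> by (auto simp: \<mu>_def)
  define m where "m x = min (a x) (b x)" for x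
  have m[measurable]: "m \<in> borel_measurable borel" unfolding m_def by measurable
  have m0: "0 \<le> m x" "m x \<le> a x" "m x \<le> b x" for x using ab0 by (auto simp: m_def)
  \<comment> \<open>The acceptance probability that thins the density \<open>a\<close> to the common
    part \<open>m\<close>. Points with \<open>a x = 0\<close> fall under the first branch.\<close>
  define \<rho> where "\<rho> x = (if a x \<le> b x then 1 else b x / a x)" for x
  have \<rho>[measurable]: "\<rho> \<in> borel_measurable borel" unfolding \<rho>_def by measurable
  have \<rho>01: "0 \<le> \<rho> x" "\<rho> x \<le> 1" for x using ab0[of x] by (auto simp: \<rho>_def divide_simps)
  have \<rho>a: "a x * \<rho> x = m x" for x using ab0[of x] by (auto simp: \<rho>_def m_def)
  have space\<sigma>: "space \<sigma> = UNIV" using sets_eq_imp_space_eq[OF \<sigma>] by simp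
  have ia: "(\<integral>\<^sup>+x. ennreal (a x) \<partial>\<sigma>) = 1"
    using \<mu>.emeasure_space_1 by (simp add: \<mu>a emeasure_density space\<sigma>)
  have ib: "(\<integral>\<^sup>+x. ennreal (b x) \<partial>\<sigma>) = 1"
    using \<nu>.emeasure_space_1 by (simp add: \<nu>b emeasure_density space\<sigma>)
  have im: "(\<integral>\<^sup>+x. ennreal (m x) \<partial>\<sigma>) \<le> 1"
    unfolding ia[symmetric] by (intro nn_integral_mono ennreal_leI m0)
  define t where "t = (\<integral>\<^sup>+x. ennreal (b x - m x) \<partial>\<sigma>)"
  have split: "(\<integral>\<^sup>+x. ennreal (f x) \<partial>\<sigma>) = (\<integral>\<^sup>+x. ennreal (m x) \<partial>\<sigma>) + (\<integral>\<^sup>+x. ennreal (f x - m x) \<partial>\<sigma>)"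
    if [measurable]: "f \<in> borel_measurable borel" and "\<And>x. m x \<le> f x" for f
    using that m0(1) by (subst nn_integral_add[symmetric]) (auto simp flip: ennreal_plus)
  have t1: "(\<integral>\<^sup>+x. ennreal (m x) \<partial>\<sigma>) + t = 1" using split[of b] m0 ib by (simp add: t_def)
  have t2: "(\<integral>\<^sup>+x. ennreal (a x - m x) \<partial>\<sigma>) = t"
    using split[of a] m0 ia t1 im by (metis ab(1) ennreal_add_left_cancel infinity_ennreal_def top.extremum_unique ennreal_one_less_top leD)
  have tle1: "t \<le> 1" using t1 by (metis le_iff_add add.commute)
  have t\<rho>: "(\<integral>\<^sup>+\<omega>. ennreal (1 - \<rho> (Y \<omega>)) \<partial>M) = t"
  proof -
    have "(\<integral>\<^sup>+\<omega>. ennreal (1 - \<rho> (Y \<omega>)) \<partial>M) = (\<integral>\<^sup>+y. ennreal (1 - \<rho> y) \<partial>\<mu>)"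
      unfolding \<mu>_def by (subst nn_integral_distr) auto
    also have "\<dots> = (\<integral>\<^sup>+y. ennreal (a y) * ennreal (1 - \<rho> y) \<partial>\<sigma>)"
      unfolding \<mu>a by (subst nn_integral_density) auto
    also have "\<dots> = (\<integral>\<^sup>+y. ennreal (a y - m y) \<partial>\<sigma>)"
      by (intro nn_integral_cong) (use ab0 \<rho>01 in \<open>simp add: right_diff_distrib \<rho>a flip: ennreal_mult\<close>)
    finally show ?thesis using t2 by simp
  qed
  have te: "t \<le> ennreal e"
  proof -
    \<comment> \<open>This set attains the total variation: on it the densities differ by
      \<open>a x - m x\<close>, and outside it \<open>a x = m x\<close>.\<close>
    let ?A = "{x. b x < a x}"
    have A[measurable]: "?A \<in> sets borel" by measurable
    have "emeasure \<mu> ?A = (\<integral>\<^sup>+x. ennreal (a x) * indicator ?A x \<partial>\<sigma>)"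
      unfolding \<mu>a by (rule emeasure_density) measurable
    also have "\<dots> = (\<integral>\<^sup>+x. ennreal (b x) * indicator ?A x + ennreal (a x - m x) \<partial>\<sigma>)"
      by (intro nn_integral_cong) (use ab0 in \<open>auto simp: m_def min_def split: split_indicator simp flip: ennreal_plus\<close>)
    also have "\<dots> = (\<integral>\<^sup>+x. ennreal (b x) * indicator ?A x \<partial>\<sigma>) + t"
      unfolding t2[symmetric] by (rule nn_integral_add) measurable
    also have "(\<integral>\<^sup>+x. ennreal (b x) * indicator ?A x \<partial>\<sigma>) = emeasure \<nu> ?A"
      unfolding \<nu>b by (rule emeasure_density[symmetric]) measurable
    finally have eq: "ennreal (measure \<mu> ?A) = ennreal (measure \<nu> ?A) + t"
      by (simp add: \<mu>.emeasure_eq_measure \<nu>.emeasure_eq_measure)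
    obtain t' where t': "t = ennreal t'" "0 \<le> t'" using tle1 by (cases t) (auto simp: top_unique)
    have "measure \<mu> ?A = measure \<nu> ?A + t'"
      using eq t' by (simp flip: ennreal_plus)
    moreover have "measure \<mu> ?A - measure \<nu> ?A \<le> dTV \<mu> \<nu>"
      by (rule dTV_upper[OF \<mu>.prob_space_axioms \<nu>.prob_space_axioms]) (simp add: \<mu>_def)
    ultimately show ?thesis using e t' by (simp add: \<mu>_def ennreal_leI)
  qed
  \<comment> \<open>If \<open>t = 0\<close>, rejection has probability 0 and the replacement law is
    immaterial; \<open>\<nu>\<close> serves as a default that is a probability measure.\<close>
  define R where "R = (if t = 0 then \<nu> else density \<sigma> (\<lambda>y. ennreal (b y - m y) / t))"
  have sR[measurable_cong]: "sets R = sets borel" by (simp add: R_def \<sigma> \<nu>)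
  have tR: "t * emeasure R A = (\<integral>\<^sup>+y. ennreal (b y - m y) * indicator A y \<partial>\<sigma>)" if [measurable]: "A \<in> sets borel" for A
  proof (cases "t = 0")
    case True
    have "(\<integral>\<^sup>+y. ennreal (b y - m y) * indicator A y \<partial>\<sigma>) \<le> t"
      unfolding t_def by (intro nn_integral_mono) (auto split: split_indicator)
    then show ?thesis using True by simp
  next
    case False
    have "emeasure R A = (\<integral>\<^sup>+y. ennreal (b y - m y) / t * indicator A y \<partial>\<sigma>)"
      using False by (simp add: R_def emeasure_density)
    also have "\<dots> = (\<integral>\<^sup>+y. inverse t * (ennreal (b y - m y) * indicator A y) \<partial>\<sigma>)"
      by (simp add: divide_ennreal_def ac_simps)
    also have "\<dots> = inverse t * (\<integral>\<^sup>+y. ennreal (b y - m y) * indicator A y \<partial>\<sigma>)"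
      by (rule nn_integral_cmult) measurable
    finally have "t * emeasure R A = t * inverse t * (\<integral>\<^sup>+y. ennreal (b y - m y) * indicator A y \<partial>\<sigma>)"
      by (simp add: mult.assoc)
    also have "t * inverse t = 1"
      using False tle1 ennreal_divide_self[of t] by (simp add: divide_ennreal_def le_less_trans[OF _ ennreal_one_less_top])
    finally show ?thesis by simp
  qed
  interpret R: prob_space R
  proof (cases "t = 0")
    case True then show "prob_space R" by (simp add: R_def \<nu>)
  next
    case False
    have "t * emeasure R UNIV = t" using tR[of UNIV] by (simp add: t_def)
    then have "emeasure R UNIV = 1"
      using False tle1 by (metis ennreal_mult_cancel_left mult.right_neutral ennreal_one_less_top leD)
    then show "prob_space R" by (intro prob_spaceI) (simp add: sets_eq_imp_space_eq[OF sR])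
  qed
  define U where "U = (uniform_measure lborel {0..1::real})"
  have sU[measurable_cong]: "sets U = sets borel" by (simp add: U_def)
  interpret U: prob_space U unfolding U_def by (rule prob_space_uniform_measure) auto
  interpret UR: pair_prob_space U R ..
  interpret MUR: pair_prob_space M "U \<Otimes>\<^sub>M R" ..
  define N where "N = M \<Otimes>\<^sub>M (U \<Otimes>\<^sub>M R)"
  define Y' where "Y' w = (if fst (snd w) \<le> \<rho> (Y (fst w)) then Y (fst w) else snd (snd w))" for w :: "'w \<times> real \<times> 'a"
  have Y'm[measurable]: "Y' \<in> N \<rightarrow>\<^sub>M borel" unfolding Y'_def N_def by measurable
  have Xm[measurable]: "(\<lambda>w. X (fst w)) \<in> N \<rightarrow>\<^sub>M borel" unfolding N_def by measurable
  have iter: "(\<integral>\<^sup>+w. F w \<partial>N) = (\<integral>\<^sup>+\<omega>. \<integral>\<^sup>+u. \<integral>\<^sup>+z. F (\<omega>, u, z) \<partial>R \<partial>U \<partial>M)"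
    if [measurable]: "F \<in> borel_measurable N" for F
  proof -
    have F: "F \<in> borel_measurable (M \<Otimes>\<^sub>M (U \<Otimes>\<^sub>M R))" using that by (simp add: N_def)
    have "(\<integral>\<^sup>+w. F w \<partial>N) = (\<integral>\<^sup>+\<omega>. \<integral>\<^sup>+v. F (\<omega>, v) \<partial>(U \<Otimes>\<^sub>M R) \<partial>M)"
      unfolding N_def by (rule UR.P.nn_integral_fst[symmetric, OF F])
    also have "\<dots> = (\<integral>\<^sup>+\<omega>. \<integral>\<^sup>+u. \<integral>\<^sup>+z. F (\<omega>, u, z) \<partial>R \<partial>U \<partial>M)"
      by (intro nn_integral_cong R.nn_integral_fst[symmetric] measurable_Pair2[OF F])
    finally show ?thesis .
  qed
  define c where "c = distr N (borel \<Otimes>\<^sub>M borel) (\<lambda>w. (X (fst w), Y' w))"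
  have prob_N: "prob_space N" unfolding N_def by (rule MUR.prob_space_axioms)
  have "prob_space c" unfolding c_def by (rule prob_space.prob_space_distr[OF prob_N]) measurable
  moreover have "distr c borel fst = distr M borel X"
  proof (rule measure_eqI)
    fix A assume "A \<in> sets (distr c borel fst)"
    then have [measurable]: "A \<in> sets borel" by simp
    have "distr c borel fst = distr N borel (\<lambda>w. X (fst w))"
      unfolding c_def by (subst distr_distr) (auto simp: comp_def)
    then have "emeasure (distr c borel fst) A = (\<integral>\<^sup>+x. indicator A x \<partial>distr N borel (\<lambda>w. X (fst w)))" by simp
    also have "\<dots> = (\<integral>\<^sup>+w. indicator A (X (fst w)) \<partial>N)"
      by (rule nn_integral_distr) measurable
    also have "\<dots> = (\<integral>\<^sup>+\<omega>. indicator A (X \<omega>) \<partial>M)"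
      by (subst iter) (auto simp: R.emeasure_space_1 U.emeasure_space_1)
    also have "\<dots> = (\<integral>\<^sup>+x. indicator A x \<partial>distr M borel X)"
      by (rule nn_integral_distr[symmetric]) measurable
    finally show "emeasure (distr c borel fst) A = emeasure (distr M borel X) A" by simp
  qed simp
  moreover have "distr c borel snd = \<nu>"
  proof (rule measure_eqI)
    fix A assume "A \<in> sets (distr c borel snd)"
    then have [measurable]: "A \<in> sets borel" by simp
    have "distr c borel snd = distr N borel (\<lambda>w. Y' w)"
      unfolding c_def by (subst distr_distr) (auto simp: comp_def)
    then have "emeasure (distr c borel snd) A = (\<integral>\<^sup>+x. indicator A x \<partial>distr N borel (\<lambda>w. Y' w))" by simp
    also have "\<dots> = (\<integral>\<^sup>+w. indicator A (Y' w) \<partial>N)"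
      by (rule nn_integral_distr) measurable
    also have "\<dots> = (\<integral>\<^sup>+\<omega>. \<integral>\<^sup>+u. (if u \<le> \<rho> (Y \<omega>) then indicator A (Y \<omega>) else emeasure R A) \<partial>U \<partial>M)"
    proof -
      have "(\<integral>\<^sup>+w. indicator A (Y' w) \<partial>N) = (\<integral>\<^sup>+\<omega>. \<integral>\<^sup>+u. \<integral>\<^sup>+z. indicator A (Y' (\<omega>, u, z)) \<partial>R \<partial>U \<partial>M)"
        by (rule iter) measurable
      also have "\<dots> = (\<integral>\<^sup>+\<omega>. \<integral>\<^sup>+u. (if u \<le> \<rho> (Y \<omega>) then indicator A (Y \<omega>) else emeasure R A) \<partial>U \<partial>M)"
        by (intro nn_integral_cong) (auto simp: Y'_def R.emeasure_space_1)
      finally show ?thesis .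
    qed
    also have "\<dots> = (\<integral>\<^sup>+\<omega>. ennreal (\<rho> (Y \<omega>)) * indicator A (Y \<omega>) + ennreal (1 - \<rho> (Y \<omega>)) * emeasure R A \<partial>M)"
      unfolding U_def by (intro nn_integral_cong uniform_unit_threshold \<rho>01)
    also have "\<dots> = (\<integral>\<^sup>+\<omega>. ennreal (\<rho> (Y \<omega>)) * indicator A (Y \<omega>) \<partial>M) + t * emeasure R A"
      unfolding t\<rho>[symmetric] by (subst nn_integral_add) (auto simp: nn_integral_multc)
    also have "(\<integral>\<^sup>+\<omega>. ennreal (\<rho> (Y \<omega>)) * indicator A (Y \<omega>) \<partial>M) = (\<integral>\<^sup>+y. ennreal (\<rho> y) * indicator A y \<partial>\<mu>)"
      unfolding \<mu>_def by (rule nn_integral_distr[symmetric]) measurable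
    also have "\<dots> = (\<integral>\<^sup>+y. ennreal (a y) * (ennreal (\<rho> y) * indicator A y) \<partial>\<sigma>)"
      unfolding \<mu>a by (rule nn_integral_density) measurable
    also have "\<dots> = (\<integral>\<^sup>+y. ennreal (m y) * indicator A y \<partial>\<sigma>)"
      by (intro nn_integral_cong) (use ab0 \<rho>01 in \<open>simp add: \<rho>a flip: ennreal_mult mult.assoc\<close>)
    also have "(\<integral>\<^sup>+y. ennreal (m y) * indicator A y \<partial>\<sigma>) + t * emeasure R A
       = (\<integral>\<^sup>+y. ennreal (m y) * indicator A y + ennreal (b y - m y) * indicator A y \<partial>\<sigma>)"
      by (subst tR) (auto simp: nn_integral_add)
    also have "\<dots> = (\<integral>\<^sup>+y. ennreal (b y) * indicator A y \<partial>\<sigma>)"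
      by (intro nn_integral_cong) (use m0 in \<open>auto split: split_indicator simp flip: ennreal_plus\<close>)
    also have "\<dots> = emeasure \<nu> A" unfolding \<nu>b by (rule emeasure_density[symmetric]) measurable
    finally show "emeasure (distr c borel snd) A = emeasure \<nu> A" .
  qed (simp add: \<nu>)
  moreover have "(\<integral>\<^sup>+z. ennreal (g z) \<partial>c) \<le> (\<integral>\<^sup>+\<omega>. ennreal (g (X \<omega>, Y \<omega>)) \<partial>M) + ennreal e"
    if g[measurable]: "g \<in> borel_measurable (borel \<Otimes>\<^sub>M borel)" and g01: "\<And>z. 0 \<le> g z" "\<And>z. g z \<le> 1" for g
  proof -
    have "(\<integral>\<^sup>+z. ennreal (g z) \<partial>c) = (\<integral>\<^sup>+w. ennreal (g (X (fst w), Y' w)) \<partial>N)"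
      unfolding c_def by (rule nn_integral_distr) measurable
    also have "\<dots> = (\<integral>\<^sup>+\<omega>. \<integral>\<^sup>+u. \<integral>\<^sup>+z. ennreal (g (X \<omega>, Y' (\<omega>, u, z))) \<partial>R \<partial>U \<partial>M)"
      by (subst iter) auto
    \<comment> \<open>A replacement costs at most 1 because \<open>g\<close> takes values in
      [0, 1].\<close>
    also have "\<dots> \<le> (\<integral>\<^sup>+\<omega>. \<integral>\<^sup>+u. \<integral>\<^sup>+z. (if u \<le> \<rho> (Y \<omega>) then ennreal (g (X \<omega>, Y \<omega>)) else ennreal (g (X \<omega>, Y \<omega>)) + 1) \<partial>R \<partial>U \<partial>M)"
      by (intro nn_integral_mono)
         (auto simp: Y'_def intro: order_trans[of _ 1] g01 simp flip: ennreal_1 intro!: ennreal_leI add_increasing)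
    also have "\<dots> = (\<integral>\<^sup>+\<omega>. \<integral>\<^sup>+u. (if u \<le> \<rho> (Y \<omega>) then ennreal (g (X \<omega>, Y \<omega>)) else ennreal (g (X \<omega>, Y \<omega>)) + 1) \<partial>U \<partial>M)"
      by (simp add: R.emeasure_space_1)
    also have "\<dots> = (\<integral>\<^sup>+\<omega>. ennreal (\<rho> (Y \<omega>)) * ennreal (g (X \<omega>, Y \<omega>)) + ennreal (1 - \<rho> (Y \<omega>)) * (ennreal (g (X \<omega>, Y \<omega>)) + 1) \<partial>M)"
      unfolding U_def by (intro nn_integral_cong uniform_unit_threshold \<rho>01)
    also have "\<dots> = (\<integral>\<^sup>+\<omega>. ennreal (g (X \<omega>, Y \<omega>)) + ennreal (1 - \<rho> (Y \<omega>)) \<partial>M)"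
    proof (rule nn_integral_cong)
      fix \<omega>
      have "ennreal (\<rho> (Y \<omega>)) + ennreal (1 - \<rho> (Y \<omega>)) = 1" using \<rho>01[of "Y \<omega>"] by (simp flip: ennreal_plus)
      then show "ennreal (\<rho> (Y \<omega>)) * ennreal (g (X \<omega>, Y \<omega>)) + ennreal (1 - \<rho> (Y \<omega>)) * (ennreal (g (X \<omega>, Y \<omega>)) + 1)
          = ennreal (g (X \<omega>, Y \<omega>)) + ennreal (1 - \<rho> (Y \<omega>))"
        by (simp add: distrib_left flip: add.assoc distrib_right)
    qed
    also have "\<dots> = (\<integral>\<^sup>+\<omega>. ennreal (g (X \<omega>, Y \<omega>)) \<partial>M) + t"
      unfolding t\<rho>[symmetric] by (rule nn_integral_add) measurable
    finally show ?thesis using te by (meson add_left_mono order_trans)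
  qed
  ultimately show ?thesis
    by (intro bexI[of _ c]) (auto simp: couplings_def c_def)
qed

section \<open>Concave rate functions\<close>

locale concave_rate =
  fixes \<phi> :: "real \<Rightarrow> real"
  assumes concave: "concave_on {0..} \<phi>"
    and diff: "\<And>s. s \<ge> 0 \<Longrightarrow> \<phi> differentiable (at s within {0..})"
    and nonneg: "\<And>s. s \<ge> 0 \<Longrightarrow> \<phi> s \<ge> 0"
    and mono: "mono_on {0..} \<phi>"
    and infty: "filterlim \<phi> at_top at_top"
    and zero: "\<phi> 0 = 0"
begin

definition D :: "real \<Rightarrow> real" where "D = deriv \<phi>"

lemma phi_mono: "0 \<le> x \<Longrightarrow> x \<le> y \<Longrightarrow> \<phi> x \<le> \<phi> y"
  using mono_onD[OF mono, of x y] by auto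

lemma phi_gt: "\<exists>z>x. \<phi> z > y"
proof -
  have "eventually (\<lambda>z. z > x \<and> \<phi> z > y) at_top"
    using infty by (intro eventually_conj eventually_gt_at_top) (simp add: filterlim_at_top_dense)
  then show ?thesis by (auto dest: eventually_happens)
qed

text \<open>Since \<phi>(0) = 0, concavity makes \<phi>(x)/x nonincreasing. The cross-multiplied
  form includes the point 0.\<close>

lemma phi_scale:
  assumes "0 \<le> x" "x \<le> y"
  shows "x * \<phi> y \<le> y * \<phi> x"
proof (cases "y = 0")
  case False
  with assms have "y > 0" by simp
  have "\<phi> ((1 - x / y) *\<^sub>R 0 + (x / y) *\<^sub>R y) \<ge> (1 - x / y) * \<phi> 0 + (x / y) * \<phi> y"
    using assms \<open>y > 0\<close> by (intro concave_onD[OF concave]) auto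
  then have "x / y * \<phi> y \<le> \<phi> x" using \<open>y > 0\<close> by (simp add: zero)
  then show ?thesis using \<open>y > 0\<close> by (simp add: field_simps)
qed (use assms in simp)

lemma phi_pos: "x > 0 \<Longrightarrow> \<phi> x > 0"
proof -
  assume "x > 0"
  obtain z where "z > x" "\<phi> z > 0" using phi_gt by blast
  then have "0 < x * \<phi> z" "x * \<phi> z \<le> z * \<phi> x" using \<open>x > 0\<close> by (auto intro: phi_scale)
  then have "0 < z * \<phi> x" by linarith
  then show ?thesis using \<open>x > 0\<close> \<open>z > x\<close> by (simp add: zero_less_mult_iff)
qed

lemma phi_subadd:
  assumes "0 \<le> a" "0 \<le> b"
  shows "\<phi> (a + b) \<le> \<phi> a + \<phi> b"
proof (cases "a + b = 0")
  case False
  then have "a + b > 0" using assms by simp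
  have "a * \<phi> (a + b) \<le> (a + b) * \<phi> a" "b * \<phi> (a + b) \<le> (a + b) * \<phi> b"
    using assms by (auto intro: phi_scale)
  then have "(a + b) * \<phi> (a + b) \<le> (a + b) * (\<phi> a + \<phi> b)" by (simp add: algebra_simps)
  then show ?thesis using \<open>a + b > 0\<close> by simp
qed (use assms in \<open>auto simp: zero add_nonneg_eq_0_iff\<close>)

lemma phi_deriv: "u > 0 \<Longrightarrow> (\<phi> has_real_derivative D u) (at u)"
proof -
  assume "u > 0"
  then have "at u within {0..} = at u" by (intro at_within_interior) auto
  then have "\<phi> differentiable at u" using diff[of u] \<open>u > 0\<close> by simp
  then show ?thesis unfolding D_def by (simp add: DERIV_deriv_iff_real_differentiable)
qed

lemma phi_tangent:
  assumes "0 \<le> z" "0 < u"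
  shows "\<phi> z \<le> \<phi> u + D u * (z - u)"
proof -
  have "- \<phi> z - - \<phi> u \<ge> - D u * (z - u)"
  proof (rule convex_on_imp_above_tangent)
    show "convex_on {0..} (\<lambda>x. - \<phi> x)" using concave by (simp add: concave_on_def)
    show "((\<lambda>x. - \<phi> x) has_field_derivative - D u) (at u within {0..})"
      by (rule has_field_derivative_at_within) (intro DERIV_minus phi_deriv assms)
  qed (use assms in auto)
  then show ?thesis by (simp add: algebra_simps)
qed

lemma D_antimono:
  assumes "0 < u" "u \<le> v"
  shows "D v \<le> D u"
proof (cases "u = v")
  case False
  have "\<phi> v \<le> \<phi> u + D u * (v - u)" "\<phi> u \<le> \<phi> v + D v * (u - v)" using assms by (auto intro: phi_tangent)
  then have "0 \<le> (D u - D v) * (v - u)" by (simp add: algebra_simps)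
  then show ?thesis using assms False by (simp add: zero_le_mult_iff)
qed simp

text \<open>With a nonpositive slope at \<open>u\<close> the tangent would keep \<phi> below
  \<phi>(u) from there on, against its growth to infinity.\<close>

lemma D_pos:
  assumes "0 < u"
  shows "0 < D u"
proof -
  obtain z where z: "z > u" "\<phi> z > \<phi> u" using phi_gt by blast
  then have "0 < D u * (z - u)" using phi_tangent[of z u] assms by simp
  then show ?thesis using z by (simp add: zero_less_mult_iff)
qed

text \<open>The nonincreasing quotient \<phi>(z)/z is bounded by its limit at 0, which is the
  one-sided derivative there. The bound makes \<open>H\<close> diverge and controls the mean growth
  of \<phi>(V).\<close>

lemma phi_linear_bound: "\<exists>c>0. \<forall>z\<ge>0. \<phi> z \<le> c * z"
proof -
  obtain l where l: "(\<phi> has_real_derivative l) (at 0 within {0..})"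
    using diff[of 0] by (auto simp: real_differentiable_def)
  then have lim: "((\<lambda>h. \<phi> h / h) \<longlongrightarrow> l) (at 0 within {0..})"
    by (simp add: has_field_derivative_iff zero)
  have "\<phi> z \<le> (\<bar>l\<bar> + 1) * z" if "z \<ge> 0" for z
  proof (cases "z = 0")
    case False
    with that have "z > 0" by simp
    have nt: "at (0::real) within {0..} \<noteq> bot" by (simp add: at_within_Ici_at_right)
    have "\<phi> z / z \<le> l"
    proof (rule tendsto_lowerbound[OF lim _ nt])
      have "eventually (\<lambda>h::real. h \<in> {0<..<z}) (at_right 0)"
        using \<open>z > 0\<close> by (simp add: eventually_at_right_less eventually_at_right)  (metis)
      then show "eventually (\<lambda>h. \<phi> z / z \<le> \<phi> h / h) (at 0 within {0..})"
        unfolding at_within_Ici_at_right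
      proof eventually_elim
        case (elim h)
        then show ?case using phi_scale[of h z] \<open>z > 0\<close> by (simp add: field_simps)
      qed
    qed
    then have "\<phi> z / z \<le> \<bar>l\<bar> + 1" by linarith
    then show ?thesis using \<open>z > 0\<close> by (simp add: field_simps)
  qed (simp add: zero)
  then show ?thesis by (intro exI[of _ "\<bar>l\<bar> + 1"]) auto
qed

lemma phi_cont: "0 < a \<Longrightarrow> continuous_on {a..b} \<phi>"
  by (rule DERIV_continuous_on, rule has_field_derivative_at_within, rule phi_deriv) auto

section \<open>The transform H and its comparison with powers of the rate\<close>

abbreviation H :: "real \<Rightarrow> real" where "H \<equiv> H_phi \<phi>"

lemma inv_phi_cont: "0 < a \<Longrightarrow> continuous_on {a..b} (\<lambda>u. 1 / \<phi> u)"
  using phi_pos by (intro continuous_intros phi_cont) (auto simp: less_le)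

lemma H_1 [simp]: "H 1 = 0"
  by (simp add: H_phi_def)

lemma H_cont: "continuous_on {1..b} H"
  unfolding H_phi_def[abs_def]
  by (intro indefinite_integral_continuous_1 integrable_continuous_real inv_phi_cont) auto

lemma H_deriv:
  assumes "1 < u"
  shows "(H has_real_derivative 1 / \<phi> u) (at u)"
proof -
  have "((\<lambda>u. integral {1..u} (\<lambda>u. 1 / \<phi> u)) has_real_derivative 1 / \<phi> u) (at u within {1..u+1})"
    using assms by (intro integral_has_real_derivative inv_phi_cont) auto
  moreover have "at u within {1..u+1} = at u" using assms by (intro at_within_interior) auto
  ultimately show ?thesis by (simp add: H_phi_def[abs_def])
qed

lemma H_strict_mono:
  assumes "1 \<le> x" "x < y"
  shows "H x < H y"
proof -
  have "\<exists>l z. x < z \<and> z < y \<and> DERIV H z :> l \<and> H y - H x = (y - x) * l"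
    using assms by (intro MVT continuous_on_subset[OF H_cont[of y]])
      (auto simp: real_differentiable_def intro!: exI[of _ "1 / \<phi> _"] H_deriv)
  then obtain l z where z: "x < z" "z < y" "DERIV H z :> l" "H y - H x = (y - x) * l" by blast
  have "l = 1 / \<phi> z" using DERIV_unique[OF z(3) H_deriv] z assms by simp
  then have "l > 0" using phi_pos z assms by simp
  then show ?thesis using z assms by (metis diff_gt_0_iff_gt mult_pos_pos)
qed

lemma H_mono: "1 \<le> x \<Longrightarrow> x \<le> y \<Longrightarrow> H x \<le> H y"
  using H_strict_mono[of x y] by (cases "x = y") auto

lemma H_nonneg: "1 \<le> x \<Longrightarrow> 0 \<le> H x"
  using H_mono[of 1 x] by simp

text \<open>By the linear bound, 1/\<phi> dominates a multiple of 1/u, so \<open>H\<close> dominates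
  a multiple of the logarithm. Hence \<open>H_phi_inv\<close> is meaningful on the whole half
  line.\<close>

lemma H_unbounded: "\<exists>x\<ge>1. y \<le> H x"
proof -
  obtain c where c: "c > 0" "\<And>z. z \<ge> 0 \<Longrightarrow> \<phi> z \<le> c * z" using phi_linear_bound by blast
  have H_ln: "ln x / c \<le> H x" if "1 \<le> x" for x
  proof -
    have "H 1 - ln 1 / c \<le> H x - ln x / c"
    proof (rule DERIV_nonneg_imp_increasing_open[OF that])
      fix u :: real assume u: "1 < u" "u < x"
      have "((\<lambda>u. H u - ln u / c) has_real_derivative 1 / \<phi> u - 1 / u / c) (at u)"
        using u c by (auto intro!: derivative_eq_intros H_deriv)
      moreover have "1 / u / c \<le> 1 / \<phi> u"
        using u c(2)[of u] c(1) phi_pos[of u] by (simp add: field_simps)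
      ultimately show "\<exists>y. ((\<lambda>u. H u - ln u / c) has_real_derivative y) (at u) \<and> 0 \<le> y" by force
    qed (use c in \<open>auto intro!: continuous_intros H_cont\<close>)
    then show ?thesis by simp
  qed
  have "y \<le> H (exp (c * \<bar>y\<bar>))"
    using H_ln[of "exp (c * \<bar>y\<bar>)"] c by simp
  then show ?thesis using c by (intro exI[of _ "exp (c * \<bar>y\<bar>)"]) auto
qed

lemma H_phi_inv:
  assumes "0 \<le> s"
  shows "H_phi_inv \<phi> s \<ge> 1" "H (H_phi_inv \<phi> s) = s"
proof -
  obtain x where x: "x \<ge> 1" "s \<le> H x" using H_unbounded by blast
  obtain y where y: "1 \<le> y" "H y = s"
    using IVT'[of H 1 s x] x assms H_cont[of x] by auto
  have "H_phi_inv \<phi> s = y"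
    unfolding H_phi_inv_def
  proof (rule the_equality)
    fix z assume z: "1 \<le> z \<and> H z = s"
    show "z = y" using H_strict_mono[of z y] H_strict_mono[of y z] z y by (cases z y rule: linorder_cases) auto
  qed (use y in auto)
  then show "H_phi_inv \<phi> s \<ge> 1" "H (H_phi_inv \<phi> s) = s" using y by auto
qed

text \<open>The derivative of ln \<phi> is \<phi>'/\<phi>, which beyond \<open>s\<close> is at most
  \<open>D s\<close> times the derivative 1/\<phi> of \<open>H\<close>. This converts exponential
  decay in \<open>H\<close> at rate \<open>D s\<close> into powers of \<phi>.\<close>

lemma H_log_phi:
  assumes "1 \<le> s" "s \<le> R"
  shows "ln (\<phi> R / \<phi> s) \<le> D s * (H R - H s)"
proof -
  have "D s * H s - ln (\<phi> s) \<le> D s * H R - ln (\<phi> R)"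
  proof (rule DERIV_nonneg_imp_increasing_open[OF assms(2)])
    fix u assume u: "s < u" "u < R"
    have "((\<lambda>u. D s * H u - ln (\<phi> u)) has_real_derivative D s * (1 / \<phi> u) - D u / \<phi> u) (at u)"
      using u assms phi_pos[of u] by (auto intro!: derivative_eq_intros H_deriv phi_deriv)
    moreover have "D u / \<phi> u \<le> D s * (1 / \<phi> u)"
      using u assms phi_pos[of u] D_antimono[of s u] by (simp add: divide_right_mono)
    ultimately show "\<exists>y. ((\<lambda>u. D s * H u - ln (\<phi> u)) has_real_derivative y) (at u) \<and> 0 \<le> y" by force
  next
    have "continuous_on {s..R} H" using assms by (intro continuous_on_subset[OF H_cont[of R]]) auto
    moreover have "\<phi> u \<noteq> 0" if "u \<in> {s..R}" for u using phi_pos[of u] that assms by auto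
    ultimately show "continuous_on {s..R} (\<lambda>u. D s * H u - ln (\<phi> u))"
      using assms by (intro continuous_intros phi_cont) auto
  qed
  then show ?thesis
    using phi_pos[of s] phi_pos[of R] assms by (simp add: ln_div algebra_simps)
qed

text \<open>The logarithmic derivative is (l - \<phi>')/\<phi>, nonpositive up to \<open>s\<close>
  because \<open>l \<le> D s\<close>. Times \<open>l\<close>, the quotient is the derivative of
  exp(l H), so this is the concavity of that function on [1, s].\<close>

lemma exp_H_over_phi_antimono:
  assumes "1 \<le> u" "u \<le> v" "v \<le> s" "0 \<le> l" "l \<le> D s"
  shows "exp (l * H v) / \<phi> v \<le> exp (l * H u) / \<phi> u"
proof -
  have "l * H u - ln (\<phi> u) \<ge> l * H v - ln (\<phi> v)"
  proof (rule DERIV_nonpos_imp_decreasing_open[OF assms(2)])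
    fix x assume x: "u < x" "x < v"
    have "((\<lambda>u. l * H u - ln (\<phi> u)) has_real_derivative l * (1 / \<phi> x) - D x / \<phi> x) (at x)"
      using x assms phi_pos[of x] by (auto intro!: derivative_eq_intros H_deriv phi_deriv)
    moreover have "l * (1 / \<phi> x) \<le> D x / \<phi> x"
      using x assms phi_pos[of x] D_antimono[of x s] by (simp add: divide_right_mono)
    ultimately show "\<exists>y. ((\<lambda>u. l * H u - ln (\<phi> u)) has_real_derivative y) (at x) \<and> y \<le> 0" by force
  next
    have "continuous_on {u..v} H" using assms by (intro continuous_on_subset[OF H_cont[of v]]) auto
    moreover have "\<phi> x \<noteq> 0" if "x \<in> {u..v}" for x using phi_pos[of x] that assms by auto
    ultimately show "continuous_on {u..v} (\<lambda>u. l * H u - ln (\<phi> u))"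
      using assms by (intro continuous_intros phi_cont) auto
  qed
  then have "exp (l * H v - ln (\<phi> v)) \<le> exp (l * H u - ln (\<phi> u))" by simp
  then show ?thesis using assms phi_pos[of u] phi_pos[of v] by (simp add: exp_diff)
qed

text \<open>As exp(l H) has derivative l exp(l H)/\<phi>, a drift of size - \<eta> \<phi> shrinks it
  at the relative rate \<eta> l. It is frozen above \<open>s\<close> because its concavity is
  secured only up to there.\<close>

definition wt :: "real \<Rightarrow> real \<Rightarrow> real \<Rightarrow> real" where
  "wt l s u = exp (l * H (min u s))"

lemma wt_ge_1: "0 \<le> l \<Longrightarrow> 1 \<le> s \<Longrightarrow> 1 \<le> u \<Longrightarrow> 1 \<le> wt l s u"
  unfolding wt_def by (simp add: H_nonneg)

lemma wt_mono: "0 \<le> l \<Longrightarrow> 1 \<le> s \<Longrightarrow> 1 \<le> u \<Longrightarrow> u \<le> v \<Longrightarrow> wt l s u \<le> wt l s v"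
  unfolding wt_def by (auto intro!: mult_left_mono H_mono)

text \<open>The tangent inequality through which a bound on the mean of v becomes a bound on the
  mean of the weight. It extends to \<open>z > s\<close> because freezing lowers the left side while
  the nonnegative slope raises the right side.\<close>

lemma wt_tangent:
  assumes "1 \<le> u" "u \<le> s" "1 \<le> z" and l: "0 \<le> l" "l \<le> D s"
  shows "wt l s z \<le> wt l s u + l * wt l s u / \<phi> u * (z - u)"
proof -
  have *: "exp (l * H z) \<le> exp (l * H u) + l * (exp (l * H u) / \<phi> u) * (z - u)" if z: "1 \<le> z" "z \<le> s" for z
  proof -
    have mvt: "\<exists>x>a. x < b \<and> exp (l * H b) - exp (l * H a) = (b - a) * (l * (exp (l * H x) / \<phi> x))"
      if "1 \<le> a" "a < b" for a b
    proof -
      have d: "((\<lambda>u. exp (l * H u)) has_real_derivative l * (exp (l * H x) / \<phi> x)) (at x)" if "1 < x" for x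
        using that by (auto intro!: derivative_eq_intros H_deriv)
      have "\<exists>m x. a < x \<and> x < b \<and> DERIV (\<lambda>u. exp (l * H u)) x :> m \<and> exp (l * H b) - exp (l * H a) = (b - a) * m"
      proof (rule MVT[OF \<open>a < b\<close>])
        show "continuous_on {a..b} (\<lambda>u. exp (l * H u))"
          using that by (intro continuous_intros continuous_on_subset[OF H_cont[of b]]) auto
        show "(\<lambda>u. exp (l * H u)) differentiable (at x)" if "a < x" "x < b" for x
          using d[of x] that \<open>1 \<le> a\<close> by (auto simp: real_differentiable_def)
      qed
      then obtain m x where x: "a < x" "x < b" "DERIV (\<lambda>u. exp (l * H u)) x :> m"
        "exp (l * H b) - exp (l * H a) = (b - a) * m" by blast
      have "m = l * (exp (l * H x) / \<phi> x)" using DERIV_unique[OF x(3) d] x that by simp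
      with x show ?thesis by auto
    qed
    consider "z = u" | "u < z" | "z < u" by linarith
    then show ?thesis
    proof cases
      case 2
      then obtain x where x: "u < x" "x < z" "exp (l * H z) - exp (l * H u) = (z - u) * (l * (exp (l * H x) / \<phi> x))"
        using mvt[of u z] assms by blast
      have "(z - u) * (l * (exp (l * H x) / \<phi> x)) \<le> (z - u) * (l * (exp (l * H u) / \<phi> u))"
        using x assms z by (intro mult_left_mono exp_H_over_phi_antimono[where s=s]) auto
      then show ?thesis using x by (simp add: algebra_simps)
    next
      case 3
      then obtain x where x: "z < x" "x < u" "exp (l * H u) - exp (l * H z) = (u - z) * (l * (exp (l * H x) / \<phi> x))"
        using mvt[of z u] z by blast
      have "(u - z) * (l * (exp (l * H u) / \<phi> u)) \<le> (u - z) * (l * (exp (l * H x) / \<phi> x))"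
        using x assms z by (intro mult_left_mono exp_H_over_phi_antimono[where s=s]) auto
      moreover have "l * (exp (l * H u) / \<phi> u) * (z - u) = - ((u - z) * (l * (exp (l * H u) / \<phi> u)))"
        by (simp only: mult.commute[of "u - z"] mult_minus_right[symmetric] minus_diff_eq)
      moreover have "e2 \<le> e1 + c" if "a \<le> b" "c = - a" "e1 - e2 = b" for a b c e1 e2 :: real
        using that by simp
      ultimately show ?thesis using x(3) by blast
    qed simp
  qed
  have "wt l s z \<le> wt l s u + l * (wt l s u / \<phi> u) * (min z s - u)"
    using *[of "min z s"] assms by (simp add: wt_def)
  also have "\<dots> \<le> wt l s u + l * (wt l s u / \<phi> u) * (z - u)"
    using assms phi_pos[of u] by (intro add_left_mono mult_left_mono) (auto simp: wt_def)
  finally show ?thesis by simp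
qed

text \<open>Monotonicity of \<phi> is assumed on the half line only; precomposing with
  \<open>max 0\<close> gives a function that is monotone on all reals and hence Borel.\<close>

lemma phi_comp_measurable [measurable]:
  assumes "f \<in> borel_measurable M" "\<And>x. 0 \<le> f x"
  shows "(\<lambda>x. \<phi> (f x)) \<in> borel_measurable M"
proof -
  define g where "g u = \<phi> (max 0 u)" for u
  have "mono g" unfolding g_def by (intro monoI phi_mono) auto
  then have "g \<in> borel_measurable borel" by (rule borel_measurable_mono)
  then have "(\<lambda>x. g (f x)) \<in> borel_measurable M" using assms(1) by measurable
  then show ?thesis using assms(2) by (simp add: g_def max_def)
qed

end

section \<open>Markov semigroups and oscillation bounds\<close>

lemma product_coupling:
  assumes "prob_space \<mu>" "sets \<mu> = sets borel" "prob_space \<nu>" "sets \<nu> = sets borel"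
  shows "\<mu> \<Otimes>\<^sub>M \<nu> \<in> couplings \<mu> \<nu>"
proof -
  interpret \<mu>: prob_space \<mu> by fact
  interpret \<nu>: prob_space \<nu> by fact
  interpret pair_prob_space \<mu> \<nu> ..
  have s: "sets (\<mu> \<Otimes>\<^sub>M \<nu>) = sets (borel \<Otimes>\<^sub>M borel)" using assms by (intro sets_pair_measure_cong) auto
  have "distr (\<mu> \<Otimes>\<^sub>M \<nu>) borel fst = \<mu>"
  proof (rule measure_eqI)
    fix A assume "A \<in> sets (distr (\<mu> \<Otimes>\<^sub>M \<nu>) borel fst)"
    then have A: "A \<in> sets \<mu>" using assms by simp
    have "fst -` A \<inter> space (\<mu> \<Otimes>\<^sub>M \<nu>) = A \<times> space \<nu>"
      using sets.sets_into_space[OF A] by (auto simp: space_pair_measure)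
    then show "emeasure (distr (\<mu> \<Otimes>\<^sub>M \<nu>) borel fst) A = emeasure \<mu> A"
      using A assms by (subst emeasure_distr)
        (auto simp: \<nu>.emeasure_pair_measure_Times \<nu>.emeasure_space_1 measurable_cong_sets[OF s refl])
  qed (simp add: assms)
  moreover have "distr (\<mu> \<Otimes>\<^sub>M \<nu>) borel snd = \<nu>"
  proof (rule measure_eqI)
    fix A assume "A \<in> sets (distr (\<mu> \<Otimes>\<^sub>M \<nu>) borel snd)"
    then have A: "A \<in> sets \<nu>" using assms by simp
    have "snd -` A \<inter> space (\<mu> \<Otimes>\<^sub>M \<nu>) = space \<mu> \<times> A"
      using sets.sets_into_space[OF A] by (auto simp: space_pair_measure)
    then show "emeasure (distr (\<mu> \<Otimes>\<^sub>M \<nu>) borel snd) A = emeasure \<nu> A"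
      using A assms by (subst emeasure_distr)
        (auto simp: \<nu>.emeasure_pair_measure_Times \<mu>.emeasure_space_1 measurable_cong_sets[OF s refl])
  qed (simp add: assms)
  ultimately show ?thesis
    by (simp add: couplings_def s prob_space_axioms)
qed

lemma coupling_marginals:
  assumes c: "c \<in> couplings \<mu> \<nu>" and f[measurable]: "f \<in> borel_measurable borel"
  shows "(\<integral>\<^sup>+z. f (fst z) \<partial>c) = (\<integral>\<^sup>+x. f x \<partial>\<mu>)" "(\<integral>\<^sup>+z. f (snd z) \<partial>c) = (\<integral>\<^sup>+x. f x \<partial>\<nu>)"
proof -
  have [measurable_cong]: "sets c = sets (borel \<Otimes>\<^sub>M borel)" and d: "distr c borel fst = \<mu>" "distr c borel snd = \<nu>"
    using c by (auto simp: couplings_def)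
  show "(\<integral>\<^sup>+z. f (fst z) \<partial>c) = (\<integral>\<^sup>+x. f x \<partial>\<mu>)"
    unfolding d(1)[symmetric] by (rule nn_integral_distr[symmetric]) measurable
  show "(\<integral>\<^sup>+z. f (snd z) \<partial>c) = (\<integral>\<^sup>+x. f x \<partial>\<nu>)"
    unfolding d(2)[symmetric] by (rule nn_integral_distr[symmetric]) measurable
qed

lemma coupling_osc:
  fixes g :: "'a::topological_space \<Rightarrow> real"
  assumes c: "c \<in> couplings \<mu> \<nu>" and g[measurable]: "g \<in> borel_measurable borel" and gB: "\<And>x. \<bar>g x\<bar> \<le> K"
    and \<Psi>: "\<And>x y. \<bar>g x - g y\<bar> \<le> \<Psi> (x, y)" and B: "(\<integral>\<^sup>+z. ennreal (\<Psi> z) \<partial>c) \<le> ennreal B" "0 \<le> B"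
  shows "\<bar>(\<integral>x. g x \<partial>\<mu>) - (\<integral>x. g x \<partial>\<nu>)\<bar> \<le> B"
proof -
  have s[measurable_cong]: "sets c = sets (borel \<Otimes>\<^sub>M borel)" and d: "distr c borel fst = \<mu>" "distr c borel snd = \<nu>"
    and "prob_space c"
    using c by (auto simp: couplings_def)
  interpret prob_space c by fact
  have i: "integrable c (\<lambda>z. g (fst z))" "integrable c (\<lambda>z. g (snd z))"
    by (auto intro!: integrable_const_bound[where B=K] simp: gB)
  have "(\<integral>x. g x \<partial>\<mu>) = (\<integral>z. g (fst z) \<partial>c)" unfolding d(1)[symmetric] by (rule integral_distr) measurable
  moreover have "(\<integral>x. g x \<partial>\<nu>) = (\<integral>z. g (snd z) \<partial>c)" unfolding d(2)[symmetric] by (rule integral_distr) measurable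
  ultimately have "\<bar>(\<integral>x. g x \<partial>\<mu>) - (\<integral>x. g x \<partial>\<nu>)\<bar> = \<bar>\<integral>z. g (fst z) - g (snd z) \<partial>c\<bar>" using i by simp
  also have "\<dots> \<le> (\<integral>z. \<bar>g (fst z) - g (snd z)\<bar> \<partial>c)" by (rule integral_abs_bound)
  also have "\<dots> \<le> B"
  proof -
    have "ennreal (\<integral>z. \<bar>g (fst z) - g (snd z)\<bar> \<partial>c) = (\<integral>\<^sup>+z. ennreal \<bar>g (fst z) - g (snd z)\<bar> \<partial>c)"
      using i by (intro nn_integral_eq_integral[symmetric]) auto
    also have "\<dots> \<le> (\<integral>\<^sup>+z. ennreal (\<Psi> z) \<partial>c)"
      by (intro nn_integral_mono ennreal_leI) (use \<Psi> in auto)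
    also note B(1)
    finally show ?thesis using B(2) by (simp add: ennreal_le_iff)
  qed
  finally show ?thesis .
qed

text \<open>Young's inequality is applied pointwise to \<open>d / A\<close> and \<open>W / B\<close>
  and then integrated. The bounds \<open>A\<close> and \<open>B\<close> take the place of the exact
  integrals, so the conclusion is in the form in which the estimates arrive.\<close>

lemma nn_integral_Hoelder:
  assumes "prob_space M" and d[measurable]: "d \<in> borel_measurable M" and W[measurable]: "W \<in> borel_measurable M"
    and d0: "\<And>x. 0 \<le> d x" and W0: "\<And>x. 0 \<le> (W x :: real)"
    and A: "(\<integral>\<^sup>+x. ennreal (d x) \<partial>M) \<le> ennreal A" "0 < A" and B: "(\<integral>\<^sup>+x. ennreal (W x) \<partial>M) \<le> ennreal B" "0 < B"
    and q: "0 < q" "q < 1"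
  shows "(\<integral>\<^sup>+x. ennreal (d x powr (1 - q) * W x powr q) \<partial>M) \<le> ennreal (A powr (1 - q) * B powr q)"
proof -
  interpret prob_space M by fact
  define C where "C = A powr (1 - q) * B powr q"
  have "C > 0" using A B by (simp add: C_def)
  have pt: "d x powr (1 - q) * W x powr q \<le> C * ((1 - q) / A) * d x + C * (q / B) * W x" for x
  proof (cases "d x = 0 \<or> W x = 0")
    case True
    then show ?thesis using \<open>C > 0\<close> A B q d0[of x] W0[of x] by (auto intro!: add_nonneg_nonneg mult_nonneg_nonneg)
  next
    case False
    then have pos: "d x > 0" "W x > 0" using d0[of x] W0[of x] by auto
    have "(d x / A) powr (1 - q) * (W x / B) powr q \<le> (1 - q) * (d x / A) + q * (W x / B)"
      using pos A B q by (intro Youngs_inequality_0) auto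
    then have "C * ((d x / A) powr (1 - q) * (W x / B) powr q) \<le> C * ((1 - q) * (d x / A) + q * (W x / B))"
      using \<open>C > 0\<close> by (intro mult_left_mono) auto
    moreover have "C * ((d x / A) powr (1 - q) * (W x / B) powr q) = d x powr (1 - q) * W x powr q"
      using pos A B by (simp add: C_def powr_divide)
    ultimately show ?thesis by (simp add: algebra_simps)
  qed
  have "(\<integral>\<^sup>+x. ennreal (d x powr (1 - q) * W x powr q) \<partial>M) \<le> (\<integral>\<^sup>+x. ennreal (C * ((1 - q) / A)) * ennreal (d x) + ennreal (C * (q / B)) * ennreal (W x) \<partial>M)"
  proof (rule nn_integral_mono)
    fix x
    have c: "0 \<le> C * ((1 - q) / A)" "0 \<le> C * (q / B)" using \<open>C > 0\<close> A B q by auto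
    have "ennreal (d x powr (1 - q) * W x powr q) \<le> ennreal (C * ((1 - q) / A) * d x + C * (q / B) * W x)"
      by (rule ennreal_leI[OF pt])
    also have "\<dots> = ennreal (C * ((1 - q) / A)) * ennreal (d x) + ennreal (C * (q / B)) * ennreal (W x)"
      using c d0[of x] W0[of x] by (subst ennreal_plus) (auto simp only: ennreal_mult mult_nonneg_nonneg)
    finally show "ennreal (d x powr (1 - q) * W x powr q) \<le> \<dots>" .
  qed
  also have "\<dots> = ennreal (C * ((1 - q) / A)) * (\<integral>\<^sup>+x. ennreal (d x) \<partial>M) + ennreal (C * (q / B)) * (\<integral>\<^sup>+x. ennreal (W x) \<partial>M)"
    by (subst nn_integral_add) (auto simp: nn_integral_cmult)
  also have "\<dots> \<le> ennreal (C * ((1 - q) / A)) * ennreal A + ennreal (C * (q / B)) * ennreal B"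
    by (intro add_mono mult_left_mono A B) auto
  also have "\<dots> = ennreal (C * ((1 - q) / A) * A + C * (q / B) * B)"
    using \<open>C > 0\<close> A B q by (simp flip: ennreal_mult ennreal_plus)
  also have "C * ((1 - q) / A) * A + C * (q / B) * B = C" using A B by (simp add: field_simps)
  finally show ?thesis by (simp add: C_def)
qed

section \<open>Kernel calculus and propagation of oscillation bounds\<close>

locale markov_semigroup =
  fixes P :: "real \<Rightarrow> 'a::polish_space \<Rightarrow> 'a measure"
  assumes markov: "markov_tf P"
begin

lemma prob_P: "t \<ge> 0 \<Longrightarrow> prob_space (P t x)" and sets_P: "t \<ge> 0 \<Longrightarrow> sets (P t x) = sets borel"
  using markov by (auto simp: markov_tf_def)

lemma space_P: "t \<ge> 0 \<Longrightarrow> space (P t x) = UNIV"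
  using sets_eq_imp_space_eq[OF sets_P] by simp

lemma P_0: "P 0 x = return borel x"
  using markov by (auto simp: markov_tf_def)

lemma kernel_P: "t \<ge> 0 \<Longrightarrow> P t \<in> borel \<rightarrow>\<^sub>M prob_algebra borel"
  using markov by (intro measurable_prob_algebraI measurable_subprob_algebra)
    (auto simp: markov_tf_def prob_space_imp_subprob_space)

lemma subkernel_P: "t \<ge> 0 \<Longrightarrow> P t \<in> borel \<rightarrow>\<^sub>M subprob_algebra borel"
  by (rule measurable_prob_algebraD[OF kernel_P])

lemma subkernel_P': "t \<ge> 0 \<Longrightarrow> sets \<mu> = sets borel \<Longrightarrow> P t \<in> \<mu> \<rightarrow>\<^sub>M subprob_algebra borel"
  using subkernel_P[of t] by (simp cong: measurable_cong_sets)

lemma measurable_nn_P: "t \<ge> 0 \<Longrightarrow> f \<in> borel_measurable borel \<Longrightarrow> (\<lambda>x. \<integral>\<^sup>+y. f y \<partial>P t x) \<in> borel_measurable borel"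
  by (rule measurable_compose[OF subkernel_P nn_integral_measurable_subprob_algebra])

lemma measurable_int_P:
  fixes f :: "'a \<Rightarrow> real"
  shows "t \<ge> 0 \<Longrightarrow> f \<in> borel_measurable borel \<Longrightarrow> (\<lambda>x. \<integral>y. f y \<partial>P t x) \<in> borel_measurable borel"
  by (rule measurable_compose[OF subkernel_P integral_measurable_subprob_algebra])

lemma P_add:
  assumes "0 \<le> s" "0 \<le> t"
  shows "P (s + t) x = P s x \<bind> P t"
proof (rule measure_eqI)
  have k: "P t \<in> P s x \<rightarrow>\<^sub>M subprob_algebra borel" by (rule subkernel_P'[OF assms(2) sets_P[OF assms(1)]])
  show s: "sets (P (s + t) x) = sets (P s x \<bind> P t)"
    using assms by (subst sets_bind[where N=borel]) (auto simp: sets_P space_P)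
  fix A assume "A \<in> sets (P (s + t) x)"
  then have A: "A \<in> sets borel" using sets_P assms by simp
  have "emeasure (P s x \<bind> P t) A = (\<integral>\<^sup>+ y. emeasure (P t y) A \<partial>P s x)"
    using A k assms by (intro emeasure_bind[where N=borel]) (auto simp: space_P)
  then show "emeasure (P (s + t) x) A = emeasure (P s x \<bind> P t) A"
    using markov assms A by (auto simp: markov_tf_def)
qed

lemma nn_integral_P_add:
  assumes "0 \<le> s" "0 \<le> t" "f \<in> borel_measurable borel"
  shows "(\<integral>\<^sup>+y. f y \<partial>P (s + t) x) = (\<integral>\<^sup>+z. \<integral>\<^sup>+y. f y \<partial>P t z \<partial>P s x)"
  unfolding P_add[OF assms(1,2)]
  by (rule nn_integral_bind[OF assms(3) subkernel_P'[OF assms(2) sets_P[OF assms(1)]]])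

lemma integral_P_bind:
  fixes f :: "'a \<Rightarrow> real"
  assumes "prob_space \<mu>" "sets \<mu> = sets borel" "0 \<le> t" "f \<in> borel_measurable borel" "\<And>x. \<bar>f x\<bar> \<le> K"
  shows "(\<integral>y. f y \<partial>(\<mu> \<bind> P t)) = (\<integral>z. (\<integral>y. f y \<partial>P t z) \<partial>\<mu>)"
proof (rule integral_bind[where K=borel and B'=1])
  show "finite_measure \<mu>" by (rule prob_space.finite_measure[OF assms(1)])
  show "AE x in \<mu>. emeasure (P t x) (space (P t x)) \<le> ennreal 1"
    using prob_space.emeasure_space_1[OF prob_P[OF assms(3)]] by simp
qed (use assms subkernel_P' in auto)

lemma integral_P_add:
  fixes f :: "'a \<Rightarrow> real"
  assumes "0 \<le> s" "0 \<le> t" "f \<in> borel_measurable borel" "\<And>x. \<bar>f x\<bar> \<le> K"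
  shows "(\<integral>y. f y \<partial>P (s + t) x) = (\<integral>z. (\<integral>y. f y \<partial>P t z) \<partial>P s x)"
  unfolding P_add[OF assms(1,2)] by (rule integral_P_bind[OF prob_P sets_P]) (use assms in auto)

lemma integral_P_bounded:
  fixes f :: "'a \<Rightarrow> real"
  assumes "0 \<le> t" "f \<in> borel_measurable borel" "\<And>x. \<bar>f x\<bar> \<le> K"
  shows "\<bar>\<integral>y. f y \<partial>P t x\<bar> \<le> K"
proof -
  interpret prob_space "P t x" by (rule prob_P[OF assms(1)])
  have [measurable]: "f \<in> borel_measurable (P t x)" using assms(2) sets_P[OF assms(1)] by (simp cong: measurable_cong_sets)
  have "\<bar>\<integral>y. f y \<partial>P t x\<bar> \<le> (\<integral>y. \<bar>f y\<bar> \<partial>P t x)" by (rule integral_abs_bound)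
  also have "\<dots> \<le> (\<integral>y. K \<partial>P t x)"
    using assms(3) abs_ge_zero[THEN order_trans, OF assms(3)]
    by (intro integral_mono integrable_const_bound[where B=K]) auto
  finally show ?thesis by (simp add: prob_space)
qed

text \<open>Hoelder's inequality separates the distance, which depends on the coupling, from the
  weights, whose integral depends on the two marginals only.\<close>

lemma coupling_step:
  fixes g J :: "'a \<Rightarrow> real"
  assumes t: "0 \<le> t" and c: "c \<in> couplings (P t x) (P t y)"
    and d[measurable]: "d \<in> borel_measurable (borel \<Otimes>\<^sub>M borel)" and d0: "\<And>z. 0 \<le> d z"
    and A: "(\<integral>\<^sup>+z. ennreal (d z) \<partial>c) \<le> ennreal A" "0 < A"
    and J[measurable]: "J \<in> borel_measurable borel" and J0: "\<And>x. 0 \<le> J x"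
    and B: "(\<integral>\<^sup>+u. ennreal (J u) \<partial>P t x) + (\<integral>\<^sup>+u. ennreal (J u) \<partial>P t y) \<le> ennreal B" "0 < B"
    and g[measurable]: "g \<in> borel_measurable borel" and gK: "\<And>x. \<bar>g x\<bar> \<le> K"
    and osc: "\<And>u v. \<bar>g u - g v\<bar> \<le> d (u, v) powr (1 - q) * (J u + J v) powr q" and q: "0 < q" "q < 1"
  shows "\<bar>(\<integral>u. g u \<partial>P t x) - (\<integral>u. g u \<partial>P t y)\<bar> \<le> A powr (1 - q) * B powr q"
proof (rule coupling_osc[OF c g gK])
  have [measurable_cong]: "sets c = sets (borel \<Otimes>\<^sub>M borel)" and "prob_space c"
    using c by (auto simp: couplings_def)
  show "(\<integral>\<^sup>+z. ennreal (d z powr (1 - q) * (J (fst z) + J (snd z)) powr q) \<partial>c) \<le> ennreal (A powr (1 - q) * B powr q)"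
  proof (rule nn_integral_Hoelder[OF \<open>prob_space c\<close> _ _ d0 _ A _ B(2) q])
    have "(\<integral>\<^sup>+z. ennreal (J (fst z) + J (snd z)) \<partial>c) = (\<integral>\<^sup>+z. ennreal (J (fst z)) \<partial>c) + (\<integral>\<^sup>+z. ennreal (J (snd z)) \<partial>c)"
      using J0 by (subst nn_integral_add[symmetric]) auto
    then show "(\<integral>\<^sup>+z. ennreal (J (fst z) + J (snd z)) \<partial>c) \<le> ennreal B"
      using B(1) coupling_marginals[OF c, of "\<lambda>u. ennreal (J u)"] by simp
  qed (use J0 in auto)
qed (use osc in auto)

end

lemma premetric_measurable:
  fixes \<theta> :: "'a::second_countable_topology \<Rightarrow> 'a \<Rightarrow> real"
  assumes "premetric \<theta>"
  shows "(\<lambda>z. \<theta> (fst z) (snd z)) \<in> borel_measurable (borel \<Otimes>\<^sub>M borel)"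
  unfolding borel_prod
  by (rule borel_measurableI_greater) (use assms in \<open>auto simp: premetric_def\<close>)

text \<open>The one-element list \<open>[(t, A)]\<close> singles out the marginal at time
  \<open>t\<close> among the finite-dimensional distributions.\<close>

lemma has_markov_law_distr:
  assumes "has_markov_law P x M X" "0 \<le> t" "sets (P t x) = sets borel"
  shows "distr M borel (X t) = P t x"
proof (rule measure_eqI)
  have X: "X t \<in> M \<rightarrow>\<^sub>M borel" using assms by (auto simp: has_markov_law_def)
  fix A assume "A \<in> sets (distr M borel (X t))"
  then have A: "A \<in> sets borel" by simp
  have "emeasure M {\<omega>\<in>space M. \<forall>i<length [(t, A)]. X (\<Sum>j\<le>i. fst ([(t, A)] ! j)) \<omega> \<in> snd ([(t, A)] ! i)}
      = mkv_fdd P x [(t, A)]"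
    using assms(1)[unfolded has_markov_law_def, THEN conjunct2, THEN conjunct2, rule_format, of "[(t, A)]"] A assms(2)
    by auto
  then have "emeasure M {\<omega>\<in>space M. X t \<omega> \<in> A} = (\<integral>\<^sup>+y. indicator A y \<partial>P t x)" by simp
  moreover have "X t -` A \<inter> space M = {\<omega>\<in>space M. X t \<omega> \<in> A}" by auto
  ultimately show "emeasure (distr M borel (X t)) A = emeasure (P t x) A"
    using A assms(3) by (simp add: emeasure_distr[OF X A])
qed (simp add: assms)

context markov_semigroup
begin

text \<open>\<open>X t\<close> has the right law but \<open>Y t\<close> only approximately, so
  \<open>dTV_coupling\<close> corrects \<open>Y t\<close>. Because the cost is truncated at 1, the
  correction adds at most \<open>L t * \<theta> x y\<close>, without the factor
  \<open>N\<close>.\<close>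

lemma assumption_A_coupling:
  assumes A: "assumption_A TYPE('w) P \<theta> r L" and \<theta>: "premetric \<theta>" and "0 \<le> t" "0 \<le> N"
  shows "\<exists>c\<in>couplings (P t x) (P t y). (\<integral>\<^sup>+z. ennreal (min 1 (N * \<theta> (fst z) (snd z))) \<partial>c) \<le> ennreal ((N * r t + L t) * \<theta> x y)"
proof -
  note [measurable] = premetric_measurable[OF \<theta>]
  have \<theta>0: "0 \<le> \<theta> x y" for x y using \<theta> by (auto simp: premetric_def)
  have rL: "0 \<le> r t" "0 \<le> L t" using A \<open>0 \<le> t\<close> by (auto simp: assumption_A_def)
  obtain M :: "'w measure" and X Y where X: "has_markov_law P x M X" and Y: "\<And>t. t \<ge> 0 \<Longrightarrow> Y t \<in> M \<rightarrow>\<^sub>M borel"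
    and TV: "\<And>t. t \<ge> 0 \<Longrightarrow> dTV (distr M borel (Y t)) (P t y) \<le> L t * \<theta> x y"
    and XY: "\<And>t. t \<ge> 0 \<Longrightarrow> (\<integral>\<^sup>+ \<omega>. ennreal (\<theta> (X t \<omega>) (Y t \<omega>)) \<partial>M) \<le> ennreal (r t * \<theta> x y)"
    using A[unfolded assumption_A_def, THEN conjunct2, THEN conjunct2, THEN conjunct2, THEN conjunct2, THEN conjunct2, rule_format, of x y]
    by (elim exE conjE) (rule that, auto)
  have M: "prob_space M" and Xm: "X t \<in> M \<rightarrow>\<^sub>M borel" using X \<open>0 \<le> t\<close> by (auto simp: has_markov_law_def)
  note [measurable] = Xm Y[OF \<open>0 \<le> t\<close>]
  obtain c where c: "c \<in> couplings (distr M borel (X t)) (P t y)"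
    and g: "\<And>g. g \<in> borel_measurable (borel \<Otimes>\<^sub>M borel) \<Longrightarrow> (\<forall>z. 0 \<le> g z \<and> g z \<le> 1) \<Longrightarrow>
       (\<integral>\<^sup>+z. ennreal (g z) \<partial>c) \<le> (\<integral>\<^sup>+\<omega>. ennreal (g (X t \<omega>, Y t \<omega>)) \<partial>M) + ennreal (L t * \<theta> x y)"
    using dTV_coupling[OF M Xm Y prob_P sets_P TV] \<open>0 \<le> t\<close> by blast
  have "(\<integral>\<^sup>+z. ennreal (min 1 (N * \<theta> (fst z) (snd z))) \<partial>c)
      \<le> (\<integral>\<^sup>+\<omega>. ennreal (min 1 (N * \<theta> (X t \<omega>) (Y t \<omega>))) \<partial>M) + ennreal (L t * \<theta> x y)"
    using g[of "\<lambda>z. min 1 (N * \<theta> (fst z) (snd z))"] \<open>0 \<le> N\<close> \<theta>0 by simp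
  also have "(\<integral>\<^sup>+\<omega>. ennreal (min 1 (N * \<theta> (X t \<omega>) (Y t \<omega>))) \<partial>M) \<le> (\<integral>\<^sup>+\<omega>. ennreal N * ennreal (\<theta> (X t \<omega>) (Y t \<omega>)) \<partial>M)"
    using \<open>0 \<le> N\<close> \<theta>0 by (intro nn_integral_mono) (auto simp flip: ennreal_mult intro!: ennreal_leI)
  also have "\<dots> = ennreal N * (\<integral>\<^sup>+\<omega>. ennreal (\<theta> (X t \<omega>) (Y t \<omega>)) \<partial>M)"
    by (rule nn_integral_cmult) (use measurable_compose[OF measurable_Pair[OF Xm Y[OF \<open>0 \<le> t\<close>]] premetric_measurable[OF \<theta>]] in simp)
  also have "\<dots> \<le> ennreal N * ennreal (r t * \<theta> x y)"
    by (intro mult_left_mono XY \<open>0 \<le> t\<close>) auto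
  finally have "(\<integral>\<^sup>+z. ennreal (min 1 (N * \<theta> (fst z) (snd z))) \<partial>c) \<le> ennreal N * ennreal (r t * \<theta> x y) + ennreal (L t * \<theta> x y)"
    by (simp add: add_right_mono)
  also have "\<dots> = ennreal ((N * r t + L t) * \<theta> x y)"
    using rL \<open>0 \<le> N\<close> \<theta>0[of x y] by (simp add: algebra_simps flip: ennreal_mult ennreal_plus)
  finally show ?thesis
    using c has_markov_law_distr[OF X \<open>0 \<le> t\<close> sets_P[OF \<open>0 \<le> t\<close>]] by auto
qed

text \<open>The last leg \<open>T\<close> is handled first, on the level of functions: it turns the
  oscillation bound for \<open>g\<close> into one for \<open>g1\<close>, with \<open>N2\<close> in
  place of \<open>N\<close> and \<open>J1\<close> in place of \<open>J\<close>. The coupling over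
  \<open>T\<close> is chosen separately for each pair, and no measurable dependence on the pair is
  required.\<close>

lemma two_step:
  fixes g J :: "'a \<Rightarrow> real"
  assumes \<theta>: "premetric \<theta>" and T: "0 \<le> T" and t: "0 \<le> t" and N: "0 < N" "0 < N2"
    and coup: "\<And>u v. \<exists>c\<in>couplings (P T u) (P T v). (\<integral>\<^sup>+z. ennreal (min 1 (N * \<theta> (fst z) (snd z))) \<partial>c) \<le> ennreal (N2 * \<theta> u v)"
    and c: "c \<in> couplings (P t x) (P t y)" "(\<integral>\<^sup>+z. ennreal (min 1 (N2 * \<theta> (fst z) (snd z))) \<partial>c) \<le> ennreal A" "0 < A"
    and J[measurable]: "J \<in> borel_measurable borel" and J0: "\<And>x. j0 \<le> J x" "0 < j0"
    and Jfin: "\<And>u. (\<integral>\<^sup>+z. ennreal (J z) \<partial>P T u) < \<infinity>"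
    and B: "(\<integral>\<^sup>+u. ennreal (J u) \<partial>P (t + T) x) + (\<integral>\<^sup>+u. ennreal (J u) \<partial>P (t + T) y) \<le> ennreal B" "0 < B"
    and g[measurable]: "g \<in> borel_measurable borel" and gK: "\<And>x. \<bar>g x\<bar> \<le> K"
    and osc: "\<And>u v. \<bar>g u - g v\<bar> \<le> (min 1 (N * \<theta> u v)) powr (1 - q) * (J u + J v) powr q" and q: "0 < q" "q < 1"
  shows "\<bar>(\<integral>u. g u \<partial>P (t + T) x) - (\<integral>u. g u \<partial>P (t + T) y)\<bar> \<le> A powr (1 - q) * B powr q"
proof -
  note [measurable] = premetric_measurable[OF \<theta>]
  have \<theta>0: "0 \<le> \<theta> x y" "x \<noteq> y \<Longrightarrow> 0 < \<theta> x y" for x y using \<theta> by (auto simp: premetric_def less_le)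
  define g1 where "g1 u = (\<integral>z. g z \<partial>P T u)" for u
  define J1 where "J1 u = enn2real (\<integral>\<^sup>+z. ennreal (J z) \<partial>P T u)" for u
  have J1: "ennreal (J1 u) = (\<integral>\<^sup>+z. ennreal (J z) \<partial>P T u)" for u
    unfolding J1_def by (rule ennreal_enn2real) (use Jfin[of u] in simp)
  have J1j: "j0 \<le> J1 u" for u
  proof -
    interpret prob_space "P T u" by (rule prob_P[OF T])
    have "ennreal j0 = (\<integral>\<^sup>+z. ennreal j0 \<partial>P T u)" by (simp add: emeasure_space_1)
    also have "\<dots> \<le> ennreal (J1 u)" unfolding J1 by (intro nn_integral_mono ennreal_leI J0)
    finally show ?thesis by (subst (asm) ennreal_le_iff) (auto simp: J1_def)
  qed
  have J1m[measurable]: "J1 \<in> borel_measurable borel"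
    unfolding J1_def using measurable_nn_P[OF T, of "\<lambda>z. ennreal (J z)"] by measurable
  have g1m[measurable]: "g1 \<in> borel_measurable borel"
    unfolding g1_def by (rule measurable_int_P[OF T g])
  have g1K: "\<bar>g1 u\<bar> \<le> K" for u unfolding g1_def by (rule integral_P_bounded[OF T g gK])
  have "\<bar>g1 u - g1 v\<bar> \<le> (min 1 (N2 * \<theta> u v)) powr (1 - q) * (J1 u + J1 v) powr q" for u v
  \<comment> \<open>\<open>coupling_step\<close> asks for a positive bound on the cost, which min(1,
    N2 \<theta>) provides off the diagonal only; on the diagonal the left side vanishes.\<close>
  proof (cases "u = v")
    case False
    obtain c where c: "c \<in> couplings (P T u) (P T v)"
      "(\<integral>\<^sup>+z. ennreal (min 1 (N * \<theta> (fst z) (snd z))) \<partial>c) \<le> ennreal (N2 * \<theta> u v)" using coup by blast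
    interpret c: prob_space c using c by (auto simp: couplings_def)
    have "(\<integral>\<^sup>+z. ennreal (min 1 (N * \<theta> (fst z) (snd z))) \<partial>c) \<le> (\<integral>\<^sup>+z. 1 \<partial>c)"
      by (intro nn_integral_mono) (auto simp flip: ennreal_1 intro!: ennreal_leI)
    then have "(\<integral>\<^sup>+z. ennreal (min 1 (N * \<theta> (fst z) (snd z))) \<partial>c) \<le> ennreal (min 1 (N2 * \<theta> u v))"
      using c(2) by (auto simp: min_def c.emeasure_space_1)
    from coupling_step[OF T c(1) _ _ this _ J _ _ _ g gK _ q, of "J1 u + J1 v"] show ?thesis
      unfolding g1_def using N \<theta>0 False osc J0 order_trans[OF less_imp_le[OF J0(2)] J0(1)] J1j[of u] J1j[of v]
      by (simp flip: J1 ennreal_plus)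
  qed (auto simp: add_nonneg_nonneg)
  note osc1 = this
  have "\<bar>(\<integral>u. g1 u \<partial>P t x) - (\<integral>u. g1 u \<partial>P t y)\<bar> \<le> A powr (1 - q) * B powr q"
  proof (rule coupling_step[OF t c(1) _ _ c(2,3) J1m _ _ B(2) g1m g1K _ q])
    show "(\<integral>\<^sup>+u. ennreal (J1 u) \<partial>P t x) + (\<integral>\<^sup>+u. ennreal (J1 u) \<partial>P t y) \<le> ennreal B"
      using B(1) by (simp add: J1 nn_integral_P_add[OF t T])
    show "0 \<le> J1 x" for x by (simp add: J1_def)
  qed (use N \<theta>0 osc1 in auto)
  then show ?thesis
    unfolding g1_def using integral_P_add[OF t T g gK] by simp
qed

text \<open>Under the independent coupling both points land in \<open>D\<close> with probability at
  least the square of the B1 constant. Smallness \<open>1 / (2 * N2)\<close> makes the cost at most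
  1/2 there, which saves half of that probability.\<close>

lemma small_set_coupling:
  assumes \<theta>: "premetric \<theta>" and t: "0 \<le> t" and N: "0 < N2" and B1: "assumption_B1 P \<theta> S t"
  shows "\<exists>\<kappa>. 0 < \<kappa> \<and> \<kappa> < 1 \<and> (\<forall>x\<in>S. \<forall>y\<in>S. (\<integral>\<^sup>+z. ennreal (min 1 (N2 * \<theta> (fst z) (snd z))) \<partial>(P t x \<Otimes>\<^sub>M P t y)) \<le> ennreal (1 - \<kappa>))"
proof -
  note [measurable] = premetric_measurable[OF \<theta>]
  obtain D m where D[measurable]: "D \<in> sets borel" and m: "m > 0" "\<And>x. x \<in> S \<Longrightarrow> measure (P t x) D \<ge> m"
    and small: "\<And>x y. x \<in> D \<Longrightarrow> y \<in> D \<Longrightarrow> \<theta> x y \<le> 1 / (2 * N2)"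
    using B1[unfolded assumption_B1_def, rule_format, of "1 / (2 * N2)"] N by auto
  define \<kappa> where "\<kappa> = (min m 1)\<^sup>2 / 2"
  have \<kappa>: "0 < \<kappa>" "\<kappa> < 1" using m power_le_one[of "min m 1" 2] by (auto simp: \<kappa>_def)
  have "(\<integral>\<^sup>+z. ennreal (min 1 (N2 * \<theta> (fst z) (snd z))) \<partial>(P t x \<Otimes>\<^sub>M P t y)) \<le> ennreal (1 - \<kappa>)" if xy: "x \<in> S" "y \<in> S" for x y
  proof -
    interpret x: prob_space "P t x" by (rule prob_P[OF t])
    interpret y: prob_space "P t y" by (rule prob_P[OF t])
    interpret xy: pair_prob_space "P t x" "P t y" ..
    have [measurable_cong]: "sets (P t x \<Otimes>\<^sub>M P t y) = sets (borel \<Otimes>\<^sub>M borel)"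
      by (intro sets_pair_measure_cong sets_P t)
    have DD: "D \<times> D \<in> sets (P t x \<Otimes>\<^sub>M P t y)"
      by (intro pair_measureI) (simp_all add: sets_P[OF t])
    have le: "min 1 (N2 * \<theta> (fst z) (snd z)) \<le> 1 - indicator (D \<times> D) z / 2" for z
    proof (cases "z \<in> D \<times> D")
      case True
      then have "\<theta> (fst z) (snd z) \<le> 1 / (2 * N2)" using small by auto
      then have "N2 * \<theta> (fst z) (snd z) \<le> 1 / 2" using N by (simp add: field_simps)
      then show ?thesis using True by simp
    qed simp
    have "(\<integral>\<^sup>+z. ennreal (min 1 (N2 * \<theta> (fst z) (snd z))) \<partial>(P t x \<Otimes>\<^sub>M P t y))
       \<le> (\<integral>\<^sup>+z. ennreal (1 - indicator (D \<times> D) z / 2) \<partial>(P t x \<Otimes>\<^sub>M P t y))"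
      by (intro nn_integral_mono ennreal_leI le)
    also have "\<dots> = ennreal (\<integral>z. 1 - indicator (D \<times> D) z / 2 \<partial>(P t x \<Otimes>\<^sub>M P t y))"
      using DD by (intro nn_integral_eq_integral xy.integrable_const_bound[where B=1])
        (auto split: split_indicator)
    also have "(\<integral>z. 1 - indicator (D \<times> D) z / 2 \<partial>(P t x \<Otimes>\<^sub>M P t y)) = 1 - xy.prob (D \<times> D) / 2"
      using DD by (subst Bochner_Integration.integral_diff) (auto simp: xy.prob_space intro!: xy.integrable_const_bound[where B=1] split: split_indicator)
    also have "xy.prob (D \<times> D) = x.prob D * y.prob D"
      using t by (simp add: sets_P measure_def y.emeasure_pair_measure_Times enn2real_mult)
    also have "1 - (x.prob D * y.prob D) / 2 \<le> 1 - \<kappa>"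
    proof -
      have "min m 1 * min m 1 \<le> x.prob D * y.prob D"
        using m(1) m(2)[OF xy(1)] m(2)[OF xy(2)] by (intro mult_mono) auto
      then show ?thesis by (simp add: \<kappa>_def power2_eq_square)
    qed
    finally show ?thesis by (simp add: ennreal_leI)
  qed
  with \<kappa> show ?thesis by blast
qed

end

section \<open>Lyapunov drift in discrete time\<close>

text \<open>The constant \<open>a\<close> may be negative, so the nonnegative integral cannot be
  split directly; the estimate passes through the Bochner integral.\<close>

lemma nn_integral_affine_bound:
  fixes f v :: "'a \<Rightarrow> real"
  assumes "prob_space M" and v[measurable]: "v \<in> borel_measurable M" and v0: "\<And>z. 0 \<le> v z"
    and m: "(\<integral>\<^sup>+z. ennreal (v z) \<partial>M) \<le> ennreal m" "0 \<le> m"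
    and f: "\<And>z. 0 \<le> f z" "\<And>z. f z \<le> a + b * v z" and b: "0 \<le> b"
  shows "(\<integral>\<^sup>+z. ennreal (f z) \<partial>M) \<le> ennreal (a + b * m)"
proof -
  interpret prob_space M by fact
  have i: "integrable M v"
    using m v0 by (intro integrableI_bounded) (auto simp: abs_of_nonneg less_top[symmetric] top_unique intro: le_less_trans)
  have "ennreal (\<integral>z. v z \<partial>M) \<le> ennreal m"
    using m(1) nn_integral_eq_integral[OF i] v0 by simp
  then have im: "(\<integral>z. v z \<partial>M) \<le> m" using m(2) by (simp add: ennreal_le_iff)
  have "(\<integral>\<^sup>+z. ennreal (f z) \<partial>M) \<le> (\<integral>\<^sup>+z. ennreal (a + b * v z) \<partial>M)"
    by (intro nn_integral_mono ennreal_leI f)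
  also have "\<dots> = ennreal (\<integral>z. a + b * v z \<partial>M)"
    using i order_trans[OF f] by (intro nn_integral_eq_integral) auto
  also have "(\<integral>z. a + b * v z \<partial>M) = a + b * (\<integral>z. v z \<partial>M)"
    using i by (simp add: prob_space)
  also have "\<dots> \<le> a + b * m" using im b by (simp add: mult_left_mono)
  finally show ?thesis by (simp add: ennreal_leI)
qed

locale lyapunov_semigroup = markov_semigroup P + concave_rate \<phi>
  for P :: "real \<Rightarrow> 'a::polish_space \<Rightarrow> 'a measure" and \<phi> :: "real \<Rightarrow> real" +
  fixes V :: "'a \<Rightarrow> real" and K c :: real
  assumes V_meas [measurable]: "V \<in> borel_measurable borel" and V_nonneg: "\<And>x. V x \<ge> 0"
    and K_pos: "K > 0"
    and lyapunov: "\<And>t x. t \<ge> 0 \<Longrightarrow>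
        (\<integral>\<^sup>+ y. ennreal (V y) \<partial>P t x)
          + (\<integral>\<^sup>+ s\<in>{0..t}. (\<integral>\<^sup>+ y. ennreal (\<phi> (V y)) \<partial>P s x) \<partial>lborel)
        \<le> ennreal (V x + K * t)"
    and c_pos: "c > 0" and phi_lin: "\<And>z. z \<ge> 0 \<Longrightarrow> \<phi> z \<le> c * z"
begin

lemma phiV_measurable [measurable]: "(\<lambda>x. \<phi> (V x)) \<in> borel_measurable borel"
  using V_nonneg by (intro phi_comp_measurable) auto

lemma V_growth:
  assumes "t \<ge> 0"
  shows "(\<integral>\<^sup>+ y. ennreal (V y) \<partial>P t x) \<le> ennreal (V x + K * t)"
  by (rule order_trans[OF _ lyapunov[OF assms, of x]]) simp

lemma phi_growth:
  assumes "t \<ge> 0"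
  shows "(\<integral>\<^sup>+ y. ennreal (\<phi> (V y)) \<partial>P t x) \<le> ennreal (\<phi> (V x) + c * K * t)"
\<comment> \<open>The tangent of \<phi> is taken at V x + K t, which is certain to be positive only
  for t > 0.\<close>
proof (cases "t = 0")
  case True
  then show ?thesis by (simp add: P_0 nn_integral_return)
next
  case False
  define u where "u = V x + K * t"
  have u: "u > 0" using False assms K_pos V_nonneg[of x] by (simp add: u_def add_nonneg_pos)
  have [measurable_cong]: "sets (P t x) = sets borel" by (rule sets_P[OF assms])
  have "(\<integral>\<^sup>+ y. ennreal (\<phi> (V y)) \<partial>P t x) \<le> ennreal ((\<phi> u - D u * u) + D u * u)"
  proof (rule nn_integral_affine_bound[OF prob_P[OF assms], where v=V])
    show "\<phi> (V z) \<le> (\<phi> u - D u * u) + D u * V z" for z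
      using phi_tangent[OF V_nonneg u, of z] by (simp add: algebra_simps)
  qed (use V_growth[OF assms, of x] u V_nonneg nonneg D_pos[OF u] in \<open>auto simp: u_def\<close>)
  also have "\<dots> \<le> ennreal (\<phi> (V x) + c * K * t)"
  proof (rule ennreal_leI)
    have "\<phi> u \<le> \<phi> (V x) + \<phi> (K * t)"
      unfolding u_def using assms K_pos V_nonneg by (intro phi_subadd) auto
    also have "\<phi> (K * t) \<le> c * (K * t)" using assms K_pos by (intro phi_lin) auto
    finally show "(\<phi> u - D u * u) + D u * u \<le> \<phi> (V x) + c * K * t" by simp
  qed
  finally show ?thesis .
qed

text \<open>To be read as a lower bound: as the mean of \<phi>(V) gains at most c K t, its value at
  the end of an interval bounds all earlier values from below, up to that error.\<close>

lemma phi_quasi_mono: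
  assumes "0 \<le> s" "s \<le> t"
  shows "(\<integral>\<^sup>+ y. ennreal (\<phi> (V y)) \<partial>P t x) \<le> (\<integral>\<^sup>+ y. ennreal (\<phi> (V y)) \<partial>P s x) + ennreal (c * K * t)"
proof -
  interpret prob_space "P s x" by (rule prob_P[OF assms(1)])
  have [measurable_cong]: "sets (P s x) = sets borel" by (rule sets_P[OF assms(1)])
  have "(\<integral>\<^sup>+ y. ennreal (\<phi> (V y)) \<partial>P t x) = (\<integral>\<^sup>+ z. \<integral>\<^sup>+ y. ennreal (\<phi> (V y)) \<partial>P (t - s) z \<partial>P s x)"
    using nn_integral_P_add[of s "t - s" "\<lambda>y. ennreal (\<phi> (V y))" x] assms by simp
  also have "\<dots> \<le> (\<integral>\<^sup>+ z. ennreal (\<phi> (V z)) + ennreal (c * K * t) \<partial>P s x)"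
  proof (rule nn_integral_mono)
    fix z
    have "(\<integral>\<^sup>+ y. ennreal (\<phi> (V y)) \<partial>P (t - s) z) \<le> ennreal (\<phi> (V z) + c * K * (t - s))"
      using assms by (intro phi_growth) auto
    also have "\<dots> \<le> ennreal (\<phi> (V z) + c * K * t)"
      using assms c_pos K_pos by (intro ennreal_leI) auto
    also have "\<dots> = ennreal (\<phi> (V z)) + ennreal (c * K * t)"
      using assms c_pos K_pos nonneg V_nonneg by (intro ennreal_plus) auto
    finally show "(\<integral>\<^sup>+ y. ennreal (\<phi> (V y)) \<partial>P (t - s) z) \<le> ennreal (\<phi> (V z)) + ennreal (c * K * t)" .
  qed
  also have "\<dots> = (\<integral>\<^sup>+ y. ennreal (\<phi> (V y)) \<partial>P s x) + ennreal (c * K * t)"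
    by (subst nn_integral_add) (auto simp: emeasure_space_1)
  finally show ?thesis .
qed

text \<open>The integrand of the Lyapunov inequality need not be measurable in time a priori, but
  its lower integral can be bounded below by the quasi-monotonicity above; this yields a
  drift inequality in discrete time.\<close>

lemma discrete_drift:
  assumes "h > 0"
  shows "(\<integral>\<^sup>+ y. ennreal (V y + h * \<phi> (V y)) \<partial>P h x) \<le> ennreal (V x + K * h + c * K * h\<^sup>2)"
proof -
  have h: "h \<ge> 0" using assms by simp
  have [measurable_cong]: "sets (P h x) = sets borel" by (rule sets_P[OF h])
  have fin: "(\<integral>\<^sup>+ y. ennreal (\<phi> (V y)) \<partial>P h x) < \<infinity>" "(\<integral>\<^sup>+ y. ennreal (V y) \<partial>P h x) < \<infinity>"
    using phi_growth[OF h, of x] V_growth[OF h, of x] by (auto intro: le_less_trans)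
  obtain G where G: "(\<integral>\<^sup>+ y. ennreal (\<phi> (V y)) \<partial>P h x) = ennreal G" "0 \<le> G"
    using fin(1) by (cases "\<integral>\<^sup>+ y. ennreal (\<phi> (V y)) \<partial>P h x") auto
  obtain W where W: "(\<integral>\<^sup>+ y. ennreal (V y) \<partial>P h x) = ennreal W" "0 \<le> W"
    using fin(2) by (cases "\<integral>\<^sup>+ y. ennreal (V y) \<partial>P h x") auto
  \<comment> \<open>By \<open>phi_quasi_mono\<close> the constant G - c K h lies below the integrand
    on all of [0, h]; the maximum with 0 makes it usable among nonnegative extended reals.\<close>
  have "ennreal (max 0 (G - c * K * h) * h) = (\<integral>\<^sup>+ s. ennreal (max 0 (G - c * K * h)) * indicator {0..h} s \<partial>lborel)"
    using h by (simp add: nn_integral_cmult_indicator ennreal_mult)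
  also have "\<dots> \<le> (\<integral>\<^sup>+ s\<in>{0..h}. (\<integral>\<^sup>+ y. ennreal (\<phi> (V y)) \<partial>P s x) \<partial>lborel)"
  proof (rule nn_integral_mono)
    fix s
    show "ennreal (max 0 (G - c * K * h)) * indicator {0..h} s \<le> (\<integral>\<^sup>+ y. ennreal (\<phi> (V y)) \<partial>P s x) * indicator {0..h} s"
    proof (cases "s \<in> {0..h}")
      case True
      have f: "(\<integral>\<^sup>+ y. ennreal (\<phi> (V y)) \<partial>P s x) < \<infinity>"
        using phi_growth[of s x] True by (auto intro: le_less_trans)
      obtain F where F: "(\<integral>\<^sup>+ y. ennreal (\<phi> (V y)) \<partial>P s x) = ennreal F" "0 \<le> F"
        using f by (cases "\<integral>\<^sup>+ y. ennreal (\<phi> (V y)) \<partial>P s x") auto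
      have "ennreal G \<le> ennreal F + ennreal (c * K * h)"
        using phi_quasi_mono[of s h x] True by (simp add: F G)
      then have "G \<le> F + c * K * h"
        using F(2) c_pos K_pos h by (simp add: ennreal_le_iff flip: ennreal_plus)
      then show ?thesis using True F by (simp add: ennreal_leI)
    qed simp
  qed
  finally have "ennreal W + ennreal (max 0 (G - c * K * h) * h) \<le> ennreal (V x + K * h)"
    using lyapunov[OF h, of x] by (auto simp: W intro: order_trans add_left_mono)
  then have "W + max 0 (G - c * K * h) * h \<le> V x + K * h"
    using W(2) h V_nonneg[of x] K_pos by (simp add: ennreal_le_iff flip: ennreal_plus)
  moreover have "(G - c * K * h) * h \<le> max 0 (G - c * K * h) * h"
    using h by (intro mult_right_mono) auto
  ultimately have le: "W + h * G \<le> V x + K * h + c * K * h\<^sup>2" by (simp add: algebra_simps power2_eq_square)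
  have "(\<integral>\<^sup>+ y. ennreal (V y + h * \<phi> (V y)) \<partial>P h x) = (\<integral>\<^sup>+ y. ennreal (V y) + ennreal h * ennreal (\<phi> (V y)) \<partial>P h x)"
    using V_nonneg nonneg h by (intro nn_integral_cong) (simp add: ennreal_mult)
  also have "\<dots> = ennreal W + ennreal h * ennreal G"
    by (subst nn_integral_add) (auto simp: nn_integral_cmult W G)
  also have "\<dots> = ennreal (W + h * G)" using W G h by (simp add: ennreal_mult)
  finally show ?thesis using le by (simp add: ennreal_leI)
qed

text \<open>Absorbing h \<phi>(V) into the Lyapunov function turns \<open>discrete_drift\<close>
  into a decrease by h \<phi>(V), up to a constant. Subadditivity and the linear bound control
  \<phi> of the new function by \<phi>(V), so the drift closes up in terms of that function.\<close>

lemma shifted_drift: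
  assumes h: "h > 0"
  shows "\<exists>A M K1 \<eta>. 1 \<le> A \<and> 0 < M \<and> 0 < K1 \<and> 0 < \<eta> \<and> K1 \<le> \<eta> / 4 * \<phi> A \<and>
    (\<forall>x. (\<integral>\<^sup>+ y. ennreal (A + V y + h * \<phi> (V y)) \<partial>P h x) \<le> ennreal (A + V x + h * \<phi> (V x) + K1)) \<and>
    (\<forall>x. M \<le> A + V x + h * \<phi> (V x) \<longrightarrow>
      \<eta> * \<phi> (A + V x + h * \<phi> (V x)) \<le> A + V x + h * \<phi> (V x) \<and>
      (\<integral>\<^sup>+ y. ennreal (A + V y + h * \<phi> (V y)) \<partial>P h x) \<le> ennreal (A + V x + h * \<phi> (V x) - \<eta> * \<phi> (A + V x + h * \<phi> (V x))))"
proof -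
  define K1 where "K1 = K * h + c * K * h\<^sup>2"
  \<comment> \<open>Half of the decrease h \<phi>(V) pays for \<eta> times \<phi> of the new
    function, except for \<eta> \<phi>(A); the other half covers \<eta> \<phi>(A) + K1 as soon as V
    is at least \<open>z\<close>.\<close>
  define \<eta> where "\<eta> = h / (2 * (1 + h * c))"
  have K1: "K1 > 0" using h K_pos c_pos by (simp add: K1_def add_pos_nonneg)
  have hc: "1 + h * c > 0" using h c_pos by (simp add: add_pos_nonneg)
  have \<eta>: "\<eta> > 0" using h hc by (simp add: \<eta>_def)
  \<comment> \<open>The shift \<open>A\<close> makes the growth \<open>K1\<close> at most a quarter
    of \<eta> \<phi>(v) everywhere, not only above the level \<open>M\<close>.\<close>
  obtain A where A: "A > 1" "\<phi> A > 4 * K1 / \<eta>" using phi_gt by blast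
  obtain z where z: "z > 0" "\<phi> z > 2 * (K1 + \<eta> * \<phi> A) / h" using phi_gt by blast
  define M where "M = A + z + h * \<phi> z"
  have b: "(\<integral>\<^sup>+ y. ennreal (A + V y + h * \<phi> (V y)) \<partial>P h x) \<le> ennreal (A + (V x + K1))" for x
  proof -
    have [measurable_cong]: "sets (P h x) = sets borel" by (rule sets_P) (use h in simp)
    have "(\<integral>\<^sup>+ y. ennreal (A + V y + h * \<phi> (V y)) \<partial>P h x) \<le> ennreal (A + 1 * (V x + K1))"
      by (rule nn_integral_affine_bound[where v="\<lambda>y. V y + h * \<phi> (V y)"])
         (use h A K1 V_nonneg nonneg discrete_drift[OF h, of x] in \<open>auto simp: K1_def add.assoc intro!: prob_P add_nonneg_nonneg\<close>)
    then show ?thesis by simp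
  qed
  have 1: "(\<integral>\<^sup>+ y. ennreal (A + V y + h * \<phi> (V y)) \<partial>P h x) \<le> ennreal (A + V x + h * \<phi> (V x) + K1)" for x
    by (rule order_trans[OF b]) (use h nonneg V_nonneg in \<open>auto intro!: ennreal_leI\<close>)
  have key: "K1 + \<eta> * \<phi> (A + V x + h * \<phi> (V x)) \<le> h * \<phi> (V x)" if "M \<le> A + V x + h * \<phi> (V x)" for x
  proof -
    have "V x \<ge> z"
    proof (rule ccontr)
      assume "\<not> V x \<ge> z"
      then have "V x < z" "h * \<phi> (V x) \<le> h * \<phi> z"
        using V_nonneg[of x] h by (auto intro!: phi_mono)
      with that show False by (simp add: M_def)
    qed
    then have "\<phi> (V x) \<ge> \<phi> z" using z by (intro phi_mono) auto
    then have "2 * (K1 + \<eta> * \<phi> A) / h \<le> \<phi> (V x)" using z by linarith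
    then have 2: "2 * (K1 + \<eta> * \<phi> A) \<le> h * \<phi> (V x)" using h by (simp add: field_simps)
    have "\<phi> (A + V x + h * \<phi> (V x)) \<le> \<phi> (A + V x) + \<phi> (h * \<phi> (V x))"
      using A V_nonneg h nonneg by (intro phi_subadd) auto
    also have "\<dots> \<le> \<phi> A + \<phi> (V x) + c * (h * \<phi> (V x))"
      using A V_nonneg h nonneg by (intro add_mono phi_subadd phi_lin) auto
    also have "\<dots> = \<phi> A + (1 + h * c) * \<phi> (V x)" by (simp add: algebra_simps)
    finally have "\<eta> * \<phi> (A + V x + h * \<phi> (V x)) \<le> \<eta> * (\<phi> A + (1 + h * c) * \<phi> (V x))"
      using \<eta> by (intro mult_left_mono) auto
    also have "\<dots> = \<eta> * \<phi> A + h * \<phi> (V x) / 2"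
      using hc by (simp add: \<eta>_def field_simps)
    finally have 3: "\<eta> * \<phi> (A + V x + h * \<phi> (V x)) \<le> \<eta> * \<phi> A + h * \<phi> (V x) / 2" .
    have "k + e \<le> w" if "e \<le> a + w / 2" "2 * (k + a) \<le> w" for k e a w :: real using that by simp
    from this[OF 3 2] show ?thesis .
  qed
  show ?thesis
  proof (rule exI[of _ A], rule exI[of _ M], rule exI[of _ K1], rule exI[of _ \<eta>], intro conjI allI impI)
    show "1 \<le> A" "0 < K1" "0 < \<eta>" using A K1 \<eta> by auto
    show "0 < M" using A z h nonneg[of z] by (simp add: M_def add_pos_nonneg add_pos_pos)
    show "K1 \<le> \<eta> / 4 * \<phi> A" using A \<eta> by (simp add: field_simps)
    fix x
    show "(\<integral>\<^sup>+ y. ennreal (A + V y + h * \<phi> (V y)) \<partial>P h x) \<le> ennreal (A + V x + h * \<phi> (V x) + K1)" by (rule 1)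
    assume M: "M \<le> A + V x + h * \<phi> (V x)"
    show "\<eta> * \<phi> (A + V x + h * \<phi> (V x)) \<le> A + V x + h * \<phi> (V x)"
      using key[OF M] K1 A V_nonneg[of x] by linarith
    show "(\<integral>\<^sup>+ y. ennreal (A + V y + h * \<phi> (V y)) \<partial>P h x) \<le> ennreal (A + V x + h * \<phi> (V x) - \<eta> * \<phi> (A + V x + h * \<phi> (V x)))"
      by (rule order_trans[OF b]) (use key[OF M] in \<open>auto intro!: ennreal_leI\<close>)
  qed
qed

end

section \<open>Contraction of the skeleton chain\<close>

context markov_semigroup
begin

text \<open>What \<open>two_step\<close> asks of a weight at the intermediate time: a finite
  integral over the last leg \<open>T\<close>, and a positive lower bound that keeps the right-hand
  sides positive.\<close>

definition weight :: "real \<Rightarrow> ('a \<Rightarrow> real) \<Rightarrow> bool" where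
  "weight T J \<longleftrightarrow> J \<in> borel_measurable borel \<and> (\<exists>j>0. \<forall>x. j \<le> J x) \<and> (\<forall>u. (\<integral>\<^sup>+z. ennreal (J z) \<partial>P T u) < \<infinity>)"

definition osc_bound :: "('a \<Rightarrow> 'a \<Rightarrow> real) \<Rightarrow> real \<Rightarrow> ('a \<Rightarrow> real) \<Rightarrow> ('a \<Rightarrow> real) \<Rightarrow> bool" where
  "osc_bound d q J g \<longleftrightarrow> g \<in> borel_measurable borel \<and> bounded (range g) \<and>
     (\<forall>u v. \<bar>g u - g v\<bar> \<le> d u v powr (1 - q) * (J u + J v) powr q)"

text \<open>Both contractions hold over the same time and for the same \<open>N\<close>. In the
  second, \<kappa> depends on the level \<open>M\<close> but precedes q, J and g in the quantifiers,
  because the weights are tuned to \<kappa> afterwards.\<close>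

lemma harris_step:
  fixes V :: "'a \<Rightarrow> real"
  assumes A: "assumption_A TYPE('w) P \<theta> r L" and \<theta>: "premetric \<theta>" and t0: "t0 > 0"
    and B1: "\<And>M. M > 0 \<Longrightarrow> assumption_B1 P \<theta> {x. V x \<le> M} t0"
  obtains N T where "N \<ge> 1" "T \<ge> 0"
    "\<And>q J g x y B. 0 < q \<Longrightarrow> q < 1 \<Longrightarrow> weight T J \<Longrightarrow> osc_bound (\<lambda>u v. min 1 (N * \<theta> u v)) q J g \<Longrightarrow> x \<noteq> y \<Longrightarrow> 0 < B \<Longrightarrow>
       (\<integral>\<^sup>+u. ennreal (J u) \<partial>P (t0 + T) x) + (\<integral>\<^sup>+u. ennreal (J u) \<partial>P (t0 + T) y) \<le> ennreal B \<Longrightarrow>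
       \<bar>(\<integral>u. g u \<partial>P (t0 + T) x) - (\<integral>u. g u \<partial>P (t0 + T) y)\<bar> \<le> (min 1 (N * \<theta> x y / 2)) powr (1 - q) * B powr q"
    "\<And>M. M > 0 \<Longrightarrow> \<exists>\<kappa>. 0 < \<kappa> \<and> \<kappa> < 1 \<and> (\<forall>q J g x y B. 0 < q \<longrightarrow> q < 1 \<longrightarrow> weight T J \<longrightarrow>
       osc_bound (\<lambda>u v. min 1 (N * \<theta> u v)) q J g \<longrightarrow> V x \<le> M \<longrightarrow> V y \<le> M \<longrightarrow> 0 < B \<longrightarrow>
       (\<integral>\<^sup>+u. ennreal (J u) \<partial>P (t0 + T) x) + (\<integral>\<^sup>+u. ennreal (J u) \<partial>P (t0 + T) y) \<le> ennreal B \<longrightarrow>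
       \<bar>(\<integral>u. g u \<partial>P (t0 + T) x) - (\<integral>u. g u \<partial>P (t0 + T) y)\<bar> \<le> (1 - \<kappa>) powr (1 - q) * B powr q)"
proof -
  have r: "\<And>s. s \<ge> 0 \<Longrightarrow> r s \<ge> 0" "(r \<longlongrightarrow> 0) at_top" and L: "\<And>s. s \<ge> 0 \<Longrightarrow> L s \<ge> 0"
    using A by (auto simp: assumption_A_def)
  have \<theta>0: "0 \<le> \<theta> x y" "x \<noteq> y \<Longrightarrow> 0 < \<theta> x y" for x y using \<theta> by (auto simp: premetric_def less_le)
  have t: "0 \<le> t0" using t0 by simp
  have rt: "0 \<le> r t0" using r(1) t0 by simp
  \<comment> \<open>\<open>T\<close> is chosen so that r(T) r(t0) is at most 1/4, the coefficient
    with which \<open>N\<close> returns after both legs.\<close>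
  have "eventually (\<lambda>T. r T < 1 / (4 * (r t0 + 1)) \<and> T \<ge> 0) at_top"
    using order_tendstoD(2)[OF r(2), of "1 / (4 * (r t0 + 1))"] rt
    by (intro eventually_conj eventually_ge_at_top) auto
  then obtain T where T: "r T < 1 / (4 * (r t0 + 1))" "T \<ge> 0"
    by (auto dest: eventually_happens)
  have rT: "r T * r t0 \<le> 1 / 4"
  proof -
    have "r T * r t0 \<le> 1 / (4 * (r t0 + 1)) * (r t0 + 1)"
      using T r(1)[OF T(2)] rt by (intro mult_mono) auto
    also have "\<dots> = 1 / 4" using rt by simp
    finally show ?thesis .
  qed
  \<comment> \<open>After both legs the factor is N r(T) r(t0) + (L(T) + 1) r(t0) + L(t0). The first
    term is at most N/4, and this \<open>N\<close> makes the others at most N/4 as well.\<close>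
  define N where "N = 1 + 4 * ((L T + 1) * r t0 + L t0)"
  have N: "N \<ge> 1" using L[OF T(2)] L[OF t] rt by (simp add: N_def)
  define N2 where "N2 = N * r T + L T + 1"
  have N2: "N2 > 0" using N r(1)[OF T(2)] L[OF T(2)] by (simp add: N2_def add_nonneg_pos)
  have N2N: "N2 * r t0 + L t0 \<le> N / 2"
  proof -
    have "N * (r T * r t0) \<le> N * (1 / 4)" using rT N by (intro mult_left_mono) auto
    then show ?thesis by (simp add: N2_def algebra_simps) (simp add: N_def algebra_simps)
  qed
  have coup: "\<exists>c\<in>couplings (P T u) (P T v). (\<integral>\<^sup>+z. ennreal (min 1 (N * \<theta> (fst z) (snd z))) \<partial>c) \<le> ennreal (N2 * \<theta> u v)" for u v
  proof -
    have "ennreal ((N * r T + L T) * \<theta> u v) \<le> ennreal (N2 * \<theta> u v)"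
      using \<theta>0(1)[of u v] by (intro ennreal_leI mult_right_mono) (auto simp: N2_def)
    then show ?thesis
      using assumption_A_coupling[OF A \<theta> T(2), of N u v] N by (auto intro: order_trans)
  qed
  have main: "\<bar>(\<integral>u. g u \<partial>P (t0 + T) x) - (\<integral>u. g u \<partial>P (t0 + T) y)\<bar> \<le> A powr (1 - q) * B powr q"
    if q: "0 < q" "q < 1" and J: "weight T J" and g: "osc_bound (\<lambda>u v. min 1 (N * \<theta> u v)) q J g" and B: "0 < B"
       "(\<integral>\<^sup>+u. ennreal (J u) \<partial>P (t0 + T) x) + (\<integral>\<^sup>+u. ennreal (J u) \<partial>P (t0 + T) y) \<le> ennreal B"
      and c: "c \<in> couplings (P t0 x) (P t0 y)" "(\<integral>\<^sup>+z. ennreal (min 1 (N2 * \<theta> (fst z) (snd z))) \<partial>c) \<le> ennreal A" "0 < A"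
    for q J g x y A B c
  proof -
    obtain j where j: "j > 0" "\<And>x. j \<le> J x" and Jm: "J \<in> borel_measurable borel" "\<And>u. (\<integral>\<^sup>+z. ennreal (J z) \<partial>P T u) < \<infinity>"
      using J by (auto simp: weight_def)
    obtain G where G: "\<And>x. \<bar>g x\<bar> \<le> G" and gm: "g \<in> borel_measurable borel"
      and osc: "\<And>u v. \<bar>g u - g v\<bar> \<le> min 1 (N * \<theta> u v) powr (1 - q) * (J u + J v) powr q"
      using g by (auto simp: osc_bound_def bounded_iff)
    show ?thesis
      using two_step[OF \<theta> T(2) t _ N2 coup c Jm(1) j(2,1) Jm(2) B(2,1) gm G osc q] N by simp
  qed
  show ?thesis
  proof (rule that[OF N T(2)])
    fix q J g x y B
    assume q: "0 < q" "q < 1" and J: "weight T J" and g: "osc_bound (\<lambda>u v. min 1 (N * \<theta> u v)) q J g" and xy: "x \<noteq> y"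
      and B: "0 < B" "(\<integral>\<^sup>+u. ennreal (J u) \<partial>P (t0 + T) x) + (\<integral>\<^sup>+u. ennreal (J u) \<partial>P (t0 + T) y) \<le> ennreal B"
    obtain c where c: "c \<in> couplings (P t0 x) (P t0 y)"
      "(\<integral>\<^sup>+z. ennreal (min 1 (N2 * \<theta> (fst z) (snd z))) \<partial>c) \<le> ennreal ((N2 * r t0 + L t0) * \<theta> x y)"
      using assumption_A_coupling[OF A \<theta> t, of N2 x y] N2 by auto
    interpret c: prob_space c using c by (auto simp: couplings_def)
    have "(\<integral>\<^sup>+z. ennreal (min 1 (N2 * \<theta> (fst z) (snd z))) \<partial>c) \<le> (\<integral>\<^sup>+z. 1 \<partial>c)"
      by (intro nn_integral_mono) (auto simp flip: ennreal_1 intro!: ennreal_leI)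
    moreover have "ennreal ((N2 * r t0 + L t0) * \<theta> x y) \<le> ennreal (N * \<theta> x y / 2)"
      using mult_right_mono[OF N2N \<theta>0(1)[of x y]] by (intro ennreal_leI) simp
    ultimately have "(\<integral>\<^sup>+z. ennreal (min 1 (N2 * \<theta> (fst z) (snd z))) \<partial>c) \<le> ennreal (min 1 (N * \<theta> x y / 2))"
      using c(2) by (auto simp: min_def c.emeasure_space_1 intro: order_trans)
    then show "\<bar>(\<integral>u. g u \<partial>P (t0 + T) x) - (\<integral>u. g u \<partial>P (t0 + T) y)\<bar> \<le> (min 1 (N * \<theta> x y / 2)) powr (1 - q) * B powr q"
      using \<theta>0(2)[OF xy] N by (intro main[OF q J g B c(1)]) auto
  next
    fix M :: real assume "M > 0"
    from small_set_coupling[OF \<theta> t N2 B1[OF this]]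
    obtain \<kappa> where \<kappa>: "0 < \<kappa>" "\<kappa> < 1" and small: "\<And>x y. V x \<le> M \<Longrightarrow> V y \<le> M \<Longrightarrow>
        (\<integral>\<^sup>+z. ennreal (min 1 (N2 * \<theta> (fst z) (snd z))) \<partial>(P t0 x \<Otimes>\<^sub>M P t0 y)) \<le> ennreal (1 - \<kappa>)"
      by auto
    show "\<exists>\<kappa>. 0 < \<kappa> \<and> \<kappa> < 1 \<and> (\<forall>q J g x y B. 0 < q \<longrightarrow> q < 1 \<longrightarrow> weight T J \<longrightarrow>
       osc_bound (\<lambda>u v. min 1 (N * \<theta> u v)) q J g \<longrightarrow> V x \<le> M \<longrightarrow> V y \<le> M \<longrightarrow> 0 < B \<longrightarrow>
       (\<integral>\<^sup>+u. ennreal (J u) \<partial>P (t0 + T) x) + (\<integral>\<^sup>+u. ennreal (J u) \<partial>P (t0 + T) y) \<le> ennreal B \<longrightarrow>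
       \<bar>(\<integral>u. g u \<partial>P (t0 + T) x) - (\<integral>u. g u \<partial>P (t0 + T) y)\<bar> \<le> (1 - \<kappa>) powr (1 - q) * B powr q)"
    proof (intro exI[of _ \<kappa>] conjI \<kappa> allI impI)
      fix q J g x y B
      assume "0 < q" "q < 1" "weight T J" "osc_bound (\<lambda>u v. min 1 (N * \<theta> u v)) q J g" "V x \<le> M" "V y \<le> M" "0 < B"
       "(\<integral>\<^sup>+u. ennreal (J u) \<partial>P (t0 + T) x) + (\<integral>\<^sup>+u. ennreal (J u) \<partial>P (t0 + T) y) \<le> ennreal B"
      then show "\<bar>(\<integral>u. g u \<partial>P (t0 + T) x) - (\<integral>u. g u \<partial>P (t0 + T) y)\<bar> \<le> (1 - \<kappa>) powr (1 - q) * B powr q"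
        using \<kappa> by (intro main[OF _ _ _ _ _ _ product_coupling[OF prob_P sets_P prob_P sets_P] small] t) auto
    qed
  qed
qed

lemma bLip_osc_le_1:
  assumes "bLip f" "0 \<le> t"
  shows "\<bar>(\<integral>u. f u \<partial>P t x) - (\<integral>u. f u \<partial>P t y)\<bar> \<le> 1"
proof (rule coupling_osc[OF product_coupling[OF prob_P sets_P prob_P sets_P], where \<Psi>="\<lambda>_. 1" and K="\<bar>f undefined\<bar> + 1"])
  interpret x: prob_space "P t x" by (rule prob_P[OF assms(2)])
  interpret y: prob_space "P t y" by (rule prob_P[OF assms(2)])
  interpret xy: pair_prob_space "P t x" "P t y" ..
  show "(\<integral>\<^sup>+z. ennreal 1 \<partial>(P t x \<Otimes>\<^sub>M P t y)) \<le> ennreal 1" by (simp add: xy.emeasure_space_1)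
  show "\<bar>f u - f v\<bar> \<le> 1" for u v using bLip_abs[OF assms(1), of u v] bdist_le_1[of u v] by linarith
qed (use assms bLip_bounded in \<open>auto intro: bLip_measurable\<close>)

end

text \<open>The setting of a single step of length \<open>h\<close>. With A \<le> v, the condition
  on \<open>K1\<close> says that v can grow in mean by at most a quarter of \<eta> \<phi>(v); above
  \<open>M\<close> it decreases by the full amount.\<close>

locale harris_chain = lyapunov_semigroup P \<phi> V K c
  for P :: "real \<Rightarrow> 'a::polish_space \<Rightarrow> 'a measure" and \<phi> V K c +
  fixes \<theta> :: "'a \<Rightarrow> 'a \<Rightarrow> real" and N T h A M K1 \<eta> \<kappa> :: real and v :: "'a \<Rightarrow> real"
  assumes h_pos: "0 < h" and N_ge: "1 \<le> N" and T_nonneg: "0 \<le> T"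
    and \<theta>_premetric: "premetric \<theta>" and \<theta>_ge: "\<And>x y. bdist x y \<le> \<theta> x y"
    and local_contraction: "\<And>q J g x y B. 0 < q \<Longrightarrow> q < 1 \<Longrightarrow> weight T J \<Longrightarrow> osc_bound (\<lambda>u v. min 1 (N * \<theta> u v)) q J g \<Longrightarrow> x \<noteq> y \<Longrightarrow> 0 < B \<Longrightarrow>
       (\<integral>\<^sup>+u. ennreal (J u) \<partial>P h x) + (\<integral>\<^sup>+u. ennreal (J u) \<partial>P h y) \<le> ennreal B \<Longrightarrow>
       \<bar>(\<integral>u. g u \<partial>P h x) - (\<integral>u. g u \<partial>P h y)\<bar> \<le> (min 1 (N * \<theta> x y / 2)) powr (1 - q) * B powr q"
    and \<kappa>: "0 < \<kappa>" "\<kappa> < 1"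
    and small_set: "\<And>q J g x y B. 0 < q \<Longrightarrow> q < 1 \<Longrightarrow> weight T J \<Longrightarrow> osc_bound (\<lambda>u v. min 1 (N * \<theta> u v)) q J g \<Longrightarrow>
       v x \<le> M \<Longrightarrow> v y \<le> M \<Longrightarrow> 0 < B \<Longrightarrow>
       (\<integral>\<^sup>+u. ennreal (J u) \<partial>P h x) + (\<integral>\<^sup>+u. ennreal (J u) \<partial>P h y) \<le> ennreal B \<Longrightarrow>
       \<bar>(\<integral>u. g u \<partial>P h x) - (\<integral>u. g u \<partial>P h y)\<bar> \<le> (1 - \<kappa>) powr (1 - q) * B powr q"
    and v_meas [measurable]: "v \<in> borel_measurable borel" and v_ge: "\<And>x. A \<le> v x"
    and const_bounds: "1 \<le> A" "0 < K1" "0 < \<eta>" "K1 \<le> \<eta> / 4 * \<phi> A"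
    and drift1: "\<And>x. (\<integral>\<^sup>+ y. ennreal (v y) \<partial>P h x) \<le> ennreal (v x + K1)"
    and drift2: "\<And>x. M \<le> v x \<Longrightarrow> \<eta> * \<phi> (v x) \<le> v x \<and> (\<integral>\<^sup>+ y. ennreal (v y) \<partial>P h x) \<le> ennreal (v x - \<eta> * \<phi> (v x))"
    and v_fin: "\<And>u. (\<integral>\<^sup>+ y. ennreal (v y) \<partial>P T u) < \<infinity>"
begin

section \<open>One-step behaviour of the Lyapunov weights\<close>

lemma v_ge_1: "1 \<le> v x"
  using v_ge[of x] const_bounds by simp

lemma v_nonneg: "0 \<le> v x"
  using v_ge_1[of x] by simp

lemma \<theta>_nonneg: "0 \<le> \<theta> x y"
  using \<theta>_premetric by (auto simp: premetric_def)

lemma wt_measurable: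
  assumes "0 \<le> l" "1 \<le> s"
  shows "(\<lambda>x. wt l s (v x)) \<in> borel_measurable borel"
proof -
  define g where "g u = wt l s (max 1 u)" for u
  have "mono g" unfolding g_def using assms by (intro monoI wt_mono) auto
  then have "g \<in> borel_measurable borel" by (rule borel_measurable_mono)
  then have "(\<lambda>x. g (v x)) \<in> borel_measurable borel" by measurable
  then show ?thesis using v_ge_1 by (simp add: g_def max_def)
qed

text \<open>The summand 1/2 keeps the affine part away from 0 and turns its additive growth \<beta>
  K1 into a relative factor of at most 1 + 2 \<beta> K1. The index \<open>n\<close> counts the steps
  already made, so the bound for the iterate of order \<open>n\<close> carries its own
  decay.\<close>

definition lyap_weight :: "real \<Rightarrow> real \<Rightarrow> real \<Rightarrow> nat \<Rightarrow> 'a \<Rightarrow> real" where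
  "lyap_weight l s \<beta> n x = (1 - \<eta> / 4 * l) ^ n * wt l s (v x) + (1 / 2 + \<beta> * v x) / (\<beta> * s)"

context
  fixes l s \<beta> :: real
  assumes l: "0 < l" "l \<le> D s" "\<eta> / 4 * l < 1" and s: "1 \<le> s" and \<beta>: "0 < \<beta>"
begin

lemma decay_factor_bounds: "0 < 1 - \<eta> / 4 * l" "1 - \<eta> / 4 * l \<le> 1"
  using l const_bounds by auto

lemma wt_v_ge_1: "1 \<le> wt l s (v x)"
  using l s v_ge_1 by (intro wt_ge_1) auto

lemma lyap_weight_pos: "1 / (2 * \<beta> * s) \<le> lyap_weight l s \<beta> n x"
proof -
  have "1 / (2 * \<beta> * s) = (1 / 2) / (\<beta> * s)" by simp
  also have "\<dots> \<le> (1 / 2 + \<beta> * v x) / (\<beta> * s)"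
    using \<beta> s v_ge_1[of x] by (intro divide_right_mono) auto
  also have "\<dots> \<le> lyap_weight l s \<beta> n x"
    unfolding lyap_weight_def using decay_factor_bounds wt_v_ge_1[of x] by simp
  finally show ?thesis .
qed

lemma lyap_weight_measurable [measurable]: "lyap_weight l s \<beta> n \<in> borel_measurable borel"
proof -
  have [measurable]: "(\<lambda>x. wt l s (v x)) \<in> borel_measurable borel" using l s by (intro wt_measurable) auto
  show ?thesis unfolding lyap_weight_def by measurable
qed

text \<open>Jensen's inequality through the tangent at a free point \<open>u\<close>. Taking
  \<open>u = v x\<close> turns mean growth or mean decrease of v into a factor on the exponential
  weight.\<close>

lemma lyap_weight_nn_integral:
  assumes m: "(\<integral>\<^sup>+ y. ennreal (v y) \<partial>P t x) \<le> ennreal m" "0 \<le> m" and t: "0 \<le> t" and u: "1 \<le> u" "u \<le> s"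
  shows "(\<integral>\<^sup>+ y. ennreal (lyap_weight l s \<beta> n y) \<partial>P t x)
    \<le> ennreal ((1 - \<eta> / 4 * l) ^ n * (wt l s u + l * wt l s u / \<phi> u * (m - u)) + (1 / 2 + \<beta> * m) / (\<beta> * s))"
proof -
  have [measurable_cong]: "sets (P t x) = sets borel" by (rule sets_P[OF t])
  define b where "b = (1 - \<eta> / 4 * l) ^ n"
  have b: "0 \<le> b" using decay_factor_bounds by (simp add: b_def)
  define w where "w = l * wt l s u / \<phi> u"
  have w: "0 \<le> w" using l phi_pos[of u] u by (simp add: w_def wt_def)
  have "(\<integral>\<^sup>+ y. ennreal (lyap_weight l s \<beta> n y) \<partial>P t x)
     \<le> ennreal ((b * (wt l s u - w * u) + (1 / 2) / (\<beta> * s)) + (b * w + 1 / s) * m)"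
  proof (rule nn_integral_affine_bound[where v=v])
    fix z
    show "0 \<le> lyap_weight l s \<beta> n z" using lyap_weight_pos[of n z] \<beta> s by (meson divide_nonneg_nonneg mult_nonneg_nonneg order_trans less_imp_le zero_le_numeral zero_le_one)
    have "b * wt l s (v z) \<le> b * (wt l s u + w * (v z - u))"
      unfolding w_def using l u v_ge_1 b by (intro mult_left_mono wt_tangent) auto
    moreover have "lyap_weight l s \<beta> n z = b * wt l s (v z) + (1 / 2 + \<beta> * v z) / (\<beta> * s)" by (simp only: lyap_weight_def b_def)
    ultimately show "lyap_weight l s \<beta> n z \<le> (b * (wt l s u - w * u) + (1 / 2) / (\<beta> * s)) + (b * w + 1 / s) * v z"
      using \<beta> by (simp add: algebra_simps add_divide_distrib)
  qed (use m t v_ge_1 b w s in \<open>auto intro!: prob_P intro: order_trans[of 0 1]\<close>)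
  also have "(b * (wt l s u - w * u) + (1 / 2) / (\<beta> * s)) + (b * w + 1 / s) * m
     = b * (wt l s u + w * (m - u)) + (1 / 2 + \<beta> * m) / (\<beta> * s)"
    using \<beta> by (simp add: algebra_simps add_divide_distrib)
  finally show ?thesis by (simp add: b_def w_def)
qed

lemma lyap_weight_weight: "weight T (lyap_weight l s \<beta> n)"
  unfolding weight_def
proof (intro conjI lyap_weight_measurable exI[of _ "1 / (2 * \<beta> * s)"] allI lyap_weight_pos)
  show "0 < 1 / (2 * \<beta> * s)" using \<beta> s by simp
  fix u
  obtain m where m: "(\<integral>\<^sup>+ y. ennreal (v y) \<partial>P T u) = ennreal m" "0 \<le> m"
    using v_fin[of u] by (cases "\<integral>\<^sup>+ y. ennreal (v y) \<partial>P T u") auto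
  show "(\<integral>\<^sup>+z. ennreal (lyap_weight l s \<beta> n z) \<partial>P T u) < \<infinity>"
    by (rule le_less_trans[OF lyap_weight_nn_integral[OF _ m(2) T_nonneg order_refl s]]) (use m in auto)
qed

lemma lyap_weight_growth:
  "(\<integral>\<^sup>+ y. ennreal (lyap_weight l s \<beta> n y) \<partial>P h x)
    \<le> ennreal ((1 - \<eta> / 4 * l) ^ n * ((1 + \<eta> / 4 * l) * wt l s (v x)) + (1 / 2 + \<beta> * (v x + K1)) / (\<beta> * s))"
proof (cases "v x \<le> s")
  case True
  have "(\<integral>\<^sup>+ y. ennreal (lyap_weight l s \<beta> n y) \<partial>P h x)
      \<le> ennreal ((1 - \<eta> / 4 * l) ^ n * (wt l s (v x) + l * wt l s (v x) / \<phi> (v x) * (v x + K1 - v x)) + (1 / 2 + \<beta> * (v x + K1)) / (\<beta> * s))"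
    using v_ge_1[of x] const_bounds h_pos True by (intro lyap_weight_nn_integral drift1) auto
  also have "\<dots> \<le> ennreal ((1 - \<eta> / 4 * l) ^ n * ((1 + \<eta> / 4 * l) * wt l s (v x)) + (1 / 2 + \<beta> * (v x + K1)) / (\<beta> * s))"
  proof (intro ennreal_leI add_right_mono mult_left_mono)
    have "\<phi> A \<le> \<phi> (v x)" using const_bounds v_ge by (intro phi_mono) auto
    then have "\<eta> / 4 * \<phi> A \<le> \<eta> / 4 * \<phi> (v x)" using const_bounds by (intro mult_left_mono) auto
    then have "K1 \<le> \<eta> / 4 * \<phi> (v x)" using const_bounds by linarith
    then have "K1 / \<phi> (v x) \<le> \<eta> / 4"
      using phi_pos[of "v x"] v_ge_1[of x] by (subst pos_divide_le_eq) auto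
    then have "(l * wt l s (v x)) * (K1 / \<phi> (v x)) \<le> (l * wt l s (v x)) * (\<eta> / 4)"
      using l wt_v_ge_1[of x] by (intro mult_left_mono) auto
    then show "wt l s (v x) + l * wt l s (v x) / \<phi> (v x) * (v x + K1 - v x) \<le> (1 + \<eta> / 4 * l) * wt l s (v x)"
      by (simp add: algebra_simps)
  qed (use decay_factor_bounds in auto)
  finally show ?thesis .
next
  case False
  have [measurable_cong]: "sets (P h x) = sets borel" by (rule sets_P) (use h_pos in simp)
  have b0: "0 \<le> (1 - \<eta> / 4 * l) ^ n" using decay_factor_bounds by simp
  have "(\<integral>\<^sup>+ y. ennreal (lyap_weight l s \<beta> n y) \<partial>P h x)
     \<le> ennreal (((1 - \<eta> / 4 * l) ^ n * wt l s (v x) + (1 / 2) / (\<beta> * s)) + (1 / s) * (v x + K1))"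
  proof (rule nn_integral_affine_bound[where v=v])
    fix z
    show "0 \<le> lyap_weight l s \<beta> n z" using lyap_weight_pos[of n z] \<beta> s by (meson divide_nonneg_nonneg mult_nonneg_nonneg order_trans less_imp_le zero_le_numeral zero_le_one)
    have "wt l s (v z) \<le> wt l s (v x)"
      using False l s v_ge_1 unfolding wt_def by (auto intro!: mult_left_mono H_mono)
    then show "lyap_weight l s \<beta> n z \<le> ((1 - \<eta> / 4 * l) ^ n * wt l s (v x) + (1 / 2) / (\<beta> * s)) + (1 / s) * v z"
      using \<beta> b0 by (simp add: lyap_weight_def add_divide_distrib mult_left_mono)
  qed (use drift1 h_pos v_nonneg const_bounds s in \<open>auto intro!: prob_P add_nonneg_nonneg\<close>)
  also have "\<dots> \<le> ennreal ((1 - \<eta> / 4 * l) ^ n * ((1 + \<eta> / 4 * l) * wt l s (v x)) + (1 / 2 + \<beta> * (v x + K1)) / (\<beta> * s))"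
  proof (rule ennreal_leI)
    have "wt l s (v x) \<le> (1 + \<eta> / 4 * l) * wt l s (v x)"
      using l const_bounds wt_v_ge_1[of x] by simp
    then have "(1 - \<eta> / 4 * l) ^ n * wt l s (v x) \<le> (1 - \<eta> / 4 * l) ^ n * ((1 + \<eta> / 4 * l) * wt l s (v x))"
      using b0 by (rule mult_left_mono)
    moreover have "(1 / 2) / (\<beta> * s) + (1 / s) * (v x + K1) = (1 / 2 + \<beta> * (v x + K1)) / (\<beta> * s)"
      using \<beta> by (simp add: add_divide_distrib)
    ultimately show "((1 - \<eta> / 4 * l) ^ n * wt l s (v x) + (1 / 2) / (\<beta> * s)) + (1 / s) * (v x + K1)
       \<le> (1 - \<eta> / 4 * l) ^ n * ((1 + \<eta> / 4 * l) * wt l s (v x)) + (1 / 2 + \<beta> * (v x + K1)) / (\<beta> * s)" by linarith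
  qed
  finally show ?thesis .
qed

lemma lyap_weight_decay:
  assumes "M \<le> v x" "v x \<le> s"
  shows "(\<integral>\<^sup>+ y. ennreal (lyap_weight l s \<beta> n y) \<partial>P h x)
    \<le> ennreal ((1 - \<eta> / 4 * l) ^ n * ((1 - \<eta> * l) * wt l s (v x)) + (1 / 2 + \<beta> * (v x - \<eta> * \<phi> (v x))) / (\<beta> * s))"
proof -
  have "(\<integral>\<^sup>+ y. ennreal (lyap_weight l s \<beta> n y) \<partial>P h x)
      \<le> ennreal ((1 - \<eta> / 4 * l) ^ n * (wt l s (v x) + l * wt l s (v x) / \<phi> (v x) * (v x - \<eta> * \<phi> (v x) - v x)) + (1 / 2 + \<beta> * (v x - \<eta> * \<phi> (v x))) / (\<beta> * s))"
    using v_ge_1[of x] h_pos assms drift2[OF assms(1)] by (intro lyap_weight_nn_integral) auto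
  also have "wt l s (v x) + l * wt l s (v x) / \<phi> (v x) * (v x - \<eta> * \<phi> (v x) - v x) = (1 - \<eta> * l) * wt l s (v x)"
    using phi_pos[of "v x"] v_ge_1[of x] by (simp add: field_simps)
  finally show ?thesis .
qed

text \<open>The right side carries the index \<open>Suc n\<close>, that is, one more decay factor;
  \<Lambda> must make up for it, whence the form of the second condition.\<close>

lemma lyap_weight_growth_factor:
  assumes \<Lambda>: "1 + 2 * \<beta> * K1 \<le> \<Lambda>" "1 + \<eta> / 4 * l \<le> \<Lambda> * (1 - \<eta> / 4 * l)"
  shows "(\<integral>\<^sup>+ y. ennreal (lyap_weight l s \<beta> n y) \<partial>P h x) \<le> ennreal (\<Lambda> * lyap_weight l s \<beta> (Suc n) x)"
proof (rule order_trans[OF lyap_weight_growth ennreal_leI])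
  have b0: "0 \<le> (1 - \<eta> / 4 * l) ^ n" using decay_factor_bounds by simp
  have "(1 + \<eta> / 4 * l) * wt l s (v x) \<le> \<Lambda> * (1 - \<eta> / 4 * l) * wt l s (v x)"
    using \<Lambda>(2) wt_v_ge_1[of x] by (intro mult_right_mono) auto
  then have 1: "(1 - \<eta> / 4 * l) ^ n * ((1 + \<eta> / 4 * l) * wt l s (v x)) \<le> (1 - \<eta> / 4 * l) ^ n * (\<Lambda> * (1 - \<eta> / 4 * l) * wt l s (v x))"
    using b0 by (rule mult_left_mono)
  have "(1 + 2 * \<beta> * K1) * (1 / 2 + \<beta> * v x) \<le> \<Lambda> * (1 / 2 + \<beta> * v x)"
    using \<Lambda>(1) \<beta> v_ge_1[of x] by (intro mult_right_mono) auto
  moreover have "0 \<le> 2 * \<beta> * K1 * (\<beta> * v x)" using \<beta> const_bounds v_ge_1[of x] by simp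
  ultimately have "1 / 2 + \<beta> * (v x + K1) \<le> \<Lambda> * (1 / 2 + \<beta> * v x)"
    by (simp add: algebra_simps)
  then have "(1 / 2 + \<beta> * (v x + K1)) / (\<beta> * s) \<le> \<Lambda> * (1 / 2 + \<beta> * v x) / (\<beta> * s)"
    using \<beta> s by (intro divide_right_mono) auto
  with 1 show "(1 - \<eta> / 4 * l) ^ n * ((1 + \<eta> / 4 * l) * wt l s (v x)) + (1 / 2 + \<beta> * (v x + K1)) / (\<beta> * s) \<le> \<Lambda> * lyap_weight l s \<beta> (Suc n) x"
    by (simp add: lyap_weight_def distrib_left mult_ac)
qed

text \<open>Only the point with the larger v has a drift, by the factor 1 - \<eta> l, while the
  other may grow by 1 + \<eta> l / 4. As its weight is the smaller one, the sum still decays by 1 -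
  \<eta> l / 4, which is why the rate in \<open>lyap_weight\<close> is a quarter of \<eta>
  l.\<close>

lemma lyap_weight_pair_decay:
  assumes "M \<le> v x" "v x \<le> s" "v y \<le> v x"
  shows "(\<integral>\<^sup>+ u. ennreal (lyap_weight l s \<beta> n u) \<partial>P h x) + (\<integral>\<^sup>+ u. ennreal (lyap_weight l s \<beta> n u) \<partial>P h y)
    \<le> ennreal (lyap_weight l s \<beta> (Suc n) x + lyap_weight l s \<beta> (Suc n) y)"
proof -
  define b where "b = (1 - \<eta> / 4 * l) ^ n"
  have b: "0 \<le> b" using decay_factor_bounds by (simp add: b_def)
  define p where "p = b * ((1 - \<eta> * l) * wt l s (v x)) + (1 / 2 + \<beta> * (v x - \<eta> * \<phi> (v x))) / (\<beta> * s)"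
  define r where "r = b * ((1 + \<eta> / 4 * l) * wt l s (v y)) + (1 / 2 + \<beta> * (v y + K1)) / (\<beta> * s)"
  have "0 \<le> r" using b \<beta> s v_ge_1[of y] const_bounds l wt_v_ge_1[of y] unfolding r_def
    by (intro add_nonneg_nonneg mult_nonneg_nonneg divide_nonneg_nonneg) auto
  have le: "p + r \<le> lyap_weight l s \<beta> (Suc n) x + lyap_weight l s \<beta> (Suc n) y"
  proof -
    have w: "wt l s (v y) \<le> wt l s (v x)" using assms l s v_ge_1 by (intro wt_mono) auto
    have "\<eta> * l * wt l s (v y) \<le> \<eta> * l * wt l s (v x)"
      using w l const_bounds by (intro mult_left_mono) auto
    moreover have "0 \<le> \<eta> * l * wt l s (v x)" using l const_bounds wt_v_ge_1[of x] by simp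
    ultimately have "(1 - \<eta> * l) * wt l s (v x) + (1 + \<eta> / 4 * l) * wt l s (v y)
       \<le> (1 - \<eta> / 4 * l) * (wt l s (v x) + wt l s (v y))"
      by (simp add: algebra_simps)
    then have 1: "b * ((1 - \<eta> * l) * wt l s (v x) + (1 + \<eta> / 4 * l) * wt l s (v y))
       \<le> b * ((1 - \<eta> / 4 * l) * (wt l s (v x) + wt l s (v y)))"
      using b by (rule mult_left_mono)
    have "\<phi> A \<le> \<phi> (v x)" using const_bounds v_ge by (intro phi_mono) auto
    then have "\<eta> / 4 * \<phi> A \<le> \<eta> / 4 * \<phi> (v x)" using const_bounds by (intro mult_left_mono) auto
    moreover have "0 \<le> \<eta> * \<phi> (v x)" using const_bounds phi_pos[of "v x"] v_ge_1[of x] by simp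
    ultimately have "K1 \<le> \<eta> * \<phi> (v x)" using const_bounds by linarith
    then have "\<beta> * K1 \<le> \<beta> * (\<eta> * \<phi> (v x))" using \<beta> by simp
    then have "(1 / 2 + \<beta> * (v x - \<eta> * \<phi> (v x))) + (1 / 2 + \<beta> * (v y + K1)) \<le> (1 / 2 + \<beta> * v x) + (1 / 2 + \<beta> * v y)"
      by (simp add: algebra_simps)
    then have "((1 / 2 + \<beta> * (v x - \<eta> * \<phi> (v x))) + (1 / 2 + \<beta> * (v y + K1))) / (\<beta> * s) \<le> ((1 / 2 + \<beta> * v x) + (1 / 2 + \<beta> * v y)) / (\<beta> * s)"
      using \<beta> s by (intro divide_right_mono) auto
    moreover have "p + r = b * ((1 - \<eta> * l) * wt l s (v x) + (1 + \<eta> / 4 * l) * wt l s (v y))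
        + ((1 / 2 + \<beta> * (v x - \<eta> * \<phi> (v x))) + (1 / 2 + \<beta> * (v y + K1))) / (\<beta> * s)"
    proof -
      have "b * x1 + y1 / z + (b * x2 + y2 / z) = b * (x1 + x2) + (y1 + y2) / z" for x1 x2 y1 y2 z :: real
        by (simp add: algebra_simps add_divide_distrib)
      then show ?thesis unfolding p_def r_def .
    qed
    moreover have "lyap_weight l s \<beta> (Suc n) x + lyap_weight l s \<beta> (Suc n) y = b * ((1 - \<eta> / 4 * l) * (wt l s (v x) + wt l s (v y)))
        + ((1 / 2 + \<beta> * v x) + (1 / 2 + \<beta> * v y)) / (\<beta> * s)"
    proof -
      have "(a * b) * x1 + y1 / z + ((a * b) * x2 + y2 / z) = b * (a * (x1 + x2)) + (y1 + y2) / z" for a x1 x2 y1 y2 z :: real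
        by (simp add: algebra_simps add_divide_distrib)
      then show ?thesis unfolding lyap_weight_def power_Suc b_def[symmetric] .
    qed
    ultimately show ?thesis using 1 by linarith
  qed
  show ?thesis
  \<comment> \<open>A negative \<open>p\<close> would be cut to 0 in \<open>ennreal p\<close>. It
    cannot occur, since the integral bounded by \<open>ennreal p\<close> has a positive lower
    bound.\<close>
  proof (cases "0 \<le> p")
    case True
    have "(\<integral>\<^sup>+ u. ennreal (lyap_weight l s \<beta> n u) \<partial>P h x) + (\<integral>\<^sup>+ u. ennreal (lyap_weight l s \<beta> n u) \<partial>P h y) \<le> ennreal p + ennreal r"
      using lyap_weight_decay[OF assms(1,2), where n=n] lyap_weight_growth[where n=n and x=y] unfolding p_def r_def b_def by (rule add_mono)
    also have "\<dots> \<le> ennreal (lyap_weight l s \<beta> (Suc n) x + lyap_weight l s \<beta> (Suc n) y)"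
      using True \<open>0 \<le> r\<close> le by (simp add: ennreal_leI flip: ennreal_plus)
    finally show ?thesis .
  next
    case False
    interpret prob_space "P h x" by (rule prob_P) (use h_pos in simp)
    have "ennreal (1 / (2 * \<beta> * s)) = (\<integral>\<^sup>+ u. ennreal (1 / (2 * \<beta> * s)) \<partial>P h x)" by (simp add: emeasure_space_1)
    also have "\<dots> \<le> (\<integral>\<^sup>+ u. ennreal (lyap_weight l s \<beta> n u) \<partial>P h x)" by (intro nn_integral_mono ennreal_leI lyap_weight_pos)
    also have "\<dots> \<le> ennreal p" using lyap_weight_decay[OF assms(1,2), where n=n] unfolding p_def b_def .
    finally have "1 / (2 * \<beta> * s) \<le> 0" using False by (simp add: ennreal_neg ennreal_eq_0_iff)
    moreover have "0 < 1 / (2 * \<beta> * s)" using \<beta> s by simp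
    ultimately show ?thesis by linarith
  qed
qed

end

end

section \<open>Iteration over the skeleton and choice of the constants\<close>

context harris_chain
begin

text \<open>Each kind of pair pays for the growth \<Lambda> in its own way: near pairs by the halved
  distance, pairs in the small set by \<kappa>. Pairs reaching beyond \<open>s\<close> have so much
  weight that the trivial oscillation bound suffices, and for the remaining pairs the weights
  themselves decay.\<close>

lemma osc_iterate:
  fixes q l s \<beta> :: real
  assumes q: "0 < q" "q < 1" and l: "0 < l" "l \<le> D s" "\<eta> / 4 * l < 1" and s: "1 \<le> s" and \<beta>: "0 < \<beta>"
    and \<Lambda>: "0 \<le> \<Lambda>" "1 + 2 * \<beta> * K1 \<le> \<Lambda>" "1 + \<eta> / 4 * l \<le> \<Lambda> * (1 - \<eta> / 4 * l)"
      "\<Lambda> powr q \<le> 2 powr (1 - q)" "(1 - \<kappa>) powr (1 - q) * \<Lambda> powr q \<le> 1"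
    and f: "bLip f"
  shows "osc_bound (\<lambda>u v. min 1 (N * \<theta> u v)) q (lyap_weight l s \<beta> n) (\<lambda>x. \<integral>z. f z \<partial>P (real n * h) x)"
proof (induction n)
  case 0
  \<comment> \<open>Initially the weights sum to at least 1, so the Lipschitz bound min(1, N
    \<theta>) only has to be compared with its own power 1 - q.\<close>
  have sum: "1 \<le> lyap_weight l s \<beta> 0 u + lyap_weight l s \<beta> 0 w" for u w
  proof -
    have "1 \<le> wt l s (v u)" by (rule wt_v_ge_1[OF l s \<beta>(1)])
    moreover have "0 \<le> (1 / 2 + \<beta> * v u) / (\<beta> * s)" "0 \<le> lyap_weight l s \<beta> 0 w"
      using \<beta> s v_nonneg[of u] lyap_weight_pos[OF l s \<beta>(1), of 0 w] by (auto intro: order_trans[rotated])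
    ultimately show ?thesis by (simp add: lyap_weight_def)
  qed
  have "\<bar>f u - f w\<bar> \<le> min 1 (N * \<theta> u w) powr (1 - q) * (lyap_weight l s \<beta> 0 u + lyap_weight l s \<beta> 0 w) powr q" for u w
  proof -
    have "\<bar>f u - f w\<bar> \<le> bdist u w" by (rule bLip_abs[OF f])
    also have "\<dots> \<le> min 1 (N * \<theta> u w)"
      using \<theta>_ge[of u w] N_ge \<theta>_nonneg[of u w] mult_right_mono[OF N_ge \<theta>_nonneg, of u w] by auto
    finally have le: "\<bar>f u - f w\<bar> \<le> min 1 (N * \<theta> u w)" .
    have "min 1 (N * \<theta> u w) \<le> min 1 (N * \<theta> u w) powr (1 - q)"
    proof (cases "min 1 (N * \<theta> u w) = 0")
      case False
      then have "0 < min 1 (N * \<theta> u w)" using N_ge \<theta>_nonneg[of u w] by (auto simp: min_def less_le)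
      then show ?thesis using powr_mono'[of "1 - q" 1 "min 1 (N * \<theta> u w)"] q by simp
    qed simp
    also have "\<dots> \<le> min 1 (N * \<theta> u w) powr (1 - q) * (lyap_weight l s \<beta> 0 u + lyap_weight l s \<beta> 0 w) powr q"
    proof -
      have "1 \<le> (lyap_weight l s \<beta> 0 u + lyap_weight l s \<beta> 0 w) powr q" using sum[of u w] q by (intro ge_one_powr_ge_zero) auto
      from mult_left_mono[OF this, of "min 1 (N * \<theta> u w) powr (1 - q)"] show ?thesis by simp
    qed
    finally show ?thesis using le by linarith
  qed
  moreover have "(\<integral>z. f z \<partial>P 0 x) = f x" for x
    using bLip_measurable[OF f] by (simp add: P_0 integral_return)
  moreover have "bounded (range f)"
    using bLip_bounded[OF f, of _ undefined] by (auto simp: bounded_iff)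
  ultimately show ?case using bLip_measurable[OF f] by (simp add: osc_bound_def)
next
  case (Suc n)
  let ?J = "lyap_weight l s \<beta>"
  define g where "g x = (\<integral>z. f z \<partial>P (real n * h) x)" for x
  have g: "osc_bound (\<lambda>u v. min 1 (N * \<theta> u v)) q (?J n) g" using Suc by (simp add: g_def[abs_def])
  have time_nonneg: "0 \<le> real n * h" "0 \<le> h" using h_pos by auto
  have fb: "\<bar>f x\<bar> \<le> \<bar>f undefined\<bar> + 1" for x by (rule bLip_bounded[OF f])
  have fm: "f \<in> borel_measurable borel" by (rule bLip_measurable[OF f])
  have gS: "(\<integral>z. f z \<partial>P (real (Suc n) * h) x) = (\<integral>z. g z \<partial>P h x)" for x
    using integral_P_add[OF time_nonneg(2,1) fm fb, of x] by (simp add: g_def algebra_simps)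
  have J: "weight T (?J n)" by (rule lyap_weight_weight[OF l s \<beta>(1)])
  have Jpos: "0 < ?J k x" for k x
  proof -
    have "0 < 1 / (2 * \<beta> * s)" using \<beta> s by simp
    then show ?thesis using lyap_weight_pos[OF l s \<beta>(1), of k x] by linarith
  qed
  have growth: "(\<integral>\<^sup>+u. ennreal (?J n u) \<partial>P h x) + (\<integral>\<^sup>+u. ennreal (?J n u) \<partial>P h y) \<le> ennreal (\<Lambda> * (?J (Suc n) x + ?J (Suc n) y))" for x y
  proof -
    have "(\<integral>\<^sup>+u. ennreal (?J n u) \<partial>P h x) + (\<integral>\<^sup>+u. ennreal (?J n u) \<partial>P h y) \<le> ennreal (\<Lambda> * ?J (Suc n) x) + ennreal (\<Lambda> * ?J (Suc n) y)"
      by (intro add_mono lyap_weight_growth_factor[OF l s \<beta>(1) \<Lambda>(2,3)])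
    also have "\<dots> = ennreal (\<Lambda> * (?J (Suc n) x + ?J (Suc n) y))"
      using \<Lambda>(1) Jpos[of "Suc n"] by (simp add: distrib_left less_imp_le flip: ennreal_plus)
    finally show ?thesis .
  qed
  have \<Lambda>pos: "\<Lambda> > 0" using \<Lambda>(2) \<beta> const_bounds by (smt (verit) mult_pos_pos)
  have "\<bar>(\<integral>z. g z \<partial>P h x) - (\<integral>z. g z \<partial>P h y)\<bar> \<le> min 1 (N * \<theta> x y) powr (1 - q) * (?J (Suc n) x + ?J (Suc n) y) powr q" for x y
  proof (cases "x = y")
    case False
    define S where "S = ?J (Suc n) x + ?J (Suc n) y"
    have S: "S > 0" using Jpos[of "Suc n" x] Jpos[of "Suc n" y] by (simp add: S_def)
    have \<Lambda>S: "(\<Lambda> * S) powr q = \<Lambda> powr q * S powr q" using S \<Lambda>pos by (simp add: powr_mult)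
    show ?thesis
    proof (cases "N * \<theta> x y < 1")
      case True
      have d0: "0 \<le> N * \<theta> x y" using N_ge \<theta>_nonneg[of x y] by simp
      have "\<bar>(\<integral>z. g z \<partial>P h x) - (\<integral>z. g z \<partial>P h y)\<bar> \<le> min 1 (N * \<theta> x y / 2) powr (1 - q) * (\<Lambda> * S) powr q"
        using local_contraction[OF q J g False _ growth[of x y]] \<Lambda>pos S by (simp add: S_def)
      also have "\<dots> = (N * \<theta> x y) powr (1 - q) * S powr q * (\<Lambda> powr q / 2 powr (1 - q))"
        using True d0 by (simp add: \<Lambda>S powr_divide)
      also have "\<dots> \<le> (N * \<theta> x y) powr (1 - q) * S powr q * 1"
        using \<Lambda>(4) by (intro mult_left_mono) (auto simp: divide_le_eq)
      finally show ?thesis using True by (simp add: S_def)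
    next
      case far: False
      then have d1: "min 1 (N * \<theta> x y) = 1" by simp
      consider "v x \<le> M" "v y \<le> M" | "max (v x) (v y) > s" | "M < max (v x) (v y)" "max (v x) (v y) \<le> s" by linarith
      then have "\<bar>(\<integral>z. g z \<partial>P h x) - (\<integral>z. g z \<partial>P h y)\<bar> \<le> S powr q"
      proof cases
        case 1
        have "\<bar>(\<integral>z. g z \<partial>P h x) - (\<integral>z. g z \<partial>P h y)\<bar> \<le> (1 - \<kappa>) powr (1 - q) * (\<Lambda> * S) powr q"
          using small_set[OF q J g 1 _ growth[of x y]] \<Lambda>pos S by (simp add: S_def)
        also have "\<dots> = ((1 - \<kappa>) powr (1 - q) * \<Lambda> powr q) * S powr q" by (simp add: \<Lambda>S)
        also have "\<dots> \<le> 1 * S powr q" using \<Lambda>(5) by (intro mult_right_mono) auto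
        finally show ?thesis by simp
      next
        \<comment> \<open>The affine parts alone sum to at least 1 here, so the claim follows from
          the fact that the semigroup keeps oscillations at most 1.\<close>
        case 2
        have big: "1 \<le> (1 / 2 + \<beta> * v x + (1 / 2 + \<beta> * v y)) / (\<beta> * s)"
        proof -
          have "\<beta> * s \<le> \<beta> * (v x + v y)" using 2 \<beta> v_nonneg[of x] v_nonneg[of y] by (intro mult_left_mono) auto
          then show ?thesis using \<beta> s by (simp add: le_divide_eq algebra_simps)
        qed
        have "(1 / 2 + \<beta> * v u) / (\<beta> * s) \<le> ?J (Suc n) u" for u
          using decay_factor_bounds[OF l s \<beta>(1)] wt_v_ge_1[OF l s \<beta>(1), of u] by (simp add: lyap_weight_def)
        from this[of x] this[of y] have "1 \<le> S" using big unfolding S_def add_divide_distrib by linarith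
        then have "1 \<le> S powr q" using q by (intro ge_one_powr_ge_zero) auto
        moreover have "\<bar>(\<integral>z. g z \<partial>P h x) - (\<integral>z. g z \<partial>P h y)\<bar> \<le> 1"
          using bLip_osc_le_1[OF f, of "real (Suc n) * h" x y] h_pos unfolding gS by simp
        ultimately show ?thesis by linarith
      next
        case 3
        have "(\<integral>\<^sup>+u. ennreal (?J n u) \<partial>P h x) + (\<integral>\<^sup>+u. ennreal (?J n u) \<partial>P h y) \<le> ennreal S"
        proof (cases "v y \<le> v x")
          case True
          then show ?thesis unfolding S_def using 3 by (intro lyap_weight_pair_decay[OF l s \<beta>(1)]) auto
        next
          case False
          then show ?thesis unfolding S_def using 3 lyap_weight_pair_decay[OF l s \<beta>(1), of y x n] by (simp add: add.commute)
        qed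
        \<comment> \<open>The distance contributes only the trivial factor 1; the gain comes from
          \<open>lyap_weight_pair_decay\<close>, in whose bound \<Lambda> does not appear.\<close>
        then have "\<bar>(\<integral>z. g z \<partial>P h x) - (\<integral>z. g z \<partial>P h y)\<bar> \<le> min 1 (N * \<theta> x y / 2) powr (1 - q) * S powr q"
          using local_contraction[OF q J g False S] by simp
        also have "\<dots> \<le> 1 * S powr q"
          using q N_ge \<theta>_nonneg[of x y] by (intro mult_right_mono powr_le1) auto
        finally show ?thesis by simp
      qed
      then show ?thesis by (simp add: d1 S_def)
    qed
  qed simp
  moreover have "bounded (range (\<lambda>x. \<integral>z. f z \<partial>P (real (Suc n) * h) x))"
    using integral_P_bounded[OF _ fm fb, of "real (Suc n) * h"] h_pos by (auto simp: bounded_iff)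
  moreover have "(\<lambda>x. \<integral>z. f z \<partial>P (real (Suc n) * h) x) \<in> borel_measurable borel"
    using h_pos by (intro measurable_int_P fm) auto
  ultimately show ?case unfolding osc_bound_def gS by auto
qed

text \<open>The constants depend on q but neither on s nor on n, f and the points, which leaves the
  level s free for optimisation.\<close>

lemma weighted_contraction:
  assumes q: "0 < q" "q < 1"
  obtains \<beta> \<epsilon> where "0 < \<beta>" "0 < \<epsilon>" "\<And>s n f x y. 1 \<le> s \<Longrightarrow> bLip f \<Longrightarrow> \<eta> / 4 * (\<epsilon> * D s) < 1 \<and>
    \<bar>(\<integral>z. f z \<partial>P (real n * h) x) - (\<integral>z. f z \<partial>P (real n * h) y)\<bar>
      \<le> ((1 - \<eta> / 4 * (\<epsilon> * D s)) ^ n * (wt (\<epsilon> * D s) s (v x) + wt (\<epsilon> * D s) s (v y)) + (1 + \<beta> * (v x + v y)) / (\<beta> * s)) powr q"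
proof -
  \<comment> \<open>\<open>m\<close> is a gain that both the halved distance and the small set can
    supply, and \<Lambda> is the growth whose power q equals the power 1 - q of this gain.\<close>
  define m where "m = min 2 (1 / (1 - \<kappa>))"
  have m: "1 < m" "m \<le> 2" "m \<le> 1 / (1 - \<kappa>)" using \<kappa> by (auto simp: m_def)
  define \<Lambda> where "\<Lambda> = m powr ((1 - q) / q)"
  have \<Lambda>1: "\<Lambda> > 1" unfolding \<Lambda>_def using m q by (intro gr_one_powr) auto
  have \<Lambda>q: "\<Lambda> powr q = m powr (1 - q)" using q by (simp add: \<Lambda>_def powr_powr)
  have \<Lambda>4: "\<Lambda> powr q \<le> 2 powr (1 - q)" unfolding \<Lambda>q using m q by (intro powr_mono2) auto
  have \<Lambda>5: "(1 - \<kappa>) powr (1 - q) * \<Lambda> powr q \<le> 1"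
  proof -
    have "(1 - \<kappa>) powr (1 - q) * m powr (1 - q) = ((1 - \<kappa>) * m) powr (1 - q)"
      using \<kappa> m by (simp add: powr_mult)
    also have "\<dots> \<le> 1"
      using \<kappa> m q by (intro powr_le1) (auto simp: field_simps)
    finally show ?thesis by (simp add: \<Lambda>q)
  qed
  \<comment> \<open>\<beta> makes the first growth condition on \<Lambda> an equality; e below does
    the same for the second one at l = e \<phi>'(1). Since \<phi>' is nonincreasing, this choice
    serves every level s.\<close>
  define \<beta> where "\<beta> = (\<Lambda> - 1) / (2 * K1)"
  have \<beta>: "0 < \<beta>" using const_bounds \<Lambda>1 by (simp add: \<beta>_def)
  have \<beta>K: "1 + 2 * \<beta> * K1 \<le> \<Lambda>"
    using const_bounds by (simp add: \<beta>_def field_simps)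
  define e where "e = (\<Lambda> - 1) / (\<eta> / 4 * (1 + \<Lambda>) * D 1)"
  have e: "0 < e" unfolding e_def using \<Lambda>1 const_bounds D_pos[of 1] by (intro divide_pos_pos mult_pos_pos) auto
  define \<epsilon> where "\<epsilon> = min 1 e"
  have \<epsilon>: "0 < \<epsilon>" "\<epsilon> \<le> 1" "\<epsilon> \<le> e" using e by (auto simp: \<epsilon>_def)
  show ?thesis
  proof (rule that[OF \<beta> \<epsilon>(1)])
    fix s :: real and n :: nat and f :: "'a \<Rightarrow> real" and x y assume s: "1 \<le> s" and f: "bLip f"
    define l where "l = \<epsilon> * D s"
    have Ds: "0 < D s" "D s \<le> D 1" using s D_pos[of s] D_antimono[of 1 s] by auto
    have l: "0 < l" "l \<le> D s" using \<epsilon> Ds by (auto simp: l_def mult_left_le_one_le)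
    have "l \<le> e * D 1" unfolding l_def using \<epsilon> Ds by (intro mult_mono) auto
    then have "\<eta> / 4 * (1 + \<Lambda>) * l \<le> \<eta> / 4 * (1 + \<Lambda>) * (e * D 1)"
      using const_bounds \<Lambda>1 by (intro mult_left_mono) auto
    also have "\<dots> = \<Lambda> - 1" using const_bounds \<Lambda>1 D_pos[of 1] by (simp add: e_def)
    finally have key: "\<eta> / 4 * l * (1 + \<Lambda>) \<le> \<Lambda> - 1" by (simp add: algebra_simps)
    have l3: "\<eta> / 4 * l < 1"
    proof (rule ccontr)
      assume "\<not> \<eta> / 4 * l < 1"
      then have "1 * (1 + \<Lambda>) \<le> \<eta> / 4 * l * (1 + \<Lambda>)" using \<Lambda>1 by (intro mult_right_mono) auto
      then show False using key by simp
    qed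
    have "osc_bound (\<lambda>u v. min 1 (N * \<theta> u v)) q (lyap_weight l s \<beta> n) (\<lambda>x. \<integral>z. f z \<partial>P (real n * h) x)"
      using \<Lambda>1 key by (intro osc_iterate[OF q l l3 s \<beta> _ \<beta>K _ \<Lambda>4 \<Lambda>5 f]) (auto simp: algebra_simps add_divide_distrib)
    then have "\<bar>(\<integral>z. f z \<partial>P (real n * h) x) - (\<integral>z. f z \<partial>P (real n * h) y)\<bar>
       \<le> min 1 (N * \<theta> x y) powr (1 - q) * (lyap_weight l s \<beta> n x + lyap_weight l s \<beta> n y) powr q"
      by (auto simp: osc_bound_def)
    also have "\<dots> \<le> 1 * (lyap_weight l s \<beta> n x + lyap_weight l s \<beta> n y) powr q"
      using q N_ge \<theta>_nonneg[of x y] by (intro mult_right_mono powr_le1) auto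
    also have "lyap_weight l s \<beta> n x + lyap_weight l s \<beta> n y = (1 - \<eta> / 4 * l) ^ n * (wt l s (v x) + wt l s (v y)) + (1 + \<beta> * (v x + v y)) / (\<beta> * s)"
    proof -
      have "b * x1 + (1 / 2 + \<beta> * u) / z + (b * x2 + (1 / 2 + \<beta> * w) / z) = b * (x1 + x2) + (1 + \<beta> * (u + w)) / z"
        for b x1 x2 u w z :: real by (simp add: algebra_simps add_divide_distrib)
      then show ?thesis unfolding lyap_weight_def .
    qed
    finally show "\<eta> / 4 * (\<epsilon> * D s) < 1 \<and> \<bar>(\<integral>z. f z \<partial>P (real n * h) x) - (\<integral>z. f z \<partial>P (real n * h) y)\<bar>
      \<le> ((1 - \<eta> / 4 * (\<epsilon> * D s)) ^ n * (wt (\<epsilon> * D s) s (v x) + wt (\<epsilon> * D s) s (v y)) + (1 + \<beta> * (v x + v y)) / (\<beta> * s)) powr q"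
      using l3 by (simp add: l_def)
  qed
qed

lemma subgeometric_contraction:
  assumes \<delta>: "0 < \<delta>" "\<delta> < 1"
  obtains C C3 where "1 \<le> C" "0 < C3" "\<And>n f x y R. bLip f \<Longrightarrow> 1 \<le> R \<Longrightarrow> H R \<le> C3 * real n \<Longrightarrow>
    \<bar>(\<integral>z. f z \<partial>P (real n * h) x) - (\<integral>z. f z \<partial>P (real n * h) y)\<bar> \<le> C * ((\<phi> (v x) + \<phi> (v y)) / \<phi> R) powr \<delta>"
proof -
  \<comment> \<open>One factor q is the exponent in the weighted contraction, the other comes from
    \<phi>(V0)/\<phi>(s) = (\<phi>(V0)/\<phi>(R))^q.\<close>
  define q where "q = sqrt \<delta>"
  have q: "0 < q" "q < 1" and qq: "q * q = \<delta>" using \<delta> by (auto simp: q_def)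
  obtain \<beta> \<epsilon> where \<beta>: "0 < \<beta>" and \<epsilon>: "0 < \<epsilon>" and contr: "\<And>s n f x y. 1 \<le> s \<Longrightarrow> bLip f \<Longrightarrow> \<eta> / 4 * (\<epsilon> * D s) < 1 \<and>
    \<bar>(\<integral>z. f z \<partial>P (real n * h) x) - (\<integral>z. f z \<partial>P (real n * h) y)\<bar>
      \<le> ((1 - \<eta> / 4 * (\<epsilon> * D s)) ^ n * (wt (\<epsilon> * D s) s (v x) + wt (\<epsilon> * D s) s (v y)) + (1 + \<beta> * (v x + v y)) / (\<beta> * s)) powr q"
    using weighted_contraction[OF q] by metis
  \<comment> \<open>Of the k multiples of l H(R) gained by the decay, one cancels the exponential
    weight; the other k - 1 amount to at least ln(\<phi>(R)/\<phi>(V0)) by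
    \<open>lH\<close>.\<close>
  define k where "k = 1 + 1 / (\<epsilon> * (1 - q))"
  have k: "k > 1" using \<epsilon> q by (simp add: k_def)
  define C3 where "C3 = \<eta> / 4 / k"
  have C3: "0 < C3" using const_bounds k by (simp add: C3_def)
  define C' where "C' = 2 + (1 + 2 * \<beta>) / \<beta>"
  have C': "C' \<ge> 1" using \<beta> by (simp add: C'_def)
  define C where "C = C' powr q"
  have C: "C \<ge> 1" unfolding C_def using C' q by (intro ge_one_powr_ge_zero) auto
  show ?thesis
  proof (rule that[OF C C3])
    fix n :: nat and f :: "'a \<Rightarrow> real" and x y and R :: real assume f: "bLip f" and R: "1 \<le> R" and HR: "H R \<le> C3 * real n"
    define V0 where "V0 = max (v x) (v y)"
    have V0: "1 \<le> V0" using v_ge_1[of x] by (simp add: V0_def)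
    have pos: "\<phi> V0 > 0" "\<phi> R > 0" "\<phi> (v x) > 0" "\<phi> (v y) > 0"
      using V0 R v_ge_1[of x] v_ge_1[of y] by (auto intro!: phi_pos)
    have \<phi>V0: "\<phi> V0 \<le> \<phi> (v x) + \<phi> (v y)" using pos by (auto simp: V0_def max_def)
    have mono: "(\<phi> V0 / \<phi> R) powr \<delta> \<le> ((\<phi> (v x) + \<phi> (v y)) / \<phi> R) powr \<delta>"
      using \<delta> pos \<phi>V0 by (intro powr_mono2 divide_right_mono) auto
    show "\<bar>(\<integral>z. f z \<partial>P (real n * h) x) - (\<integral>z. f z \<partial>P (real n * h) y)\<bar> \<le> C * ((\<phi> (v x) + \<phi> (v y)) / \<phi> R) powr \<delta>"
    proof (cases "R \<le> V0")
      \<comment> \<open>For R at most V0 the claimed bound is at least 1, so the trivial oscillation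
        bound is enough.\<close>
      case True
      have "\<bar>(\<integral>z. f z \<partial>P (real n * h) x) - (\<integral>z. f z \<partial>P (real n * h) y)\<bar> \<le> 1"
        using h_pos by (intro bLip_osc_le_1[OF f]) auto
      also have "1 \<le> (\<phi> V0 / \<phi> R) powr \<delta>"
        using \<delta> pos phi_mono[OF _ True] R by (intro ge_one_powr_ge_zero) auto
      also note mono
      also have "((\<phi> (v x) + \<phi> (v y)) / \<phi> R) powr \<delta> \<le> C * ((\<phi> (v x) + \<phi> (v y)) / \<phi> R) powr \<delta>"
        using C by (simp add: mult_le_cancel_right1)
      finally show ?thesis .
    next
      case False
      then have V0R: "V0 < R" by simp
      \<comment> \<open>A weighted geometric mean of \<phi>(V0) and \<phi>(R); it lies between them
        and is therefore the value of \<phi> at some level s between V0 and R.\<close>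
      define p where "p = \<phi> V0 powr (1 - q) * \<phi> R powr q"
      have mR: "\<phi> V0 \<le> \<phi> R" using V0R V0 by (intro phi_mono) auto
      have p1: "\<phi> V0 \<le> p"
      proof -
        have "\<phi> V0 = \<phi> V0 powr (1 - q) * \<phi> V0 powr q" using pos by (simp flip: powr_add)
        also have "\<dots> \<le> p" unfolding p_def using pos mR q by (intro mult_left_mono powr_mono2) auto
        finally show ?thesis .
      qed
      have p2: "p \<le> \<phi> R"
      proof -
        have "p \<le> \<phi> R powr (1 - q) * \<phi> R powr q" unfolding p_def using pos mR q by (intro mult_right_mono powr_mono2) auto
        also have "\<dots> = \<phi> R" using pos by (simp flip: powr_add)
        finally show ?thesis .
      qed
      obtain s where s: "V0 \<le> s" "s \<le> R" "\<phi> s = p"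
        using IVT'[of \<phi> V0 p R] p1 p2 V0R V0 phi_cont[of V0 R] by auto
      have s1: "1 \<le> s" using s V0 by simp
      define l where "l = \<epsilon> * D s"
      have l: "0 < l" using \<epsilon> D_pos[of s] s1 by (simp add: l_def)
      have ct: "\<eta> / 4 * l < 1" "\<bar>(\<integral>z. f z \<partial>P (real n * h) x) - (\<integral>z. f z \<partial>P (real n * h) y)\<bar>
        \<le> ((1 - \<eta> / 4 * l) ^ n * (wt l s (v x) + wt l s (v y)) + (1 + \<beta> * (v x + v y)) / (\<beta> * s)) powr q"
        using contr[OF s1 f, of n x y] by (auto simp: l_def)
      have nk: "k * H R \<le> \<eta> / 4 * real n"
        using HR k by (simp add: C3_def field_simps)
      have ps: "\<phi> V0 / p = (\<phi> V0 / \<phi> R) powr q"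
      proof -
        have "\<phi> V0 / p = \<phi> V0 powr 1 / (\<phi> V0 powr (1 - q) * \<phi> R powr q)" using pos by (simp add: p_def)
        also have "\<dots> = \<phi> V0 powr (1 - (1 - q)) / \<phi> R powr q" by (subst powr_diff) simp
        also have "\<dots> = (\<phi> V0 / \<phi> R) powr q" using pos by (simp add: powr_divide)
        finally show ?thesis .
      qed
      have Rp: "\<phi> R / p = (\<phi> R / \<phi> V0) powr (1 - q)"
      proof -
        have "\<phi> R / p = \<phi> R powr 1 / (\<phi> V0 powr (1 - q) * \<phi> R powr q)" using pos by (simp add: p_def)
        also have "\<dots> = \<phi> R powr (1 - q) / \<phi> V0 powr (1 - q)" by (subst powr_diff) simp
        also have "\<dots> = (\<phi> R / \<phi> V0) powr (1 - q)" using pos by (simp add: powr_divide)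
        finally show ?thesis .
      qed
      have lH: "\<epsilon> * (1 - q) * ln (\<phi> R / \<phi> V0) \<le> l * H R"
      proof -
        have "(1 - q) * ln (\<phi> R / \<phi> V0) = ln (\<phi> R / \<phi> s)" using pos by (simp add: s(3) Rp ln_powr)
        also have "\<dots> \<le> D s * (H R - H s)" by (rule H_log_phi[OF s1 s(2)])
        also have "\<dots> \<le> D s * H R" using D_pos[of s] s1 H_nonneg[OF s1] by (intro mult_left_mono) auto
        finally have "\<epsilon> * ((1 - q) * ln (\<phi> R / \<phi> V0)) \<le> \<epsilon> * (D s * H R)" using \<epsilon> by (intro mult_left_mono) auto
        then show ?thesis by (simp add: l_def mult.assoc)
      qed
      have first: "(1 - \<eta> / 4 * l) ^ n * wt l s (v u) \<le> \<phi> V0 / p" if u: "v u \<le> V0" for u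
      proof -
        have "(1 - \<eta> / 4 * l) ^ n \<le> exp (- (\<eta> / 4 * l)) ^ n"
          using ct(1) exp_ge_add_one_self[of "- (\<eta> / 4 * l)"] by (intro power_mono) auto
        also have "\<dots> = exp (- (l * (\<eta> / 4 * real n)))" by (simp add: exp_of_nat_mult[symmetric] algebra_simps)
        also have "\<dots> \<le> exp (- (l * (k * H R)))" using nk l by simp
        finally have 1: "(1 - \<eta> / 4 * l) ^ n \<le> exp (- (l * (k * H R)))" .
        have 2: "wt l s (v u) \<le> exp (l * H R)"
          unfolding wt_def using l u V0R v_ge_1[of u] s1 by (auto intro!: mult_left_mono H_mono)
        have "(1 - \<eta> / 4 * l) ^ n * wt l s (v u) \<le> exp (- (l * (k * H R))) * exp (l * H R)"
          using 1 2 ct(1) by (intro mult_mono) (auto simp: wt_def)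
        also have "\<dots> = exp (- ((k - 1) * (l * H R)))" by (simp add: exp_add[symmetric] algebra_simps)
        also have "\<dots> \<le> exp (- ln (\<phi> R / \<phi> V0))"
        proof -
          have "(k - 1) * (\<epsilon> * (1 - q) * ln (\<phi> R / \<phi> V0)) \<le> (k - 1) * (l * H R)"
            using k lH by (intro mult_left_mono) auto
          moreover have "(k - 1) * (\<epsilon> * (1 - q) * ln (\<phi> R / \<phi> V0)) = ln (\<phi> R / \<phi> V0)"
            using \<epsilon> q by (simp add: k_def)
          ultimately show ?thesis by simp
        qed
        also have "\<dots> = \<phi> V0 / \<phi> R" using pos by (simp add: exp_minus)
        also have "\<dots> \<le> \<phi> V0 / p" using p1 p2 pos by (intro divide_left_mono) auto
        finally show ?thesis .
      qed
      have second: "(1 + \<beta> * (v x + v y)) / (\<beta> * s) \<le> (1 + 2 * \<beta>) / \<beta> * (\<phi> V0 / p)"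
      proof -
        have "\<beta> * (v x + v y) \<le> \<beta> * (2 * V0)" using \<beta> by (intro mult_left_mono) (auto simp: V0_def)
        then have "1 + \<beta> * (v x + v y) \<le> (1 + 2 * \<beta>) * V0" using V0 by (simp add: algebra_simps)
        then have "(1 + \<beta> * (v x + v y)) / (\<beta> * s) \<le> (1 + 2 * \<beta>) * V0 / (\<beta> * s)"
          using \<beta> s1 by (intro divide_right_mono) auto
        also have "\<dots> = (1 + 2 * \<beta>) / \<beta> * (V0 / s)" by simp
        also have "\<dots> \<le> (1 + 2 * \<beta>) / \<beta> * (\<phi> V0 / p)"
        proof (rule mult_left_mono)
          \<comment> \<open>The affine weight decays like V0/s, and concavity bounds this by the
            ratio of the values of \<phi>.\<close>
          show "V0 / s \<le> \<phi> V0 / p"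
            using phi_scale[of V0 s] s V0 s1 p1 pos by (simp add: field_simps)
        qed (use \<beta> in simp)
        finally show ?thesis .
      qed
      have "(1 - \<eta> / 4 * l) ^ n * (wt l s (v x) + wt l s (v y)) + (1 + \<beta> * (v x + v y)) / (\<beta> * s) \<le> C' * (\<phi> V0 / p)"
      proof -
        have "C' * (\<phi> V0 / p) = \<phi> V0 / p + \<phi> V0 / p + (1 + 2 * \<beta>) / \<beta> * (\<phi> V0 / p)"
          unfolding C'_def by (simp only: distrib_right)
        moreover have "(1 - \<eta> / 4 * l) ^ n * (wt l s (v x) + wt l s (v y)) = (1 - \<eta> / 4 * l) ^ n * wt l s (v x) + (1 - \<eta> / 4 * l) ^ n * wt l s (v y)"
          by (rule distrib_left)
        moreover have "v x \<le> V0" "v y \<le> V0" by (auto simp: V0_def)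
        ultimately show ?thesis using first[of x] first[of y] second by linarith
      qed
      moreover have "0 \<le> (1 - \<eta> / 4 * l) ^ n * (wt l s (v x) + wt l s (v y)) + (1 + \<beta> * (v x + v y)) / (\<beta> * s)"
        using ct(1) \<beta> s1 v_nonneg[of x] v_nonneg[of y]
        by (intro add_nonneg_nonneg mult_nonneg_nonneg divide_nonneg_nonneg) (auto simp: wt_def)
      ultimately have "((1 - \<eta> / 4 * l) ^ n * (wt l s (v x) + wt l s (v y)) + (1 + \<beta> * (v x + v y)) / (\<beta> * s)) powr q \<le> (C' * (\<phi> V0 / p)) powr q"
        using q by (intro powr_mono2) auto
      also have "\<dots> = C * (\<phi> V0 / \<phi> R) powr \<delta>"
        unfolding ps using C' pos qq by (simp add: powr_mult C_def powr_powr)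
      also have "\<dots> \<le> C * ((\<phi> (v x) + \<phi> (v y)) / \<phi> R) powr \<delta>" using mono C by (intro mult_left_mono) auto
      finally show ?thesis using ct(2) by linarith
    qed
  qed
qed

end

section \<open>Invariant measures and convergence rates\<close>

text \<open>The indicator of a closed set is the limit of the cutoffs max(0, 1 - k infdist). Such a
  cutoff has Lipschitz constant k for \<open>bdist\<close>, so \<open>g k x / real k\<close> is an
  admissible test function, and closed sets are an intersection-stable generator.\<close>

lemma measure_eqI_bLip:
  fixes \<mu> \<nu> :: "'a::metric_space measure"
  assumes \<mu>: "prob_space \<mu>" "sets \<mu> = sets borel" and \<nu>: "prob_space \<nu>" "sets \<nu> = sets borel"
    and eq: "\<And>f. bLip f \<Longrightarrow> (\<integral>x. f x \<partial>\<mu>) = (\<integral>x. f x \<partial>\<nu>)"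
  shows "\<mu> = \<nu>"
proof (rule measure_eqI_generator_eq[where \<Omega>=UNIV and E="Collect closed" and A="\<lambda>_. UNIV"])
  interpret \<mu>: prob_space \<mu> by fact
  interpret \<nu>: prob_space \<nu> by fact
  show "Int_stable (Collect closed :: 'a set set)" by (auto simp: Int_stable_def)
  have bs: "sets (borel :: 'a measure) = sigma_sets UNIV (Collect closed)"
    by (subst borel_eq_closed) (simp add: sets_measure_of)
  show "sets \<mu> = sigma_sets UNIV (Collect closed)" "sets \<nu> = sigma_sets UNIV (Collect closed)"
    using \<mu> \<nu> bs by auto
  fix F :: "'a set" assume "F \<in> Collect closed"
  then have F: "closed F" by simp
  have Fs: "F \<in> sets borel" using F by simp
  show "emeasure \<mu> F = emeasure \<nu> F"
  \<comment> \<open>\<open>infdist\<close> to the empty set is 0 by convention, so the cutoffs would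
    not converge to its indicator.\<close>
  proof (cases "F = {}")
    case False
    define g where "g k x = max 0 (1 - real k * infdist x F)" for k :: nat and x
    have g01: "0 \<le> g k x" "g k x \<le> 1" for k x by (auto simp: g_def infdist_nonneg)
    have gm: "g k \<in> borel_measurable borel" for k
      unfolding g_def by (intro borel_measurable_continuous_onI continuous_intros)
    have gL: "bLip (\<lambda>x. g k x / real k)" if "k > 0" for k
      unfolding bLip_def
    proof (intro allI)
      fix x y
      have "g k x - g k y \<le> real k * bdist x y"
      proof (cases "dist x y \<le> 1")
        case True
        have "infdist y F \<le> infdist x F + dist y x" by (rule infdist_triangle)
        then have "real k * infdist y F \<le> real k * (infdist x F + dist y x)" by (intro mult_left_mono) auto
        moreover have "0 \<le> real k * dist y x" by simp
        ultimately have "g k x - g k y \<le> real k * dist y x"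
          unfolding g_def by (simp add: algebra_simps max_def)
        then show ?thesis using True by (simp add: bdist_def dist_commute)
      next
        case False
        have "g k x - g k y \<le> 1" using g01[of k x] g01[of k y] by linarith
        then show ?thesis using False that by (simp add: bdist_def)
      qed
      then show "g k x / real k - g k y / real k \<le> bdist x y"
        using that by (simp add: field_simps)
    qed
    have geq: "(\<integral>x. g (Suc k) x \<partial>\<mu>) = (\<integral>x. g (Suc k) x \<partial>\<nu>)" for k
      using eq[OF gL[of "Suc k"]] by simp
    have lim: "(\<lambda>k. \<integral>x. g (Suc k) x \<partial>M) \<longlonglongrightarrow> measure M F" if M: "prob_space M" "sets M = sets borel" for M
    proof -
      interpret M: prob_space M by fact
      have [measurable]: "g k \<in> borel_measurable M" for k using gm M(2) by (simp cong: measurable_cong_sets)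
      have "(\<lambda>k. \<integral>x. g (Suc k) x \<partial>M) \<longlonglongrightarrow> (\<integral>x. indicator F x \<partial>M)"
      proof (rule integral_dominated_convergence[where w="\<lambda>_. 1"])
        show "AE x in M. (\<lambda>i. g (Suc i) x) \<longlonglongrightarrow> indicator F x"
        proof (rule AE_I2)
          fix x
          show "(\<lambda>i. g (Suc i) x) \<longlonglongrightarrow> indicator F x"
          proof (cases "x \<in> F")
            case True
            then have "g (Suc i) x = 1" for i by (simp add: g_def)
            then show ?thesis using True by simp
          next
            case x: False
            then have d: "infdist x F > 0" using F False infdist_pos_not_in_closed by blast
            obtain n where n: "real n * infdist x F > 1" using reals_Archimedean3[OF d] by blast
            have "eventually (\<lambda>i. g (Suc i) x = 0) sequentially"
              using eventually_ge_at_top[of n]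
            proof eventually_elim
              case (elim i)
              have "real n * infdist x F \<le> real (Suc i) * infdist x F" using elim d by (intro mult_right_mono) auto
              then show ?case using n by (simp add: g_def)
            qed
            then show ?thesis using x by (simp add: tendsto_eventually)
          qed
        qed
      qed (use g01 Fs M(2) in \<open>auto simp: abs_le_iff intro: order_trans[of _ 0]\<close>)
      then show ?thesis using Fs M(2) by simp
    qed
    have "measure \<mu> F = measure \<nu> F"
      using lim[OF \<mu>] lim[OF \<nu>] unfolding geq by (rule LIMSEQ_unique)
    then show ?thesis by (simp add: \<mu>.emeasure_eq_measure \<nu>.emeasure_eq_measure)
  qed simp
qed (use prob_space.emeasure_space_1[OF assms(1)] sets_eq_imp_space_eq[OF assms(2)] in auto)

text \<open>The coupling is the law of a pair whose first entry is drawn from \<open>\<mu>\<close>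
  and whose second entry is drawn from the transport kernel at the first. The slack of that kernel
  is removed by letting it tend to 0.\<close>

lemma wasserstein_le_dual:
  fixes \<mu> \<nu> :: "'a::{second_countable_topology, metric_space} measure"
  assumes \<mu>: "prob_space \<mu>" "sets \<mu> = sets borel" and \<nu>: "prob_space \<nu>" "sets \<nu> = sets borel"
    and dual: "\<And>f. bLip f \<Longrightarrow> (\<integral>x. f x \<partial>\<mu>) - (\<integral>x. f x \<partial>\<nu>) \<le> E"
  shows "wasserstein (\<lambda>x y. min (dist x y) 1) \<mu> \<nu> \<le> ennreal E"
proof (rule ennreal_le_epsilon)
  fix e :: real assume "0 < e"
  have "0 \<le> E" using dual[of "\<lambda>_. 0"] by (simp add: bLip_def)
  obtain \<kappa> where \<kappa>: "\<kappa> \<in> borel \<rightarrow>\<^sub>M prob_algebra borel" "\<mu> \<bind> \<kappa> = \<nu>"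
    and cost: "(\<integral>\<^sup>+x. \<integral>\<^sup>+y. ennreal (bdist x y) \<partial>\<kappa> x \<partial>\<mu>) \<le> ennreal (E + e)"
    using transport_kernel[OF \<mu> \<nu> dual \<open>0 < e\<close>] by blast
  note [measurable] = \<kappa>(1)
  have prob\<kappa>: "prob_space (\<kappa> x)" and sets\<kappa>: "sets (\<kappa> x) = sets borel" for x
    using measurable_space[OF \<kappa>(1), of x] by (auto simp: space_prob_algebra)
  define k where "k x = distr (\<kappa> x) (borel \<Otimes>\<^sub>M borel) (Pair x)" for x
  have kp: "k \<in> borel \<rightarrow>\<^sub>M prob_algebra (borel \<Otimes>\<^sub>M borel)"
    unfolding k_def by (rule measurable_distr_prob_space2[OF \<kappa>(1)]) simp
  have km: "k \<in> \<mu> \<rightarrow>\<^sub>M subprob_algebra (borel \<Otimes>\<^sub>M borel)"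
    using measurable_prob_algebraD[OF kp] \<mu>(2) by (simp cong: measurable_cong_sets)
  define c where "c = \<mu> \<bind> k"
  have \<mu>in: "\<mu> \<in> space (prob_algebra borel)" using \<mu> by (simp add: space_prob_algebra)
  have sc: "sets c = sets (borel \<Otimes>\<^sub>M borel)" unfolding c_def by (rule sets_bind'[OF \<mu>in kp])
  have int: "(\<integral>\<^sup>+z. F z \<partial>c) = (\<integral>\<^sup>+x. \<integral>\<^sup>+y. F (x, y) \<partial>\<kappa> x \<partial>\<mu>)" if F: "F \<in> borel_measurable (borel \<Otimes>\<^sub>M borel)" for F
  proof -
    have "(\<integral>\<^sup>+z. F z \<partial>c) = (\<integral>\<^sup>+x. \<integral>\<^sup>+z. F z \<partial>k x \<partial>\<mu>)" unfolding c_def by (rule nn_integral_bind[OF F km])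
    also have "\<dots> = (\<integral>\<^sup>+x. \<integral>\<^sup>+y. F (x, y) \<partial>\<kappa> x \<partial>\<mu>)"
      unfolding k_def using F sets\<kappa> by (intro nn_integral_cong nn_integral_distr) (auto cong: measurable_cong_sets)
    finally show ?thesis .
  qed
  have "c \<in> couplings \<mu> \<nu>"
    unfolding couplings_def
  proof (intro CollectI conjI sc)
    show "prob_space c" unfolding c_def by (rule prob_space_bind'[OF \<mu>in kp])
    show "distr c borel fst = \<mu>"
    proof (rule measure_eqI)
      fix A assume "A \<in> sets (distr c borel fst)"
      then have A[measurable]: "A \<in> sets borel" by simp
      have fc: "fst \<in> c \<rightarrow>\<^sub>M borel" by (simp add: measurable_cong_sets[OF sc refl])
      have "emeasure (distr c borel fst) A = (\<integral>\<^sup>+z. indicator A z \<partial>distr c borel fst)" by simp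
      also have "\<dots> = (\<integral>\<^sup>+z. indicator A (fst z) \<partial>c)" by (rule nn_integral_distr[OF fc]) simp
      also have "\<dots> = (\<integral>\<^sup>+x. \<integral>\<^sup>+y. indicator A x \<partial>\<kappa> x \<partial>\<mu>)" by (subst int) auto
      also have "\<dots> = (\<integral>\<^sup>+x. indicator A x \<partial>\<mu>)" using prob_space.emeasure_space_1[OF prob\<kappa>] by simp
      finally show "emeasure (distr c borel fst) A = emeasure \<mu> A" using \<mu>(2) by simp
    qed (simp add: \<mu>)
    show "distr c borel snd = \<nu>"
    proof (rule measure_eqI)
      fix A assume "A \<in> sets (distr c borel snd)"
      then have A[measurable]: "A \<in> sets borel" by simp
      have fc: "snd \<in> c \<rightarrow>\<^sub>M borel" by (simp add: measurable_cong_sets[OF sc refl])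
      have "emeasure (distr c borel snd) A = (\<integral>\<^sup>+z. indicator A z \<partial>distr c borel snd)" by simp
      also have "\<dots> = (\<integral>\<^sup>+z. indicator A (snd z) \<partial>c)" by (rule nn_integral_distr[OF fc]) simp
      also have "\<dots> = (\<integral>\<^sup>+x. \<integral>\<^sup>+y. indicator A y \<partial>\<kappa> x \<partial>\<mu>)" by (subst int) auto
      also have "\<dots> = (\<integral>\<^sup>+x. emeasure (\<kappa> x) A \<partial>\<mu>)" by (simp add: sets\<kappa>)
      also have "\<dots> = emeasure \<nu> A"
        unfolding \<kappa>(2)[symmetric] by (rule emeasure_bind_prob_algebra[OF \<mu>in \<kappa>(1) A, symmetric])
      finally show "emeasure (distr c borel snd) A = emeasure \<nu> A" .
    qed (simp add: \<nu>)
  qed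
  then have "wasserstein (\<lambda>x y. min (dist x y) 1) \<mu> \<nu> \<le> (\<integral>\<^sup>+z. ennreal (min (dist (fst z) (snd z)) 1) \<partial>c)"
    unfolding wasserstein_def by (rule INF_lower)
  also have "\<dots> = (\<integral>\<^sup>+x. \<integral>\<^sup>+y. ennreal (bdist x y) \<partial>\<kappa> x \<partial>\<mu>)"
    unfolding bdist_def[symmetric] by (subst int) auto
  also note cost
  finally show "wasserstein (\<lambda>x y. min (dist x y) 1) \<mu> \<nu> \<le> ennreal E + ennreal e"
    using \<open>0 \<le> E\<close> \<open>0 < e\<close> by simp
qed

context harris_chain
begin

section \<open>Cesaro averages of the skeleton chain\<close>

lemma phiv_measurable [measurable]: "(\<lambda>x. \<phi> (v x)) \<in> borel_measurable borel"
  by (rule phi_comp_measurable[OF v_meas v_nonneg])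

lemma phiv_nonneg: "0 \<le> \<phi> (v x)"
  by (rule nonneg[OF v_nonneg])

lemma time_nonneg: "0 \<le> real n * h"
  using h_pos by simp

text \<open>A qualitative form for existence and uniqueness: decay in n, times a factor linear in
  \<phi>(v), which is the quantity whose averages the drift controls. The exponent 1/2 stands for
  any exponent below 1.\<close>

lemma contraction_tendsto:
  obtains C a where "0 \<le> C" "a \<longlonglongrightarrow> 0" "\<And>n. 0 \<le> a n"
    "\<And>n f x y. bLip f \<Longrightarrow> \<bar>(\<integral>z. f z \<partial>P (real n * h) x) - (\<integral>z. f z \<partial>P (real n * h) y)\<bar> \<le> C * a n * (1 + \<phi> (v x) + \<phi> (v y))"
proof -
  obtain C C3 where C: "1 \<le> C" "0 < C3" and contr: "\<And>n f x y R. bLip f \<Longrightarrow> 1 \<le> R \<Longrightarrow> H R \<le> C3 * real n \<Longrightarrow>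
    \<bar>(\<integral>z. f z \<partial>P (real n * h) x) - (\<integral>z. f z \<partial>P (real n * h) y)\<bar> \<le> C * ((\<phi> (v x) + \<phi> (v y)) / \<phi> R) powr (1/2)"
    using subgeometric_contraction[of "1/2"] by auto
  define R where "R n = H_phi_inv \<phi> (C3 * real n)" for n
  have R: "1 \<le> R n" "H (R n) = C3 * real n" for n
    using H_phi_inv[of "C3 * real n"] C by (auto simp: R_def)
  have \<phi>R: "0 < \<phi> (R n)" for n using R[of n] by (intro phi_pos) auto
  have "filterlim (\<lambda>n. \<phi> (R n)) at_top sequentially"
    unfolding filterlim_at_top
  proof
    fix Z
    obtain z where z: "z > 1" "\<phi> z > Z" using phi_gt by blast
    show "eventually (\<lambda>n. Z \<le> \<phi> (R n)) sequentially"
      using eventually_ge_at_top[of "nat \<lceil>H z / C3\<rceil>"]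
    proof eventually_elim
      case (elim n)
      then have "H z / C3 \<le> real n" by linarith
      then have "H z \<le> H (R n)" using C R by (simp add: field_simps)
      then have "z \<le> R n" using H_strict_mono[of "R n" z] R[of n] by linarith
      then show ?case using phi_mono[of z "R n"] z by simp
    qed
  qed
  then have "(\<lambda>n. 1 / \<phi> (R n)) \<longlonglongrightarrow> 0"
    by (intro tendsto_divide_0[OF tendsto_const] filterlim_at_top_imp_at_infinity)
  then have "(\<lambda>n. (1 / \<phi> (R n)) powr (1/2)) \<longlonglongrightarrow> 0 powr (1/2)"
    using \<phi>R by (intro tendsto_powr') (auto intro!: always_eventually less_imp_le)
  then have a: "(\<lambda>n. (1 / \<phi> (R n)) powr (1/2)) \<longlonglongrightarrow> 0" by simp
  show ?thesis
  proof (rule that[of C, OF _ a])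
    fix n and f :: "'a \<Rightarrow> real" and x y assume f: "bLip f"
    define u where "u = \<phi> (v x) + \<phi> (v y)"
    have u: "0 \<le> u" using phiv_nonneg[of x] phiv_nonneg[of y] by (simp add: u_def)
    have "\<bar>(\<integral>z. f z \<partial>P (real n * h) x) - (\<integral>z. f z \<partial>P (real n * h) y)\<bar> \<le> C * (u / \<phi> (R n)) powr (1/2)"
      unfolding u_def using contr[OF f R(1), of n n x y] R by simp
    also have "(u / \<phi> (R n)) powr (1/2) = (1 / \<phi> (R n)) powr (1/2) * u powr (1/2)"
      using u \<phi>R[of n] by (simp add: powr_divide)
    also have "\<dots> \<le> (1 / \<phi> (R n)) powr (1/2) * (1 + u)"
    proof (rule mult_left_mono)
      have "sqrt u \<le> 1 + u" using u by (intro real_le_lsqrt) (auto simp: power2_eq_square algebra_simps)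
      then show "u powr (1/2) \<le> 1 + u" using u by (simp add: powr_half_sqrt)
    qed simp
    finally show "\<bar>(\<integral>z. f z \<partial>P (real n * h) x) - (\<integral>z. f z \<partial>P (real n * h) y)\<bar> \<le> C * (1 / \<phi> (R n)) powr (1/2) * (1 + \<phi> (v x) + \<phi> (v y))"
      using C by (simp add: u_def mult.assoc add.assoc)
  qed (use C in auto)
qed

lemma full_drift:
  obtains K2 where "0 \<le> K2" "\<And>x. (\<integral>\<^sup>+y. ennreal (v y) \<partial>P h x) + ennreal (\<eta> * \<phi> (v x)) \<le> ennreal (v x + K2)"
proof
  \<comment> \<open>The added term pays for the drift that is not guaranteed below the level
    \<open>M\<close>.\<close>
  define K2 where "K2 = K1 + \<eta> * \<phi> (max 0 M)"
  show "0 \<le> K2" using const_bounds nonneg[of "max 0 M"] by (simp add: K2_def)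
  fix x
  have \<eta>\<phi>: "0 \<le> \<eta> * \<phi> (v x)" using const_bounds phiv_nonneg[of x] by simp
  show "(\<integral>\<^sup>+y. ennreal (v y) \<partial>P h x) + ennreal (\<eta> * \<phi> (v x)) \<le> ennreal (v x + K2)"
  proof (cases "M \<le> v x")
    case True
    have "(\<integral>\<^sup>+y. ennreal (v y) \<partial>P h x) + ennreal (\<eta> * \<phi> (v x)) \<le> ennreal (v x - \<eta> * \<phi> (v x)) + ennreal (\<eta> * \<phi> (v x))"
      using drift2[OF True] by (intro add_right_mono) auto
    also have "\<dots> = ennreal (v x)" using drift2[OF True] \<eta>\<phi> by (simp flip: ennreal_plus)
    also have "\<dots> \<le> ennreal (v x + K2)" using \<open>0 \<le> K2\<close> by (intro ennreal_leI) simp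
    finally show ?thesis .
  next
    case False
    have "\<eta> * \<phi> (v x) \<le> \<eta> * \<phi> (max 0 M)" using False const_bounds v_nonneg[of x] by (intro mult_left_mono phi_mono) auto
    then have "v x + K1 + \<eta> * \<phi> (v x) \<le> v x + K2" by (simp add: K2_def)
    moreover have "(\<integral>\<^sup>+y. ennreal (v y) \<partial>P h x) + ennreal (\<eta> * \<phi> (v x)) \<le> ennreal (v x + K1) + ennreal (\<eta> * \<phi> (v x))"
      by (intro add_right_mono drift1)
    moreover have "ennreal (v x + K1) + ennreal (\<eta> * \<phi> (v x)) = ennreal (v x + K1 + \<eta> * \<phi> (v x))"
      using \<eta>\<phi> v_nonneg[of x] const_bounds by (intro ennreal_plus[symmetric]) auto
    ultimately show ?thesis by (metis ennreal_leI order_trans)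
  qed
qed

text \<open>Telescoping the drift bounds the time averages of \<phi>(v), although it bounds the mean
  of v only linearly in time. The drift is kept in additive form because subtraction of extended
  reals would not telescope.\<close>

lemma phi_sum_bound:
  obtains B where "0 \<le> B" "\<And>n. (\<Sum>k<n. \<integral>\<^sup>+y. ennreal (\<phi> (v y)) \<partial>P (real k * h) x) \<le> ennreal (B * real n)"
proof -
  obtain K2 where K2: "0 \<le> K2" "\<And>x. (\<integral>\<^sup>+y. ennreal (v y) \<partial>P h x) + ennreal (\<eta> * \<phi> (v x)) \<le> ennreal (v x + K2)"
    using full_drift by blast
  have tel: "(\<integral>\<^sup>+y. ennreal (v y) \<partial>P (real n * h) x) + ennreal \<eta> * (\<Sum>k<n. \<integral>\<^sup>+y. ennreal (\<phi> (v y)) \<partial>P (real k * h) x) \<le> ennreal (v x + real n * K2)" for n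
  proof (induction n)
    case 0
    then show ?case by (simp add: P_0 nn_integral_return)
  next
    case (Suc n)
    interpret prob_space "P (real n * h) x" by (rule prob_P[OF time_nonneg])
    have [measurable_cong]: "sets (P (real n * h) x) = sets borel" by (rule sets_P[OF time_nonneg])
    have [measurable]: "(\<lambda>y. \<integral>\<^sup>+z. ennreal (v z) \<partial>P h y) \<in> borel_measurable borel" using h_pos by (intro measurable_nn_P) auto
    let ?I = "\<lambda>k. \<integral>\<^sup>+y. ennreal (\<phi> (v y)) \<partial>P (real k * h) x"
    have "(\<integral>\<^sup>+y. ennreal (v y) \<partial>P (real (Suc n) * h) x) = (\<integral>\<^sup>+y. \<integral>\<^sup>+z. ennreal (v z) \<partial>P h y \<partial>P (real n * h) x)"
      using nn_integral_P_add[OF time_nonneg, of h "\<lambda>y. ennreal (v y)" n x] h_pos by (simp add: algebra_simps)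
    moreover have "ennreal \<eta> * ?I n = (\<integral>\<^sup>+y. ennreal (\<eta> * \<phi> (v y)) \<partial>P (real n * h) x)"
      using const_bounds phiv_nonneg by (simp add: ennreal_mult nn_integral_cmult)
    ultimately have "(\<integral>\<^sup>+y. ennreal (v y) \<partial>P (real (Suc n) * h) x) + ennreal \<eta> * ?I n
        = (\<integral>\<^sup>+y. (\<integral>\<^sup>+z. ennreal (v z) \<partial>P h y) + ennreal (\<eta> * \<phi> (v y)) \<partial>P (real n * h) x)"
      by (subst nn_integral_add) auto
    also have "\<dots> \<le> (\<integral>\<^sup>+y. ennreal (v y) + ennreal K2 \<partial>P (real n * h) x)"
      using K2 v_nonneg by (intro nn_integral_mono) (simp flip: ennreal_plus)
    also have "\<dots> = (\<integral>\<^sup>+y. ennreal (v y) \<partial>P (real n * h) x) + ennreal K2"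
      by (subst nn_integral_add) (auto simp: emeasure_space_1)
    finally have step: "(\<integral>\<^sup>+y. ennreal (v y) \<partial>P (real (Suc n) * h) x) + ennreal \<eta> * ?I n \<le> (\<integral>\<^sup>+y. ennreal (v y) \<partial>P (real n * h) x) + ennreal K2" .
    have "(\<integral>\<^sup>+y. ennreal (v y) \<partial>P (real (Suc n) * h) x) + ennreal \<eta> * (\<Sum>k<Suc n. ?I k)
       = ((\<integral>\<^sup>+y. ennreal (v y) \<partial>P (real (Suc n) * h) x) + ennreal \<eta> * ?I n) + ennreal \<eta> * (\<Sum>k<n. ?I k)"
      by (simp add: distrib_left ac_simps)
    also have "\<dots> \<le> ((\<integral>\<^sup>+y. ennreal (v y) \<partial>P (real n * h) x) + ennreal K2) + ennreal \<eta> * (\<Sum>k<n. ?I k)"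
      by (intro add_right_mono step)
    also have "\<dots> = ((\<integral>\<^sup>+y. ennreal (v y) \<partial>P (real n * h) x) + ennreal \<eta> * (\<Sum>k<n. ?I k)) + ennreal K2"
      by (simp add: ac_simps)
    also have "\<dots> \<le> ennreal (v x + real n * K2) + ennreal K2" by (intro add_right_mono Suc.IH)
    also have "\<dots> = ennreal (v x + real (Suc n) * K2)"
      using K2 v_nonneg[of x] by (simp add: algebra_simps flip: ennreal_plus)
    finally show ?case .
  qed
  define B where "B = (v x + K2) / \<eta>"
  have B: "0 \<le> B" using K2 v_nonneg[of x] const_bounds by (simp add: B_def)
  show ?thesis
  proof (rule that[OF B])
    fix n
    let ?S = "\<Sum>k<n. \<integral>\<^sup>+y. ennreal (\<phi> (v y)) \<partial>P (real k * h) x"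
    show "?S \<le> ennreal (B * real n)"
    proof (cases "n = 0")
      case False
      have le: "ennreal \<eta> * ?S \<le> ennreal (v x + real n * K2)" by (rule order_trans[OF _ tel[of n]]) simp
      have "ennreal \<eta> * ?S \<le> ennreal (\<eta> * (B * real n))"
      proof (rule order_trans[OF le ennreal_leI])
        have "v x \<le> real n * v x" using False v_nonneg[of x] by (simp add: mult_le_cancel_right1)
        moreover have "\<eta> * (B * real n) = (v x + K2) * real n" using const_bounds by (simp add: B_def)
        ultimately show "v x + real n * K2 \<le> \<eta> * (B * real n)" by (simp add: algebra_simps)
      qed
      also have "\<dots> = ennreal \<eta> * ennreal (B * real n)" using const_bounds B by (simp add: ennreal_mult)
      finally show ?thesis using const_bounds by (simp add: ennreal_mult_le_mult_iff)
    qed simp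
  qed
qed

text \<open>The law of the skeleton chain at a uniformly chosen time below \<open>m\<close>, i.e.
  the Cesaro mean of its laws. For \<open>m = 0\<close> it is some unspecified probability
  measure.\<close>

definition avg :: "'a \<Rightarrow> nat \<Rightarrow> 'a measure" where
  "avg x m = measure_pmf (pmf_of_set {..<m}) \<bind> (\<lambda>k. P (real k * h) x)"

lemma avg_kernel: "(\<lambda>k. P (real k * h) x) \<in> measure_pmf (pmf_of_set {..<m}) \<rightarrow>\<^sub>M prob_algebra borel"
  by (auto simp: space_prob_algebra prob_P[OF time_nonneg] sets_P[OF time_nonneg])

lemma prob_avg: "prob_space (avg x m)" and sets_avg: "sets (avg x m) = sets borel"
proof -
  have *: "measure_pmf (pmf_of_set {..<m}) \<in> space (prob_algebra (measure_pmf (pmf_of_set {..<m})))"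
    by (simp add: space_prob_algebra prob_space_measure_pmf)
  show "prob_space (avg x m)" unfolding avg_def by (rule prob_space_bind'[OF * avg_kernel])
  show "sets (avg x m) = sets borel" unfolding avg_def by (rule sets_bind'[OF * avg_kernel])
qed

lemma integral_avg:
  fixes f :: "'a \<Rightarrow> real"
  assumes "m > 0" and f: "f \<in> borel_measurable borel" "\<And>y. \<bar>f y\<bar> \<le> G"
  shows "(\<integral>y. f y \<partial>avg x m) = (\<Sum>k<m. \<integral>y. f y \<partial>P (real k * h) x) / real m"
proof -
  have "(\<integral>y. f y \<partial>avg x m) = (\<integral>k. (\<integral>y. f y \<partial>P (real k * h) x) \<partial>measure_pmf (pmf_of_set {..<m}))"
    unfolding avg_def
  proof (rule integral_bind[where K=borel and B'=1])
    show "AE k in measure_pmf (pmf_of_set {..<m}). emeasure (P (real k * h) x) (space (P (real k * h) x)) \<le> ennreal 1"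
      using prob_space.emeasure_space_1[OF prob_P[OF time_nonneg]] by simp
  qed (use f measurable_prob_algebraD[OF avg_kernel] in \<open>auto intro: prob_space.finite_measure[OF prob_space_measure_pmf]\<close>)
  also have "\<dots> = (\<Sum>k<m. \<integral>y. f y \<partial>P (real k * h) x) / real m"
    using assms(1) by (subst integral_pmf_of_set) auto
  finally show ?thesis .
qed

lemma nn_integral_avg_phi:
  obtains B where "0 \<le> B" "\<And>m. m > 0 \<Longrightarrow> (\<integral>\<^sup>+y. ennreal (\<phi> (v y)) \<partial>avg x m) \<le> ennreal B"
proof -
  obtain B where B: "0 \<le> B" "\<And>n. (\<Sum>k<n. \<integral>\<^sup>+y. ennreal (\<phi> (v y)) \<partial>P (real k * h) x) \<le> ennreal (B * real n)"
    using phi_sum_bound by blast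
  show ?thesis
  proof (rule that[OF B(1)])
    fix m :: nat assume m: "m > 0"
    have "(\<integral>\<^sup>+y. ennreal (\<phi> (v y)) \<partial>avg x m) = (\<integral>\<^sup>+k. \<integral>\<^sup>+y. ennreal (\<phi> (v y)) \<partial>P (real k * h) x \<partial>measure_pmf (pmf_of_set {..<m}))"
      unfolding avg_def by (rule nn_integral_bind[OF _ measurable_prob_algebraD[OF avg_kernel]]) measurable
    also have "\<dots> = (\<Sum>k<m. \<integral>\<^sup>+y. ennreal (\<phi> (v y)) \<partial>P (real k * h) x) / of_nat m"
      using m by (subst nn_integral_pmf_of_set) auto
    also have "\<dots> \<le> ennreal (B * real m) / of_nat m" by (intro divide_right_mono_ennreal B)
    also have "\<dots> = ennreal B"
      using m B(1) by (simp add: divide_ennreal ennreal_of_nat_eq_real_of_nat)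
    finally show "(\<integral>\<^sup>+y. ennreal (\<phi> (v y)) \<partial>avg x m) \<le> ennreal B" .
  qed
qed

text \<open>Shifting the window of the Cesaro mean by one step exchanges one summand at each end, a
  change of at most 2 G before division by \<open>m\<close>.\<close>

lemma avg_shift:
  fixes f :: "'a \<Rightarrow> real"
  assumes m: "m > 0" and f: "f \<in> borel_measurable borel" "\<And>y. \<bar>f y\<bar> \<le> G"
  shows "\<bar>(\<integral>y. (\<integral>z. f z \<partial>P (real n * h) y) \<partial>avg x m) - (\<integral>y. f y \<partial>avg x m)\<bar> \<le> 2 * G * real n / real m"
proof -
  define F where "F k = (\<integral>y. f y \<partial>P (real k * h) x)" for k
  have F: "\<bar>F k\<bar> \<le> G" for k unfolding F_def by (rule integral_P_bounded[OF time_nonneg f])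
  have Fk: "(\<integral>y. (\<integral>z. f z \<partial>P (real n * h) y) \<partial>P (real k * h) x) = F (k + n)" for k
    unfolding F_def using integral_P_add[OF time_nonneg time_nonneg f, of k n x] by (simp add: distrib_right)
  have "(\<integral>y. (\<integral>z. f z \<partial>P (real n * h) y) \<partial>avg x m) = (\<Sum>k<m. \<integral>y. (\<integral>z. f z \<partial>P (real n * h) y) \<partial>P (real k * h) x) / real m"
    by (rule integral_avg[OF m measurable_int_P[OF time_nonneg f(1)] integral_P_bounded[OF time_nonneg f]])
  then have 1: "(\<integral>y. (\<integral>z. f z \<partial>P (real n * h) y) \<partial>avg x m) = (\<Sum>k<m. F (k + n)) / real m" unfolding Fk .
  have 2: "(\<integral>y. f y \<partial>avg x m) = (\<Sum>k<m. F k) / real m"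
    unfolding F_def by (rule integral_avg[OF m f])
  have "\<bar>(\<Sum>k<m. F (k + n)) - (\<Sum>k<m. F k)\<bar> \<le> 2 * G * real n"
  proof (induction n)
    case (Suc n)
    have "(\<Sum>k<m. F (k + Suc n)) - (\<Sum>k<m. F (k + n)) = F (m + n) - F n"
      using sum_lessThan_telescope[of "\<lambda>k. F (k + n)" m] by (simp add: sum_subtractf)
    then have "\<bar>(\<Sum>k<m. F (k + Suc n)) - (\<Sum>k<m. F (k + n))\<bar> \<le> 2 * G"
      using F[of "m + n"] F[of n] by linarith
    then show ?case using Suc by (simp add: algebra_simps)
  qed simp
  then have "\<bar>(\<Sum>k<m. F (k + n)) - (\<Sum>k<m. F k)\<bar> / real m \<le> 2 * G * real n / real m"
    by (intro divide_right_mono) auto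
  then show ?thesis unfolding 1 2 by (simp flip: diff_divide_distrib)
qed

text \<open>Running n further steps hardly changes a long average, while those n steps make the test
  function nearly constant. Integrating the latter bound over independent starting points uses the
  uniform moment bound of \<phi>(v) under the averages.\<close>

lemma avg_Cauchy:
  assumes "\<epsilon> > 0"
  shows "\<exists>m0>0. \<forall>m\<ge>m0. \<forall>m'\<ge>m0. \<forall>f. bLip f \<longrightarrow> (\<integral>y. f y \<partial>avg x m) - (\<integral>y. f y \<partial>avg x m') \<le> \<epsilon>"
proof -
  obtain C a where C: "0 \<le> C" "a \<longlonglongrightarrow> 0" "\<And>n. 0 \<le> a n" and contr:
    "\<And>n f x y. bLip f \<Longrightarrow> \<bar>(\<integral>z. f z \<partial>P (real n * h) x) - (\<integral>z. f z \<partial>P (real n * h) y)\<bar> \<le> C * a n * (1 + \<phi> (v x) + \<phi> (v y))"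
    using contraction_tendsto by blast
  obtain B where B: "0 \<le> B" "\<And>m. m > 0 \<Longrightarrow> (\<integral>\<^sup>+y. ennreal (\<phi> (v y)) \<partial>avg x m) \<le> ennreal B"
    using nn_integral_avg_phi by blast
  have "(\<lambda>n. C * a n * (1 + 2 * B)) \<longlonglongrightarrow> C * 0 * (1 + 2 * B)" by (intro tendsto_intros C)
  then have "eventually (\<lambda>n. C * a n * (1 + 2 * B) < \<epsilon> / 2) sequentially"
    using assms by (intro order_tendstoD) auto
  then obtain n where n: "C * a n * (1 + 2 * B) < \<epsilon> / 2" by (auto dest: eventually_happens)
  define m0 where "m0 = Suc (nat \<lceil>8 * real n / \<epsilon>\<rceil>)"
  have m0: "2 * real n / real m \<le> \<epsilon> / 4" if "m \<ge> m0" for m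
  proof -
    have "8 * real n / \<epsilon> \<le> real m" using that unfolding m0_def by linarith
    moreover have "real m > 0" using that by (simp add: m0_def)
    ultimately show ?thesis using assms by (simp add: field_simps)
  qed
  have "(\<integral>y. f y \<partial>avg x m) - (\<integral>y. f y \<partial>avg x m') \<le> \<epsilon>" if m: "m \<ge> m0" "m' \<ge> m0" and f: "bLip f" for m m' f
  proof -
    have mpos: "m > 0" "m' > 0" using m by (auto simp: m0_def)
    \<comment> \<open>Subtracting \<open>f x\<close> normalises the test function to absolute value
      at most 1, so \<open>m0\<close> does not depend on \<open>f\<close>.\<close>
    define g where "g y = f y - f x" for y
    have g: "bLip g" using f by (simp add: bLip_def g_def)
    have gm[measurable]: "g \<in> borel_measurable borel" by (rule bLip_measurable[OF g])
    have g1: "\<bar>g y\<bar> \<le> 1" for y using bLip_abs[OF f, of y x] bdist_le_1[of y x] unfolding g_def by linarith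
    define G where "G y = (\<integral>z. g z \<partial>P (real n * h) y)" for y
    have Gm: "G \<in> borel_measurable borel" unfolding G_def by (rule measurable_int_P[OF time_nonneg gm])
    have G1: "\<bar>G y\<bar> \<le> 1" for y unfolding G_def by (rule integral_P_bounded[OF time_nonneg gm g1])
    have main: "\<bar>(\<integral>y. G y \<partial>avg x m) - (\<integral>y. G y \<partial>avg x m')\<bar> \<le> C * a n * (1 + 2 * B)"
    proof (rule coupling_osc[OF product_coupling[OF prob_avg sets_avg prob_avg sets_avg] Gm G1,
            where \<Psi>="\<lambda>z. C * a n * (1 + \<phi> (v (fst z)) + \<phi> (v (snd z)))"])
      show "\<bar>G y - G z\<bar> \<le> C * a n * (1 + \<phi> (v (fst (y, z))) + \<phi> (v (snd (y, z))))" for y z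
        unfolding G_def using contr[OF g, of n y z] by simp
      show "0 \<le> C * a n * (1 + 2 * B)" using C B by simp
      have pc: "avg x m \<Otimes>\<^sub>M avg x m' \<in> couplings (avg x m) (avg x m')"
        by (rule product_coupling[OF prob_avg sets_avg prob_avg sets_avg])
      then interpret pp: prob_space "avg x m \<Otimes>\<^sub>M avg x m'" by (auto simp: couplings_def)
      have [measurable_cong]: "sets (avg x m \<Otimes>\<^sub>M avg x m') = sets (borel \<Otimes>\<^sub>M borel)" using pc by (auto simp: couplings_def)
      have "(\<integral>\<^sup>+z. ennreal (C * a n * (1 + \<phi> (v (fst z)) + \<phi> (v (snd z)))) \<partial>(avg x m \<Otimes>\<^sub>M avg x m'))
         = (\<integral>\<^sup>+z. ennreal (C * a n) * (1 + (ennreal (\<phi> (v (fst z))) + ennreal (\<phi> (v (snd z))))) \<partial>(avg x m \<Otimes>\<^sub>M avg x m'))"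
        using C phiv_nonneg by (intro nn_integral_cong) (simp add: ennreal_mult add.assoc flip: ennreal_plus ennreal_1)
      also have "\<dots> = ennreal (C * a n) * (1 + ((\<integral>\<^sup>+z. ennreal (\<phi> (v (fst z))) \<partial>(avg x m \<Otimes>\<^sub>M avg x m')) + (\<integral>\<^sup>+z. ennreal (\<phi> (v (snd z))) \<partial>(avg x m \<Otimes>\<^sub>M avg x m'))))"
        by (simp add: nn_integral_cmult nn_integral_add pp.emeasure_space_1)
      also have "\<dots> = ennreal (C * a n) * (1 + ((\<integral>\<^sup>+y. ennreal (\<phi> (v y)) \<partial>avg x m) + (\<integral>\<^sup>+y. ennreal (\<phi> (v y)) \<partial>avg x m')))"
        using coupling_marginals[OF pc, of "\<lambda>y. ennreal (\<phi> (v y))"] by simp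
      also have "\<dots> \<le> ennreal (C * a n) * (1 + (ennreal B + ennreal B))"
        using B(2) mpos by (intro mult_left_mono add_mono) auto
      also have "\<dots> = ennreal (C * a n * (1 + 2 * B))"
      proof -
        have BB: "ennreal (B + B) = ennreal B + ennreal B" using B(1) by (intro ennreal_plus) auto
        have "ennreal (1 + (B + B)) = ennreal 1 + ennreal (B + B)" using B(1) by (intro ennreal_plus) auto
        moreover have "ennreal (C * a n * (1 + (B + B))) = ennreal (C * a n) * ennreal (1 + (B + B))"
          using C B(1) by (intro ennreal_mult) auto
        moreover have "C * a n * (1 + 2 * B) = C * a n * (1 + (B + B))" by simp
        ultimately show ?thesis by (simp only: BB ennreal_1)
      qed
      finally show "(\<integral>\<^sup>+z. ennreal (C * a n * (1 + \<phi> (v (fst z)) + \<phi> (v (snd z)))) \<partial>(avg x m \<Otimes>\<^sub>M avg x m')) \<le> ennreal (C * a n * (1 + 2 * B))" .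
    qed
    have s: "\<bar>(\<integral>y. G y \<partial>avg x k) - (\<integral>y. g y \<partial>avg x k)\<bar> \<le> \<epsilon> / 4" if "k \<ge> m0" for k
      using avg_shift[where m=k and f=g and G=1 and n=n and x=x, OF _ gm g1] m0[OF that] that unfolding G_def by (force simp: m0_def)
    have "(\<integral>y. g y \<partial>avg x k) = (\<integral>y. f y \<partial>avg x k) - f x" for k
    proof -
      interpret prob_space "avg x k" by (rule prob_avg)
      have "integrable (avg x k) (\<lambda>y. f y)" by (rule bLip_integrable[OF prob_avg sets_avg f]) (simp add: measurable_ident_sets[OF sets_avg])
      then show ?thesis by (simp add: g_def prob_space)
    qed
    then show ?thesis using s[OF m(1)] s[OF m(2)] main n by (simp only:)
  qed
  then show ?thesis by (intro exI[of _ m0]) (auto simp: m0_def)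
qed

end

context markov_semigroup
begin

lemma bind_P:
  assumes "prob_space \<mu>" "sets \<mu> = sets borel" "0 \<le> t"
  shows "prob_space (\<mu> \<bind> P t)" "sets (\<mu> \<bind> P t) = sets borel"
proof -
  have *: "\<mu> \<in> space (prob_algebra borel)" using assms by (simp add: space_prob_algebra)
  show "prob_space (\<mu> \<bind> P t)" by (rule prob_space_bind'[OF * kernel_P[OF assms(3)]])
  show "sets (\<mu> \<bind> P t) = sets borel" by (rule sets_bind'[OF * kernel_P[OF assms(3)]])
qed

end

lemma one_plus_powr_le:
  fixes z \<delta> :: real
  assumes "0 \<le> z" "0 < \<delta>" "\<delta> < 1"
  shows "(1 + z) powr \<delta> \<le> 2 * (1 + z powr \<delta>)"
proof -
  have "(1 + z) powr \<delta> \<le> (2 * max 1 z) powr \<delta>" using assms by (intro powr_mono2) auto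
  also have "\<dots> = 2 powr \<delta> * max 1 z powr \<delta>" using assms by (simp add: powr_mult)
  also have "\<dots> \<le> 2 * (1 + z powr \<delta>)"
  proof (rule mult_mono)
    show "2 powr \<delta> \<le> (2::real)" using powr_mono[of \<delta> 1 "2::real"] assms by simp
    show "max 1 z powr \<delta> \<le> 1 + z powr \<delta>" by (auto simp: max_def)
  qed auto
  finally show ?thesis .
qed

context harris_chain
begin

section \<open>Uniqueness, existence and rates for the invariant law\<close>

lemma invariant_iterate:
  fixes f :: "'a \<Rightarrow> real"
  assumes \<pi>: "prob_space \<pi>" "sets \<pi> = sets borel" "\<pi> \<bind> P h = \<pi>"
    and f: "f \<in> borel_measurable borel" "\<And>y. \<bar>f y\<bar> \<le> G"
  shows "(\<integral>y. (\<integral>z. f z \<partial>P (real n * h) y) \<partial>\<pi>) = (\<integral>y. f y \<partial>\<pi>)"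
  using f
proof (induction n arbitrary: f)
  case 0
  then show ?case by (simp add: P_0 integral_return)
next
  case (Suc n)
  have h0: "0 \<le> h" using h_pos by simp
  define g where "g y = (\<integral>z. f z \<partial>P h y)" for y
  have g: "g \<in> borel_measurable borel" "\<And>y. \<bar>g y\<bar> \<le> G"
    unfolding g_def using measurable_int_P[OF h0 Suc.prems(1)] integral_P_bounded[OF h0 Suc.prems] by auto
  have "(\<integral>z. f z \<partial>P (real (Suc n) * h) y) = (\<integral>z. g z \<partial>P (real n * h) y)" for y
    unfolding g_def using integral_P_add[OF time_nonneg h0 Suc.prems, of n y] by (simp add: algebra_simps)
  then have "(\<integral>y. (\<integral>z. f z \<partial>P (real (Suc n) * h) y) \<partial>\<pi>) = (\<integral>y. g y \<partial>\<pi>)"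
    using Suc.IH[OF g] by simp
  also have "\<dots> = (\<integral>y. f y \<partial>(\<pi> \<bind> P h))"
    unfolding g_def by (rule integral_P_bind[OF \<pi>(1,2) h0 Suc.prems, symmetric])
  finally show ?case by (simp add: \<pi>)
qed

text \<open>An arbitrary invariant law may fail to integrate \<phi>(v). The contraction bound is
  therefore truncated at 1, and dominated convergence replaces a moment estimate.\<close>

lemma invariant_unique:
  assumes \<pi>: "prob_space \<pi>" "sets \<pi> = sets borel" "\<pi> \<bind> P h = \<pi>"
    and \<pi>': "prob_space \<pi>'" "sets \<pi>' = sets borel" "\<pi>' \<bind> P h = \<pi>'"
  shows "\<pi> = \<pi>'"
proof (rule measure_eqI_bLip[OF \<pi>(1,2) \<pi>'(1,2)])
  fix f :: "'a \<Rightarrow> real" assume f: "bLip f"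
  obtain C a where C: "0 \<le> C" "a \<longlonglongrightarrow> 0" "\<And>n. 0 \<le> a n" and contr:
    "\<And>n f x y. bLip f \<Longrightarrow> \<bar>(\<integral>z. f z \<partial>P (real n * h) x) - (\<integral>z. f z \<partial>P (real n * h) y)\<bar> \<le> C * a n * (1 + \<phi> (v x) + \<phi> (v y))"
    using contraction_tendsto by blast
  have fb: "\<bar>f x\<bar> \<le> \<bar>f undefined\<bar> + 1" for x by (rule bLip_bounded[OF f])
  have fm: "f \<in> borel_measurable borel" by (rule bLip_measurable[OF f])
  have pc: "\<pi> \<Otimes>\<^sub>M \<pi>' \<in> couplings \<pi> \<pi>'" by (rule product_coupling[OF \<pi>(1,2) \<pi>'(1,2)])
  then interpret pp: prob_space "\<pi> \<Otimes>\<^sub>M \<pi>'" by (auto simp: couplings_def)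
  have [measurable_cong]: "sets (\<pi> \<Otimes>\<^sub>M \<pi>') = sets (borel \<Otimes>\<^sub>M borel)" using pc by (auto simp: couplings_def)
  define \<Psi> where "\<Psi> n z = min 1 (C * a n * (1 + \<phi> (v (fst z)) + \<phi> (v (snd z))))" for n z
  have \<Psi>0: "0 \<le> \<Psi> n z" "\<Psi> n z \<le> 1" for n z using C phiv_nonneg by (auto simp: \<Psi>_def intro!: add_nonneg_nonneg)
  have [measurable]: "\<Psi> n \<in> borel_measurable (borel \<Otimes>\<^sub>M borel)" for n unfolding \<Psi>_def by measurable
  have \<Psi>lim: "(\<lambda>n. \<integral>z. \<Psi> n z \<partial>(\<pi> \<Otimes>\<^sub>M \<pi>')) \<longlonglongrightarrow> (\<integral>z. 0 \<partial>(\<pi> \<Otimes>\<^sub>M \<pi>'))"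
  proof (rule integral_dominated_convergence[where w="\<lambda>_. 1"])
    have "(\<lambda>n. \<Psi> n z) \<longlonglongrightarrow> min 1 (C * 0 * (1 + \<phi> (v (fst z)) + \<phi> (v (snd z))))" for z
      unfolding \<Psi>_def by (intro tendsto_intros C)
    then show "AE z in \<pi> \<Otimes>\<^sub>M \<pi>'. (\<lambda>n. \<Psi> n z) \<longlonglongrightarrow> 0" by simp
  qed (use \<Psi>0 in auto)
  have "\<bar>(\<integral>x. f x \<partial>\<pi>) - (\<integral>x. f x \<partial>\<pi>')\<bar> \<le> (\<integral>z. \<Psi> n z \<partial>(\<pi> \<Otimes>\<^sub>M \<pi>'))" for n
  proof -
    define g where "g y = (\<integral>z. f z \<partial>P (real n * h) y)" for y
    have g: "g \<in> borel_measurable borel" "\<And>y. \<bar>g y\<bar> \<le> \<bar>f undefined\<bar> + 1"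
      unfolding g_def using measurable_int_P[OF time_nonneg fm] integral_P_bounded[OF time_nonneg fm fb] by auto
    have "\<bar>(\<integral>x. g x \<partial>\<pi>) - (\<integral>x. g x \<partial>\<pi>')\<bar> \<le> (\<integral>z. \<Psi> n z \<partial>(\<pi> \<Otimes>\<^sub>M \<pi>'))"
    proof (rule coupling_osc[OF pc g])
      show "\<bar>g x - g y\<bar> \<le> \<Psi> n (x, y)" for x y
        unfolding g_def \<Psi>_def using contr[OF f, of n x y] bLip_osc_le_1[OF f time_nonneg, of n x y] by simp
      show "(\<integral>\<^sup>+z. ennreal (\<Psi> n z) \<partial>(\<pi> \<Otimes>\<^sub>M \<pi>')) \<le> ennreal (\<integral>z. \<Psi> n z \<partial>(\<pi> \<Otimes>\<^sub>M \<pi>'))"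
        using \<Psi>0 by (subst nn_integral_eq_integral) (auto intro!: pp.integrable_const_bound[where B=1])
      show "0 \<le> (\<integral>z. \<Psi> n z \<partial>(\<pi> \<Otimes>\<^sub>M \<pi>'))" using \<Psi>0 by (intro integral_nonneg_AE) auto
    qed
    then show ?thesis
      unfolding g_def using invariant_iterate[OF \<pi> fm fb, of n] invariant_iterate[OF \<pi>' fm fb, of n] by simp
  qed
  then have "\<bar>(\<integral>x. f x \<partial>\<pi>) - (\<integral>x. f x \<partial>\<pi>')\<bar> \<le> 0"
    using \<Psi>lim by (intro LIMSEQ_le_const) auto
  then show "(\<integral>x. f x \<partial>\<pi>) = (\<integral>x. f x \<partial>\<pi>')" by simp
qed

text \<open>The Feller property makes the image of a Lipschitz test function under
  \<open>P h\<close> continuous and bounded, so weak convergence can be tested on it;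
  \<open>avg_shift\<close> then gives invariance in the limit.\<close>

lemma invariant_exists:
  assumes feller: "feller P"
  obtains \<pi> m where "prob_space \<pi>" "sets \<pi> = sets borel" "\<pi> \<bind> P h = \<pi>" "\<And>k. 0 < m k"
    "\<And>g::'a \<Rightarrow> real. continuous_on UNIV g \<Longrightarrow> bounded (range g) \<Longrightarrow> (\<lambda>k. \<integral>x. g x \<partial>avg x0 (m k)) \<longlonglongrightarrow> (\<integral>x. g x \<partial>\<pi>)"
proof -
  have "\<forall>k. \<exists>m0>0. \<forall>m\<ge>m0. \<forall>m'\<ge>m0. \<forall>f. bLip f \<longrightarrow> (\<integral>y. f y \<partial>avg x0 m) - (\<integral>y. f y \<partial>avg x0 m') \<le> (1/2) ^ k"
    using avg_Cauchy[of "(1/2) ^ k" x0 for k] by simp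
  then obtain M0 where M0: "\<And>k. 0 < M0 k" "\<And>k m m' f. M0 k \<le> m \<Longrightarrow> M0 k \<le> m' \<Longrightarrow> bLip f \<Longrightarrow>
      (\<integral>y. f y \<partial>avg x0 m) - (\<integral>y. f y \<partial>avg x0 m') \<le> (1/2) ^ k"
    by metis
  \<comment> \<open>Summing the thresholds makes both \<open>m k\<close> and
    \<open>m (Suc k)\<close> exceed \<open>M0 k\<close>, and the added \<open>k\<close> forces
    \<open>m k\<close> to infinity.\<close>
  define m where "m k = (\<Sum>i\<le>k. M0 i) + k" for k
  have m1: "M0 k \<le> m k" "M0 k \<le> m (Suc k)" for k
    using member_le_sum[of k "{..k}" M0] by (auto simp: m_def)
  have m0: "0 < m k" for k using M0(1)[of k] m1(1)[of k] by simp
  have mk: "k \<le> m k" for k by (simp add: m_def)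
  obtain \<pi> where \<pi>: "prob_space \<pi>" "sets \<pi> = sets borel" and lim:
    "\<And>g::'a \<Rightarrow> real. continuous_on UNIV g \<Longrightarrow> bounded (range g) \<Longrightarrow> (\<lambda>k. \<integral>x. g x \<partial>avg x0 (m k)) \<longlonglongrightarrow> (\<integral>x. g x \<partial>\<pi>)"
    using weak_limit_exists[of "\<lambda>k. avg x0 (m k)"] prob_avg sets_avg M0(2)[OF m1] by blast
  have h0: "0 \<le> h" using h_pos by simp
  have "\<pi> \<bind> P h = \<pi>"
  proof (rule measure_eqI_bLip[OF bind_P[OF \<pi> h0] \<pi>])
    fix f :: "'a \<Rightarrow> real" assume f: "bLip f"
    have fb: "\<bar>f x\<bar> \<le> \<bar>f undefined\<bar> + 1" for x by (rule bLip_bounded[OF f])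
    have fm: "f \<in> borel_measurable borel" by (rule bLip_measurable[OF f])
    have fc: "continuous_on UNIV f" "bounded (range f)"
      using bLip_continuous[OF f] fb by (auto simp: bounded_iff)
    define g where "g y = (\<integral>z. f z \<partial>P h y)" for y
    have gc: "continuous_on UNIV g" "bounded (range g)"
      using feller h0 fc unfolding feller_def g_def by auto
    have d: "(\<lambda>k. (\<integral>x. g x \<partial>avg x0 (m k)) - (\<integral>x. f x \<partial>avg x0 (m k))) \<longlonglongrightarrow> (\<integral>x. g x \<partial>\<pi>) - (\<integral>x. f x \<partial>\<pi>)"
      by (intro tendsto_diff lim gc fc)
    have "(\<lambda>k. (\<integral>x. g x \<partial>avg x0 (m k)) - (\<integral>x. f x \<partial>avg x0 (m k))) \<longlonglongrightarrow> 0"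
    proof (rule Lim_null_comparison)
      define G where "G = \<bar>f undefined\<bar> + 1"
      show "(\<lambda>k. 2 * G / real k) \<longlonglongrightarrow> 0"
        by (rule tendsto_divide_0[OF tendsto_const]) (rule filterlim_at_top_imp_at_infinity[OF filterlim_real_sequentially])
      show "\<forall>\<^sub>F k in sequentially. norm ((\<integral>x. g x \<partial>avg x0 (m k)) - (\<integral>x. f x \<partial>avg x0 (m k))) \<le> 2 * G / real k"
        using eventually_gt_at_top[of 0]
      proof eventually_elim
        case (elim k)
        have "\<bar>(\<integral>x. g x \<partial>avg x0 (m k)) - (\<integral>x. f x \<partial>avg x0 (m k))\<bar> \<le> 2 * G * real 1 / real (m k)"
          using avg_shift[where n=1 and m="m k" and x=x0, OF m0 fm fb] unfolding g_def G_def by simp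
        also have "\<dots> \<le> 2 * G / real k"
          using mk[of k] elim by (simp add: G_def divide_left_mono)
        finally show ?case by simp
      qed
    qed
    then have "(\<integral>x. g x \<partial>\<pi>) = (\<integral>x. f x \<partial>\<pi>)" using LIMSEQ_unique[OF d] by force
    then show "(\<integral>x. f x \<partial>(\<pi> \<bind> P h)) = (\<integral>x. f x \<partial>\<pi>)"
      unfolding g_def using integral_P_bind[OF \<pi> h0 fm fb] by simp
  qed
  then show ?thesis using that[OF \<pi> _ m0 lim] by blast
qed

text \<open>The moment of \<phi>(v) does not pass directly to the weak limit, since \<phi>(v) is
  only measurable. The estimate is made against the averages, whose moments are uniformly bounded,
  and only the iterated test function, continuous by the Feller property, is taken to the
  limit.\<close>

lemma skeleton_rate:
  assumes feller: "feller P" and \<delta>: "0 < \<delta>" "\<delta> < 1"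
    and \<pi>: "prob_space \<pi>" "sets \<pi> = sets borel" "\<pi> \<bind> P h = \<pi>" and m: "\<And>k. 0 < m k"
    and lim: "\<And>g::'a \<Rightarrow> real. continuous_on UNIV g \<Longrightarrow> bounded (range g) \<Longrightarrow> (\<lambda>k. \<integral>x. g x \<partial>avg x0 (m k)) \<longlonglongrightarrow> (\<integral>x. g x \<partial>\<pi>)"
  obtains C C3 B where "1 \<le> C" "0 < C3" "0 \<le> B" "\<And>n f x R. bLip f \<Longrightarrow> 1 \<le> R \<Longrightarrow> H R \<le> C3 * real n \<Longrightarrow>
    \<bar>(\<integral>z. f z \<partial>P (real n * h) x) - (\<integral>z. f z \<partial>\<pi>)\<bar> \<le> C * ((\<phi> (v x) + B) / \<phi> R) powr \<delta>"
proof -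
  obtain C C3 where C: "1 \<le> C" "0 < C3" and contr: "\<And>n f x y R. bLip f \<Longrightarrow> 1 \<le> R \<Longrightarrow> H R \<le> C3 * real n \<Longrightarrow>
    \<bar>(\<integral>z. f z \<partial>P (real n * h) x) - (\<integral>z. f z \<partial>P (real n * h) y)\<bar> \<le> C * ((\<phi> (v x) + \<phi> (v y)) / \<phi> R) powr \<delta>"
    using subgeometric_contraction[OF \<delta>] by metis
  obtain B where B: "0 \<le> B" "\<And>m. m > 0 \<Longrightarrow> (\<integral>\<^sup>+y. ennreal (\<phi> (v y)) \<partial>avg x0 m) \<le> ennreal B"
    using nn_integral_avg_phi by blast
  show ?thesis
  proof (rule that[OF C B(1)])
    fix n :: nat and f :: "'a \<Rightarrow> real" and x and R :: real assume f: "bLip f" and R: "1 \<le> R" "H R \<le> C3 * real n"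
    have fb: "\<bar>f x\<bar> \<le> \<bar>f undefined\<bar> + 1" for x by (rule bLip_bounded[OF f])
    have fm: "f \<in> borel_measurable borel" by (rule bLip_measurable[OF f])
    have fc: "continuous_on UNIV f" "bounded (range f)"
      using bLip_continuous[OF f] fb by (auto simp: bounded_iff)
    define g where "g y = (\<integral>z. f z \<partial>P (real n * h) y)" for y
    have gc: "continuous_on UNIV g" "bounded (range g)"
      using feller time_nonneg[of n] fc unfolding feller_def g_def by auto
    have gm[measurable]: "g \<in> borel_measurable borel" unfolding g_def by (rule measurable_int_P[OF time_nonneg fm])
    have gb: "\<bar>g y\<bar> \<le> \<bar>f undefined\<bar> + 1" for y unfolding g_def by (rule integral_P_bounded[OF time_nonneg fm fb])
    have \<phi>R: "\<phi> R > 0" using R by (intro phi_pos) auto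
    have px: "\<phi> (v x) > 0" using v_ge_1[of x] by (intro phi_pos) auto
    have bound: "\<bar>g x - (\<integral>y. g y \<partial>avg x0 (m k))\<bar> \<le> C * ((\<phi> (v x) + B) / \<phi> R) powr \<delta>" for k
    proof -
      have pc: "P 0 x \<Otimes>\<^sub>M avg x0 (m k) \<in> couplings (P 0 x) (avg x0 (m k))"
        by (rule product_coupling[OF prob_P sets_P prob_avg sets_avg]) auto
      then interpret pp: prob_space "P 0 x \<Otimes>\<^sub>M avg x0 (m k)" by (auto simp: couplings_def)
      have [measurable_cong]: "sets (P 0 x \<Otimes>\<^sub>M avg x0 (m k)) = sets (borel \<Otimes>\<^sub>M borel)" using pc by (auto simp: couplings_def)
      define W where "W z = \<phi> (v (fst z)) + \<phi> (v (snd z))" for z :: "'a \<times> 'a"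
      have W0: "0 \<le> W z" for z using phiv_nonneg by (simp add: W_def)
      have Wm[measurable]: "W \<in> borel_measurable (borel \<Otimes>\<^sub>M borel)" unfolding W_def by measurable
      have "(\<integral>\<^sup>+z. ennreal (W z) \<partial>(P 0 x \<Otimes>\<^sub>M avg x0 (m k))) = (\<integral>\<^sup>+y. ennreal (\<phi> (v y)) \<partial>P 0 x) + (\<integral>\<^sup>+y. ennreal (\<phi> (v y)) \<partial>avg x0 (m k))"
        unfolding W_def using phiv_nonneg coupling_marginals[OF pc, of "\<lambda>y. ennreal (\<phi> (v y))"]
        by (simp add: nn_integral_add)
      also have "\<dots> \<le> ennreal (\<phi> (v x)) + ennreal B"
        using B(2)[OF m[of k]] by (intro add_mono) (auto simp: P_0 nn_integral_return)
      also have "\<dots> = ennreal (\<phi> (v x) + B)" using px B(1) by simp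
      finally have WB: "(\<integral>\<^sup>+z. ennreal (W z) \<partial>(P 0 x \<Otimes>\<^sub>M avg x0 (m k))) \<le> ennreal (\<phi> (v x) + B)" .
      \<comment> \<open>With the constant 1 in place of the distance, Hoelder's inequality is
        Jensen's inequality for the power \<delta>.\<close>
      have Hl: "(\<integral>\<^sup>+z. ennreal (1 powr (1 - \<delta>) * W z powr \<delta>) \<partial>(P 0 x \<Otimes>\<^sub>M avg x0 (m k))) \<le> ennreal (1 powr (1 - \<delta>) * (\<phi> (v x) + B) powr \<delta>)"
        using W0 WB px B(1) \<delta> by (intro nn_integral_Hoelder pp.prob_space_axioms) (auto simp: pp.emeasure_space_1)
      have "\<bar>(\<integral>y. g y \<partial>P 0 x) - (\<integral>y. g y \<partial>avg x0 (m k))\<bar> \<le> C * ((\<phi> (v x) + B) / \<phi> R) powr \<delta>"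
      proof (rule coupling_osc[OF pc gm gb, where \<Psi>="\<lambda>z. C / \<phi> R powr \<delta> * W z powr \<delta>"])
        show "\<bar>g y - g z\<bar> \<le> C / \<phi> R powr \<delta> * W (y, z) powr \<delta>" for y z
          using contr[OF f R, of y z] phiv_nonneg[of y] phiv_nonneg[of z] \<phi>R
          by (simp add: g_def W_def powr_divide)
        have "(\<integral>\<^sup>+z. ennreal (C / \<phi> R powr \<delta> * W z powr \<delta>) \<partial>(P 0 x \<Otimes>\<^sub>M avg x0 (m k)))
           = ennreal (C / \<phi> R powr \<delta>) * (\<integral>\<^sup>+z. ennreal (W z powr \<delta>) \<partial>(P 0 x \<Otimes>\<^sub>M avg x0 (m k)))"
          using C by (subst nn_integral_cmult[symmetric]) (auto simp: ennreal_mult[symmetric])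
        also have "\<dots> \<le> ennreal (C / \<phi> R powr \<delta>) * ennreal ((\<phi> (v x) + B) powr \<delta>)"
          using Hl by (intro mult_left_mono) auto
        also have "\<dots> = ennreal (C * ((\<phi> (v x) + B) / \<phi> R) powr \<delta>)"
          using C px B(1) \<phi>R by (simp add: powr_divide flip: ennreal_mult)
        finally show "(\<integral>\<^sup>+z. ennreal (C / \<phi> R powr \<delta> * W z powr \<delta>) \<partial>(P 0 x \<Otimes>\<^sub>M avg x0 (m k))) \<le> ennreal (C * ((\<phi> (v x) + B) / \<phi> R) powr \<delta>)" .
        show "0 \<le> C * ((\<phi> (v x) + B) / \<phi> R) powr \<delta>" using C by simp
      qed
      then show ?thesis by (simp add: P_0 integral_return)
    qed
    have "(\<lambda>k. \<bar>g x - (\<integral>y. g y \<partial>avg x0 (m k))\<bar>) \<longlonglongrightarrow> \<bar>g x - (\<integral>y. g y \<partial>\<pi>)\<bar>"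
      by (intro tendsto_intros lim gc)
    then have "\<bar>g x - (\<integral>y. g y \<partial>\<pi>)\<bar> \<le> C * ((\<phi> (v x) + B) / \<phi> R) powr \<delta>"
      by (rule LIMSEQ_le_const2) (use bound in auto)
    then show "\<bar>(\<integral>z. f z \<partial>P (real n * h) x) - (\<integral>z. f z \<partial>\<pi>)\<bar> \<le> C * ((\<phi> (v x) + B) / \<phi> R) powr \<delta>"
      unfolding g_def using invariant_iterate[OF \<pi> fm fb, of n] by simp
  qed
qed

text \<open>Time is split as t = s + n h with the remainder s run first. The skeleton bound then
  applies pointwise at the position reached at time s, where the moment of \<phi>(V) has grown by at
  most a constant.\<close>

lemma continuous_time_rate:
  assumes feller: "feller P" and \<delta>: "0 < \<delta>" "\<delta> < 1"
    and \<pi>: "prob_space \<pi>" "sets \<pi> = sets borel" "\<pi> \<bind> P h = \<pi>" and m: "\<And>k. 0 < m k"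
    and lim: "\<And>g::'a \<Rightarrow> real. continuous_on UNIV g \<Longrightarrow> bounded (range g) \<Longrightarrow> (\<lambda>k. \<integral>x. g x \<partial>avg x0 (m k)) \<longlonglongrightarrow> (\<integral>x. g x \<partial>\<pi>)"
    and vV: "\<And>x. \<phi> (v x) \<le> a0 + a1 * \<phi> (V x)" "0 \<le> a0" "0 \<le> a1"
  shows "\<exists>C1>0. \<exists>C2>0. \<forall>x. \<forall>t\<ge>0. wasserstein (\<lambda>x y. min (dist x y) 1) (P t x) \<pi>
          \<le> ennreal (C1 * (1 + \<phi> (V x) powr \<delta>) / \<phi> (H_phi_inv \<phi> (C2 * t)) powr \<delta>)"
proof -
  obtain C C3 B where C: "1 \<le> C" "0 < C3" "0 \<le> B" and rate: "\<And>n f x R. bLip f \<Longrightarrow> 1 \<le> R \<Longrightarrow> H R \<le> C3 * real n \<Longrightarrow>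
    \<bar>(\<integral>z. f z \<partial>P (real n * h) x) - (\<integral>z. f z \<partial>\<pi>)\<bar> \<le> C * ((\<phi> (v x) + B) / \<phi> R) powr \<delta>"
    using skeleton_rate[OF feller \<delta> \<pi> m lim] by metis
  interpret \<pi>: prob_space \<pi> by (rule \<pi>(1))
  \<comment> \<open>For t at least h, the integer part n of t/h satisfies t/h \<le> 2 n, so C2 t is
    at most C3 n.\<close>
  define C2 where "C2 = C3 / (2 * h)"
  have C2: "0 < C2" using C h_pos by (simp add: C2_def)
  define R where "R t = H_phi_inv \<phi> (C2 * t)" for t
  have R: "1 \<le> R t" "H (R t) = C2 * t" if "0 \<le> t" for t
    using H_phi_inv[of "C2 * t"] C2 that by (auto simp: R_def)
  have \<phi>R: "0 < \<phi> (R t)" if "0 \<le> t" for t using R[OF that] by (intro phi_pos) auto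
  define a2 where "a2 = 1 + a0 + a1 * (c * K * h) + B + a1"
  have cK: "0 \<le> c * K * h" using c_pos K_pos h_pos by simp
  have a2: "1 \<le> a2" using vV C cK by (simp add: a2_def)
  \<comment> \<open>The second entry of the maximum makes the bound at least 1 for t < h, where the
    trivial oscillation bound is used.\<close>
  define C1 where "C1 = max (C * a2 powr \<delta> * 2) (\<phi> (R h) powr \<delta>)"
  have C1: "0 < C1" using C a2 by (simp add: C1_def less_max_iff_disj)
  have "wasserstein (\<lambda>x y. min (dist x y) 1) (P t x) \<pi> \<le> ennreal (C1 * (1 + \<phi> (V x) powr \<delta>) / \<phi> (R t) powr \<delta>)" if t: "0 \<le> t" for x t
  proof (rule wasserstein_le_dual[OF prob_P[OF t] sets_P[OF t] \<pi>(1,2)])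
    fix f :: "'a \<Rightarrow> real" assume f: "bLip f"
    have fb: "\<bar>f x\<bar> \<le> \<bar>f undefined\<bar> + 1" for x by (rule bLip_bounded[OF f])
    have fm[measurable]: "f \<in> borel_measurable borel" by (rule bLip_measurable[OF f])
    show "(\<integral>y. f y \<partial>P t x) - (\<integral>y. f y \<partial>\<pi>) \<le> C1 * (1 + \<phi> (V x) powr \<delta>) / \<phi> (R t) powr \<delta>"
    proof (cases "t < h")
      case True
      have "H (R t) \<le> H (R h)" using R[OF t] R[of h] True C2 h_pos by simp
      then have "R t \<le> R h" using H_strict_mono[of "R h" "R t"] R[of h] R[OF t] h_pos by force
      then have "\<phi> (R t) powr \<delta> \<le> \<phi> (R h) powr \<delta>"
        using R[OF t] \<phi>R[OF t] \<delta> by (intro powr_mono2 phi_mono) auto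
      also have "\<dots> \<le> C1" by (simp add: C1_def)
      also have "\<dots> \<le> C1 * (1 + \<phi> (V x) powr \<delta>)" using C1 by simp
      finally have "1 \<le> C1 * (1 + \<phi> (V x) powr \<delta>) / \<phi> (R t) powr \<delta>" using \<phi>R[OF t] by simp
      moreover have "(\<integral>y. f y \<partial>P t x) - (\<integral>y. f y \<partial>\<pi>) \<le> 1"
      proof -
        have pc: "P t x \<Otimes>\<^sub>M \<pi> \<in> couplings (P t x) \<pi>" by (rule product_coupling[OF prob_P[OF t] sets_P[OF t] \<pi>(1,2)])
        then interpret pp: prob_space "P t x \<Otimes>\<^sub>M \<pi>" by (auto simp: couplings_def)
        have "\<bar>(\<integral>y. f y \<partial>P t x) - (\<integral>y. f y \<partial>\<pi>)\<bar> \<le> 1"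
        proof (rule coupling_osc[OF pc fm fb, where \<Psi>="\<lambda>_. 1"])
          show "\<bar>f u - f w\<bar> \<le> 1" for u w using bLip_abs[OF f, of u w] bdist_le_1[of u w] by linarith
        qed (auto simp: pp.emeasure_space_1)
        then show ?thesis by simp
      qed
      ultimately show ?thesis by linarith
    next
      case False
      define n where "n = nat \<lfloor>t / h\<rfloor>"
      define s where "s = t - real n * h"
      have th: "1 \<le> t / h" using False h_pos by (simp add: field_simps)
      have n: "real n \<le> t / h" "t / h < real n + 1" using th by (auto simp: n_def)
      have s: "0 \<le> s" "s \<le> h"
        using n h_pos by (auto simp: s_def field_simps)
      have n1: "1 \<le> real n" using th by (simp add: n_def)
      have nh: "C2 * t \<le> C3 * real n"
      proof -
        have "t / h \<le> 2 * real n" using n n1 by linarith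
        then have "C3 / 2 * (t / h) \<le> C3 / 2 * (2 * real n)" using C by (intro mult_left_mono) auto
        then show ?thesis by (simp add: C2_def)
      qed
      interpret Ps: prob_space "P s x" by (rule prob_P[OF s(1)])
      have [measurable_cong]: "sets (P s x) = sets borel" by (rule sets_P[OF s(1)])
      define g where "g y = (\<integral>z. f z \<partial>P (real n * h) y)" for y
      have gm[measurable]: "g \<in> borel_measurable borel" unfolding g_def by (rule measurable_int_P[OF time_nonneg fm])
      have gb: "\<bar>g y\<bar> \<le> \<bar>f undefined\<bar> + 1" for y unfolding g_def by (rule integral_P_bounded[OF time_nonneg fm fb])
      have gi: "integrable (P s x) g" using gb by (intro Ps.integrable_const_bound[where B="\<bar>f undefined\<bar> + 1"]) auto
      have "P t x = P (s + real n * h) x" by (simp add: s_def)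
      then have "(\<integral>y. f y \<partial>P t x) = (\<integral>y. g y \<partial>P s x)"
        unfolding g_def using integral_P_add[OF s(1) time_nonneg fm fb, of n x] by simp
      then have "(\<integral>y. f y \<partial>P t x) - (\<integral>y. f y \<partial>\<pi>) = (\<integral>y. g y - (\<integral>y. f y \<partial>\<pi>) \<partial>P s x)"
        using gi by (simp add: Ps.prob_space)
      also have "\<dots> \<le> (\<integral>y. \<bar>g y - (\<integral>y. f y \<partial>\<pi>)\<bar> \<partial>P s x)"
        using gi by (intro integral_mono) auto
      also have "\<dots> \<le> C1 * (1 + \<phi> (V x) powr \<delta>) / \<phi> (R t) powr \<delta>"
      proof -
        define W where "W y = \<phi> (v y) + B" for y
        define u where "u = a0 + a1 * (\<phi> (V x) + c * K * s) + B + 1"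
        have W0: "0 \<le> W y" for y using phiv_nonneg[of y] C by (simp add: W_def)
        have Wm[measurable]: "W \<in> borel_measurable borel" unfolding W_def by measurable
        have \<phi>V: "0 \<le> \<phi> (V x)" using nonneg V_nonneg by simp
        have cKs: "0 \<le> c * K * s" using c_pos K_pos s by simp
        have u: "0 < u" using vV C \<phi>V c_pos K_pos s unfolding u_def by (intro add_nonneg_pos add_nonneg_nonneg mult_nonneg_nonneg) auto
        have "(\<integral>\<^sup>+y. ennreal (W y) \<partial>P s x) \<le> ennreal ((a0 + B) + a1 * (\<phi> (V x) + c * K * s))"
        proof (rule nn_integral_affine_bound[OF Ps.prob_space_axioms, where v="\<lambda>y. \<phi> (V y)"])
          show "W z \<le> a0 + B + a1 * \<phi> (V z)" for z using vV(1)[of z] by (simp add: W_def)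
        qed (use nonneg V_nonneg W0 vV phi_growth[OF s(1), of x] \<phi>V cKs in auto)
        also have "\<dots> \<le> ennreal u" by (intro ennreal_leI) (simp add: u_def)
        finally have WB: "(\<integral>\<^sup>+y. ennreal (W y) \<partial>P s x) \<le> ennreal u" .
        have Hl: "(\<integral>\<^sup>+y. ennreal (1 powr (1 - \<delta>) * W y powr \<delta>) \<partial>P s x) \<le> ennreal (1 powr (1 - \<delta>) * u powr \<delta>)"
          using W0 WB u \<delta> by (intro nn_integral_Hoelder Ps.prob_space_axioms) (auto simp: Ps.emeasure_space_1)
        have "ennreal (\<integral>y. \<bar>g y - (\<integral>y. f y \<partial>\<pi>)\<bar> \<partial>P s x) = (\<integral>\<^sup>+y. ennreal \<bar>g y - (\<integral>y. f y \<partial>\<pi>)\<bar> \<partial>P s x)"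
          using gi by (intro nn_integral_eq_integral[symmetric]) auto
        also have "\<dots> \<le> (\<integral>\<^sup>+y. ennreal (C / \<phi> (R t) powr \<delta>) * ennreal (W y powr \<delta>) \<partial>P s x)"
        proof (rule nn_integral_mono)
          fix y
          have "\<bar>g y - (\<integral>y. f y \<partial>\<pi>)\<bar> \<le> C * (W y / \<phi> (R t)) powr \<delta>"
            unfolding g_def W_def using R[OF t] nh by (intro rate[OF f]) auto
          also have "\<dots> = C / \<phi> (R t) powr \<delta> * W y powr \<delta>" using W0[of y] \<phi>R[OF t] by (simp add: powr_divide)
          finally show "ennreal \<bar>g y - (\<integral>y. f y \<partial>\<pi>)\<bar> \<le> ennreal (C / \<phi> (R t) powr \<delta>) * ennreal (W y powr \<delta>)"
            using C by (subst ennreal_mult[symmetric]) (auto intro: ennreal_leI)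
        qed
        also have "\<dots> = ennreal (C / \<phi> (R t) powr \<delta>) * (\<integral>\<^sup>+y. ennreal (W y powr \<delta>) \<partial>P s x)"
          by (rule nn_integral_cmult) measurable
        also have "\<dots> \<le> ennreal (C / \<phi> (R t) powr \<delta>) * ennreal (u powr \<delta>)"
          using Hl by (intro mult_left_mono) auto
        also have "\<dots> = ennreal (C / \<phi> (R t) powr \<delta> * u powr \<delta>)" using C by (subst ennreal_mult) auto
        finally have 1: "(\<integral>y. \<bar>g y - (\<integral>y. f y \<partial>\<pi>)\<bar> \<partial>P s x) \<le> C / \<phi> (R t) powr \<delta> * u powr \<delta>"
          using C by (subst (asm) ennreal_le_iff) auto
        have "u \<le> a2 * (1 + \<phi> (V x))"
        proof -
          have "c * K * s \<le> c * K * h" using s c_pos K_pos by (intro mult_left_mono) auto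
          then have "a1 * (c * K * s) \<le> a1 * (c * K * h)" using vV(3) by (rule mult_left_mono)
          moreover have "a1 * \<phi> (V x) \<le> a2 * \<phi> (V x)" using \<phi>V vV C cK by (intro mult_right_mono) (auto simp: a2_def)
          ultimately show ?thesis using vV(3) unfolding u_def distrib_left by (simp add: a2_def)
        qed
        then have "u powr \<delta> \<le> (a2 * (1 + \<phi> (V x))) powr \<delta>" using u \<delta> by (intro powr_mono2) auto
        also have "\<dots> = a2 powr \<delta> * (1 + \<phi> (V x)) powr \<delta>" using a2 \<phi>V by (simp add: powr_mult)
        also have "\<dots> \<le> a2 powr \<delta> * (2 * (1 + \<phi> (V x) powr \<delta>))"
          by (intro mult_left_mono one_plus_powr_le \<phi>V \<delta>) auto
        finally have "C / \<phi> (R t) powr \<delta> * u powr \<delta> \<le> C / \<phi> (R t) powr \<delta> * (a2 powr \<delta> * (2 * (1 + \<phi> (V x) powr \<delta>)))"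
          using C by (intro mult_left_mono) auto
        also have "\<dots> = (C * a2 powr \<delta> * 2) * (1 + \<phi> (V x) powr \<delta>) / \<phi> (R t) powr \<delta>" by simp
        also have "\<dots> \<le> C1 * (1 + \<phi> (V x) powr \<delta>) / \<phi> (R t) powr \<delta>"
          by (intro divide_right_mono mult_right_mono) (auto simp: C1_def)
        finally show ?thesis using 1 by linarith
      qed
      finally show ?thesis .
    qed
  qed
  then show ?thesis using C1 C2 unfolding R_def by blast
qed

end

theorem theorem2p7:
  fixes P :: "real \<Rightarrow> 'a::polish_space \<Rightarrow> 'a measure"
    and V :: "'a \<Rightarrow> real" and \<phi> :: "real \<Rightarrow> real" and K :: real
    and \<theta> :: "'a \<Rightarrow> 'a \<Rightarrow> real" and r L :: "real \<Rightarrow> real" and t0 :: real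
  assumes markov: "markov_tf P"
    and feller: "feller P"
    and V_meas: "V \<in> borel_measurable borel" and V_nonneg: "\<forall>x. V x \<ge> 0"
    and phi_concave: "concave_on {0..} \<phi>"
    and phi_diff: "\<forall>s\<ge>0. \<phi> differentiable (at s within {0..})"
    and phi_nonneg: "\<forall>s\<ge>0. \<phi> s \<ge> 0"
    and phi_mono: "mono_on {0..} \<phi>"
    and phi_infty: "filterlim \<phi> at_top at_top"
    and phi_0: "\<phi> 0 = 0"
    and K_pos: "K > 0"
    and lyapunov: "\<forall>t\<ge>0. \<forall>x.
        (\<integral>\<^sup>+ y. ennreal (V y) \<partial>P t x)
          + (\<integral>\<^sup>+ s\<in>{0..t}. (\<integral>\<^sup>+ y. ennreal (\<phi> (V y)) \<partial>P s x) \<partial>lborel)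
        \<le> ennreal (V x + K * t)"
    and theta_premetric: "premetric \<theta>"
    and theta_ge: "\<forall>x y. min (dist x y) 1 \<le> \<theta> x y"
    and assmA: "assumption_A TYPE('w) P \<theta> r L"
    and t0_pos: "t0 > 0"
    and assmB1: "\<forall>M>0. assumption_B1 P \<theta> {x. V x \<le> M} t0"
  shows "\<exists>\<pi>. invariant_prob P \<pi> \<and> (\<forall>\<pi>'. invariant_prob P \<pi>' \<longrightarrow> \<pi>' = \<pi>) \<and>
     (\<forall>\<delta>. 0 < \<delta> \<and> \<delta> < 1 \<longrightarrow> (\<exists>C1>0. \<exists>C2>0. \<forall>x. \<forall>t\<ge>0.
        wasserstein (\<lambda>x y. min (dist x y) 1) (P t x) \<pi>
          \<le> ennreal (C1 * (1 + \<phi> (V x) powr \<delta>) / \<phi> (H_phi_inv \<phi> (C2 * t)) powr \<delta>)))"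
proof -
  interpret concave_rate \<phi>
    by unfold_locales (use phi_concave phi_diff phi_nonneg phi_mono phi_infty phi_0 in auto)
  obtain c where c: "c > 0" "\<And>z. z \<ge> 0 \<Longrightarrow> \<phi> z \<le> c * z" using phi_linear_bound by blast
  interpret lyapunov_semigroup P \<phi> V K c
  proof unfold_locales
    show "(\<integral>\<^sup>+ y. ennreal (V y) \<partial>P t x) + (\<integral>\<^sup>+ s\<in>{0..t}. (\<integral>\<^sup>+ y. ennreal (\<phi> (V y)) \<partial>P s x) \<partial>lborel)
        \<le> ennreal (V x + K * t)" if "t \<ge> 0" for t x
      using lyapunov that by blast
  qed (simp_all add: markov V_meas V_nonneg K_pos c)
  obtain N T where N: "N \<ge> 1" "T \<ge> 0" and local:
    "\<And>q J g x y B. 0 < q \<Longrightarrow> q < 1 \<Longrightarrow> weight T J \<Longrightarrow> osc_bound (\<lambda>u v. min 1 (N * \<theta> u v)) q J g \<Longrightarrow> x \<noteq> y \<Longrightarrow> 0 < B \<Longrightarrow>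
       (\<integral>\<^sup>+u. ennreal (J u) \<partial>P (t0 + T) x) + (\<integral>\<^sup>+u. ennreal (J u) \<partial>P (t0 + T) y) \<le> ennreal B \<Longrightarrow>
       \<bar>(\<integral>u. g u \<partial>P (t0 + T) x) - (\<integral>u. g u \<partial>P (t0 + T) y)\<bar> \<le> (min 1 (N * \<theta> x y / 2)) powr (1 - q) * B powr q"
    and small: "\<And>M. M > 0 \<Longrightarrow> \<exists>\<kappa>. 0 < \<kappa> \<and> \<kappa> < 1 \<and> (\<forall>q J g x y B. 0 < q \<longrightarrow> q < 1 \<longrightarrow> weight T J \<longrightarrow>
       osc_bound (\<lambda>u v. min 1 (N * \<theta> u v)) q J g \<longrightarrow> V x \<le> M \<longrightarrow> V y \<le> M \<longrightarrow> 0 < B \<longrightarrow>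
       (\<integral>\<^sup>+u. ennreal (J u) \<partial>P (t0 + T) x) + (\<integral>\<^sup>+u. ennreal (J u) \<partial>P (t0 + T) y) \<le> ennreal B \<longrightarrow>
       \<bar>(\<integral>u. g u \<partial>P (t0 + T) x) - (\<integral>u. g u \<partial>P (t0 + T) y)\<bar> \<le> (1 - \<kappa>) powr (1 - q) * B powr q)"
  proof (rule harris_step[OF assmA theta_premetric t0_pos])
    show "assumption_B1 P \<theta> {x. V x \<le> M} t0" if "M > 0" for M using assmB1 that by blast
  qed (rule that)
  define h where "h = t0 + T"
  have h: "h > 0" using t0_pos N by (simp add: h_def)
  obtain A M K1 \<eta> where const_bounds: "1 \<le> A" "0 < M" "0 < K1" "0 < \<eta>" "K1 \<le> \<eta> / 4 * \<phi> A"
    and drift1: "\<And>x. (\<integral>\<^sup>+ y. ennreal (A + V y + h * \<phi> (V y)) \<partial>P h x) \<le> ennreal (A + V x + h * \<phi> (V x) + K1)"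
    and drift2: "\<And>x. M \<le> A + V x + h * \<phi> (V x) \<Longrightarrow>
      \<eta> * \<phi> (A + V x + h * \<phi> (V x)) \<le> A + V x + h * \<phi> (V x) \<and>
      (\<integral>\<^sup>+ y. ennreal (A + V y + h * \<phi> (V y)) \<partial>P h x) \<le> ennreal (A + V x + h * \<phi> (V x) - \<eta> * \<phi> (A + V x + h * \<phi> (V x)))"
    using shifted_drift[OF h] by blast
  obtain \<kappa> where \<kappa>: "0 < \<kappa>" "\<kappa> < 1" and small\<kappa>: "\<And>q J g x y B. 0 < q \<Longrightarrow> q < 1 \<Longrightarrow> weight T J \<Longrightarrow>
       osc_bound (\<lambda>u v. min 1 (N * \<theta> u v)) q J g \<Longrightarrow> V x \<le> M \<Longrightarrow> V y \<le> M \<Longrightarrow> 0 < B \<Longrightarrow>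
       (\<integral>\<^sup>+u. ennreal (J u) \<partial>P h x) + (\<integral>\<^sup>+u. ennreal (J u) \<partial>P h y) \<le> ennreal B \<Longrightarrow>
       \<bar>(\<integral>u. g u \<partial>P h x) - (\<integral>u. g u \<partial>P h y)\<bar> \<le> (1 - \<kappa>) powr (1 - q) * B powr q"
    using small[OF const_bounds(2)] unfolding h_def by blast
  define v where "v x = A + V x + h * \<phi> (V x)" for x
  have \<phi>V: "0 \<le> h * \<phi> (V x)" for x using h nonneg V_nonneg by simp
  have Vv: "V x \<le> v x" "A \<le> v x" for x
    using \<phi>V[of x] const_bounds(1) V_nonneg[rule_format, of x] by (auto simp: v_def)
  have v_fin: "(\<integral>\<^sup>+ y. ennreal (v y) \<partial>P T u) < \<infinity>" for u
  proof -
    have [measurable_cong]: "sets (P T u) = sets borel" by (rule sets_P[OF N(2)])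
    have "(\<integral>\<^sup>+ y. ennreal (v y) \<partial>P T u) \<le> ennreal (A + (1 + h * c) * (V u + K * T))"
    proof (rule nn_integral_affine_bound[OF prob_P[OF N(2)], where v=V])
      fix z
      show "0 \<le> v z" using Vv[of z] const_bounds(1) by linarith
      have "h * \<phi> (V z) \<le> h * (c * V z)" using h c V_nonneg by (intro mult_left_mono) auto
      then show "v z \<le> A + (1 + h * c) * V z" by (simp add: v_def algebra_simps)
    qed (use V_growth[OF N(2)] V_nonneg K_pos N h c in auto)
    then show ?thesis by (rule le_less_trans) simp
  qed
  interpret harris_chain P \<phi> V K c \<theta> N T h A M K1 \<eta> \<kappa> v
  proof unfold_locales
    show "v \<in> borel_measurable borel" unfolding v_def by measurable
    show "bdist x y \<le> \<theta> x y" for x y using theta_ge by (simp add: bdist_def)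
    \<comment> \<open>Since V \<le> v, the sublevel set of v lies in the sublevel set of V to which
      B1 applies.\<close>
    show "\<bar>(\<integral>u. g u \<partial>P h x) - (\<integral>u. g u \<partial>P h y)\<bar> \<le> (1 - \<kappa>) powr (1 - q) * B powr q"
      if "0 < q" "q < 1" "weight T J" "osc_bound (\<lambda>u v. min 1 (N * \<theta> u v)) q J g" "v x \<le> M" "v y \<le> M" "0 < B"
       "(\<integral>\<^sup>+u. ennreal (J u) \<partial>P h x) + (\<integral>\<^sup>+u. ennreal (J u) \<partial>P h y) \<le> ennreal B" for q J g x y B
      using that Vv(1)[of x] Vv(1)[of y] by (intro small\<kappa>) auto
  qed (use h N theta_premetric local[folded h_def] \<kappa> Vv const_bounds drift1 drift2 v_fin in \<open>auto simp: v_def\<close>)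
  \<comment> \<open>The averages start from an arbitrary point; by \<open>invariant_unique\<close>
    the limit does not depend on it.\<close>
  obtain \<pi> m where \<pi>: "prob_space \<pi>" "sets \<pi> = sets borel" "\<pi> \<bind> P h = \<pi>" and m: "\<And>k. 0 < m k"
    and lim: "\<And>g::'a \<Rightarrow> real. continuous_on UNIV g \<Longrightarrow> bounded (range g) \<Longrightarrow> (\<lambda>k. \<integral>x. g x \<partial>avg undefined (m k)) \<longlonglongrightarrow> (\<integral>x. g x \<partial>\<pi>)"
    by (rule invariant_exists[OF feller, where ?x0.0=undefined]) (rule that)
  have h0: "0 \<le> h" using h by simp
  have bind_em: "emeasure (\<mu> \<bind> P t) B = (\<integral>\<^sup>+ x. emeasure (P t x) B \<partial>\<mu>)"
    if "prob_space \<mu>" "sets \<mu> = sets borel" "0 \<le> t" "B \<in> sets borel" for \<mu> t B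
    using that kernel_P by (intro emeasure_bind_prob_algebra[where N=borel]) (auto simp: space_prob_algebra)
  \<comment> \<open>Invariance passes from the skeleton to all times: \<open>P t\<close> and
    \<open>P h\<close> commute, so the image of \<pi> under \<open>P t\<close> is again invariant
    for the skeleton and equals \<pi> by uniqueness.\<close>
  have inv: "\<pi> \<bind> P t = \<pi>" if t: "0 \<le> t" for t
  proof (rule invariant_unique[OF bind_P[OF \<pi>(1,2) t] _ \<pi>])
    have assoc: "(\<pi> \<bind> P a) \<bind> P b = \<pi> \<bind> P (a + b)" if "0 \<le> a" "0 \<le> b" for a b
    proof -
      have "(\<pi> \<bind> P a) \<bind> P b = \<pi> \<bind> (\<lambda>x. P a x \<bind> P b)"
        by (rule bind_assoc[OF subkernel_P'[OF that(1) \<pi>(2)] subkernel_P[OF that(2)]])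
      moreover have "(\<lambda>x. P a x \<bind> P b) = P (a + b)" by (rule ext) (rule P_add[OF that, symmetric])
      ultimately show ?thesis by simp
    qed
    have "(\<pi> \<bind> P t) \<bind> P h = (\<pi> \<bind> P h) \<bind> P t"
      using assoc[OF t h0] assoc[OF h0 t] by (simp add: add.commute)
    then show "(\<pi> \<bind> P t) \<bind> P h = \<pi> \<bind> P t" by (simp add: \<pi>(3))
  qed
  have "invariant_prob P \<pi>"
    unfolding invariant_prob_def using \<pi>(1,2) bind_em[OF \<pi>(1,2)] inv by auto
  moreover have "\<pi>' = \<pi>" if \<pi>': "invariant_prob P \<pi>'" for \<pi>'
  proof (rule invariant_unique[OF _ _ _ \<pi>])
    show p: "prob_space \<pi>'" "sets \<pi>' = sets borel" using \<pi>' by (auto simp: invariant_prob_def)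
    show "\<pi>' \<bind> P h = \<pi>'"
    proof (rule measure_eqI)
      show s: "sets (\<pi>' \<bind> P h) = sets \<pi>'" using bind_P(2)[OF p h0] p by simp
      fix B assume "B \<in> sets (\<pi>' \<bind> P h)"
      then have "B \<in> sets borel" using s p by simp
      then show "emeasure (\<pi>' \<bind> P h) B = emeasure \<pi>' B"
        using bind_em[OF p h0] \<pi>' h0 by (auto simp: invariant_prob_def)
    qed
  qed
  moreover have "\<exists>C1>0. \<exists>C2>0. \<forall>x. \<forall>t\<ge>0. wasserstein (\<lambda>x y. min (dist x y) 1) (P t x) \<pi>
          \<le> ennreal (C1 * (1 + \<phi> (V x) powr \<delta>) / \<phi> (H_phi_inv \<phi> (C2 * t)) powr \<delta>)" if \<delta>: "0 < \<delta>" "\<delta> < 1" for \<delta>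
  proof (rule continuous_time_rate[OF feller \<delta> \<pi> m lim])
    show "\<phi> (v x) \<le> \<phi> A + (1 + c * h) * \<phi> (V x)" for x
    proof -
      have "\<phi> (v x) \<le> \<phi> (A + V x) + \<phi> (h * \<phi> (V x))"
        unfolding v_def using const_bounds V_nonneg \<phi>V[of x] by (intro phi_subadd) auto
      also have "\<dots> \<le> (\<phi> A + \<phi> (V x)) + c * (h * \<phi> (V x))"
        using const_bounds V_nonneg \<phi>V[of x] c by (intro add_mono phi_subadd) auto
      finally show ?thesis by (simp add: algebra_simps)
    qed
    show "0 \<le> \<phi> A" using const_bounds nonneg by simp
    show "0 \<le> 1 + c * h" using c h by simp
  qed
  ultimately show ?thesis by blast
qed

end
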